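(* Let $n\ge2$. For every $\theta>0$ and every $\mathbf z\in\mathbb R^n$ the total energy $\mathcal T:=E_{\mathrm b}+\theta\,E^{2,1}$ restricted to the arclength submanifold $\mathcal A^2_{\mathbf z}\subset H^2(\mathbb R/\mathbb Z,\mathbb R^n)$ satisfies the Palais–Smale condition.
   Context: $\mathbb R/\mathbb Z$ is the circle of length $1$. $H^2(\mathbb R/\mathbb Z,\mathbb R^n)=W^{2,2}(\mathbb R/\mathbb Z,\mathbb R^n)$ with inner product $\langle f,h\rangle_{H^2}=\int_{\mathbb R/\mathbb Z}(\langle f,h\rangle+\langle f',h'\rangle+\langle f'',h''\rangle)\,du$. The set $$\mathcal A^2_{\mathbf z}:=\{\gamma\in H^2(\mathbb R/\mathbb Z,\mathbb R^n):\gamma|_{[0,1)}\text{ injective},\ |\gamma'|=1,\ \gamma(0)=\mathbf z\}$$ is a smooth submanifold of the open set of regular ($|\gamma'|>0$) curves in $H^2$ that are injective on $[0,1)$; its tangent space at $\gamma$ is $\{h\in H^2:\langle\gamma',h'\rangle=0,\ h(0)=0\}$, equipped with the $H^2$-norm. Bending energy: $E_{\mathrm b}(\gamma)=\frac12\int_\gamma\kappa^2\,ds$, with $\kappa=|\partial_s^2\gamma|$ the curvature, $\partial_s=|\gamma'|^{-1}\partial_u$, $ds=|\gamma'(u)|\,du$. Möbius energy: $E^{2,1}(\gamma)=\int_{\mathbb R/\mathbb Z}\int_{\mathbb R/\mathbb Z}\Big(\frac1{|\gamma(u)-\gamma(v)|^2}-\frac1{d_\gamma(u,v)^2}\Big)|\gamma'(u)||\gamma'(v)|\,du\,dv$,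 where $d_\gamma(u,v)$ is the intrinsic distance along the closed curve between $\gamma(u)$ and $\gamma(v)$. Palais–Smale condition: for a $C^1$ function $\mathcal E$ on a smooth Banach manifold $\mathcal M$, a Palais–Smale sequence is a sequence $(x_k)\subset\mathcal M$ with $\sup_k\mathcal E(x_k)<\infty$ and $\|D\mathcal E_{x_k}\|_{(T_{x_k}\mathcal M)^*}\to0$. $\mathcal E$ satisfies the Palais–Smale condition if every Palais–Smale sequence has a subsequence converging to a point of $\mathcal M$. *)

theory Defs
  imports "HOL-Analysis.Analysis"
begin

section \<open>The Sobolev space of the circle of length 1\<close>

text \<open>
  Functions on the circle are 1-periodic functions on the reals, and integrals over the circle are
  integrals over the fundamental domain. Of weak derivatives only the values on that domain matter.
\<close>

definition circle :: "real measure" where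
  "circle = restrict_space lborel {0..<1}"

definition sq_integrable :: "(real \<Rightarrow> 'a::euclidean_space) \<Rightarrow> bool" where
  "sq_integrable f \<longleftrightarrow> f \<in> borel_measurable circle \<and> integrable circle (\<lambda>u. (norm (f u))\<^sup>2)"

definition smooth_periodic :: "(real \<Rightarrow> real) \<Rightarrow> bool" where
  "smooth_periodic \<phi> \<longleftrightarrow>
     (\<forall>k u. (deriv ^^ k) \<phi> differentiable (at u)) \<and> (\<forall>u. \<phi> (u + 1) = \<phi> u)"

definition has_weak_deriv :: "(real \<Rightarrow> 'a::euclidean_space) \<Rightarrow> (real \<Rightarrow> 'a) \<Rightarrow> bool" where
  "has_weak_deriv f g \<longleftrightarrow> integrable circle f \<and> integrable circle g \<and>
     (\<forall>\<phi>. smooth_periodic \<phi> \<longrightarrow>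
        (LINT u|circle. deriv \<phi> u *\<^sub>R f u) = - (LINT u|circle. \<phi> u *\<^sub>R g u))"

text \<open>A representative; it is determined up to null sets by \<open>has_weak_deriv_unique\<close> below.\<close>

definition weak_deriv :: "(real \<Rightarrow> 'a::euclidean_space) \<Rightarrow> real \<Rightarrow> 'a" where
  "weak_deriv f = (SOME g. has_weak_deriv f g)"


subsection \<open>Uniqueness of weak derivatives\<close>

lemma space_circle [simp]: "space circle = {0..<1}"
  by (simp add: circle_def space_restrict_space)

lemma sets_circle: "sets circle = sets (restrict_space borel {0..<1})"
  unfolding circle_def by (intro sets_restrict_space_cong) auto

lemma borel_measurable_circleI: "f \<in> borel_measurable borel \<Longrightarrow> f \<in> borel_measurable circle"
  by (simp add: circle_def measurable_restrict_space1)

lemma emeasure_circle: "emeasure circle {0..<1} = 1"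
  by (simp add: circle_def emeasure_restrict_space)

interpretation circle: finite_measure circle
  by standard (simp add: emeasure_circle)

lemma integrable_circle_scaleR:
  fixes g :: "real \<Rightarrow> 'a::euclidean_space"
  assumes "integrable circle g" "\<phi> \<in> borel_measurable circle"
    and "\<And>u. u \<in> {0..<1} \<Longrightarrow> \<bar>\<phi> u\<bar> \<le> B"
  shows "integrable circle (\<lambda>u. \<phi> u *\<^sub>R g u)"
proof (rule Bochner_Integration.integrable_bound)
  show "integrable circle (\<lambda>u. B *\<^sub>R g u)" using assms(1) by simp
  show "(\<lambda>u. \<phi> u *\<^sub>R g u) \<in> borel_measurable circle"
    using assms(1,2) by (intro borel_measurable_scaleR) auto
  show "AE u in circle. norm (\<phi> u *\<^sub>R g u) \<le> norm (B *\<^sub>R g u)"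
  proof (rule AE_I2)
    fix u assume "u \<in> space circle"
    then have "\<bar>\<phi> u\<bar> \<le> \<bar>B\<bar>" using assms(3)[of u] by simp
    then show "norm (\<phi> u *\<^sub>R g u) \<le> norm (B *\<^sub>R g u)" by (simp add: mult_right_mono)
  qed
qed

lemma smooth_periodic_derivs:
  assumes "smooth_periodic \<phi>"
  shows "continuous_on UNIV \<phi>" "continuous_on UNIV (deriv \<phi>)"
proof -
  have d: "(deriv ^^ k) \<phi> differentiable (at u)" for k u
    using assms unfolding smooth_periodic_def by blast
  have "\<phi> differentiable (at u)" "deriv \<phi> differentiable (at u)" for u
    using d[of 0 u] d[of 1 u] by simp_all
  then show "continuous_on UNIV \<phi>" "continuous_on UNIV (deriv \<phi>)"
    by (auto intro!: continuous_at_imp_continuous_on differentiable_imp_continuous_within)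
qed

lemma integrable_circle_continuous_scaleR:
  fixes g :: "real \<Rightarrow> 'a::euclidean_space"
  assumes "integrable circle g" "continuous_on UNIV \<phi>"
  shows "integrable circle (\<lambda>u. \<phi> u *\<^sub>R g u)"
proof -
  have "compact (\<phi> ` {0..1})"
    using assms(2) by (intro compact_continuous_image continuous_on_subset[OF assms(2)]) auto
  then obtain B where "\<forall>x\<in>\<phi> ` {0..1}. norm x \<le> B"
    using compact_imp_bounded bounded_iff by metis
  then show ?thesis
    by (intro integrable_circle_scaleR[of _ _ B] assms borel_measurable_circleI
          borel_measurable_continuous_onI) auto
qed

lemma trig_has_derivative:
  assumes "real_polynomial_function (p :: complex \<Rightarrow> real)"
  shows "\<exists>q. real_polynomial_function q \<and>
    (\<forall>u. ((\<lambda>u. p (cis (2 * pi * u))) has_real_derivative q (cis (2 * pi * u))) (at u))"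
  using assms
proof induction
  case (linear f)
  let ?q = "\<lambda>z. f (2 * pi * \<i> * z)"
  have "bounded_linear ?q"
    using bounded_linear_compose[OF linear bounded_linear_mult_right] by simp
  moreover have "((\<lambda>u. f (cis (2 * pi * u))) has_real_derivative ?q (cis (2 * pi * u))) (at u)" for u
  proof -
    have "((\<lambda>u. cis (2 * pi * u)) has_vector_derivative (2 * pi * \<i> * cis (2 * pi * u))) (at u)"
      unfolding has_vector_derivative_def
      by (auto intro!: derivative_eq_intros simp: scaleR_conv_of_real algebra_simps)
    then show ?thesis
      using bounded_linear.has_vector_derivative[OF linear]
      by (simp add: has_real_derivative_iff_has_vector_derivative)
  qed
  ultimately show ?case by blast
next
  case (const c)
  show ?case by (rule exI[of _ "\<lambda>_. 0"]) auto
next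
  case (add f g)
  then obtain qf qg where
    "real_polynomial_function qf" "real_polynomial_function qg"
    "\<And>u. ((\<lambda>u. f (cis (2 * pi * u))) has_real_derivative qf (cis (2 * pi * u))) (at u)"
    "\<And>u. ((\<lambda>u. g (cis (2 * pi * u))) has_real_derivative qg (cis (2 * pi * u))) (at u)"
    by blast
  then show ?case
    by (intro exI[of _ "\<lambda>z. qf z + qg z"]) (auto intro!: DERIV_add)
next
  case (mult f g)
  then obtain qf qg where
    "real_polynomial_function qf" "real_polynomial_function qg"
    "\<And>u. ((\<lambda>u. f (cis (2 * pi * u))) has_real_derivative qf (cis (2 * pi * u))) (at u)"
    "\<And>u. ((\<lambda>u. g (cis (2 * pi * u))) has_real_derivative qg (cis (2 * pi * u))) (at u)"
    by blast
  then show ?case using mult.hyps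
    by (intro exI[of _ "\<lambda>z. qf z * g z + qg z * f z"]) (auto intro!: DERIV_mult)
qed

lemma smooth_periodic_trig:
  assumes "real_polynomial_function (p :: complex \<Rightarrow> real)"
  shows "smooth_periodic (\<lambda>u. p (cis (2 * pi * u)))"
proof -
  have "\<exists>q. real_polynomial_function q \<and>
      (deriv ^^ k) (\<lambda>u. p (cis (2 * pi * u))) = (\<lambda>u. q (cis (2 * pi * u)))" for k
  proof (induction k)
    case 0
    then show ?case using assms by auto
  next
    case (Suc k)
    then obtain q where q: "real_polynomial_function q"
      "(deriv ^^ k) (\<lambda>u. p (cis (2 * pi * u))) = (\<lambda>u. q (cis (2 * pi * u)))" by blast
    from trig_has_derivative[OF q(1)] obtain r where r: "real_polynomial_function r"
      "\<And>u. ((\<lambda>u. q (cis (2 * pi * u))) has_real_derivative r (cis (2 * pi * u))) (at u)" by blast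
    show ?case
      using r(1) DERIV_imp_deriv[OF r(2)] by (auto simp: q(2) intro!: exI[of _ r])
  qed
  note derivs = this
  have "(deriv ^^ k) (\<lambda>u. p (cis (2 * pi * u))) differentiable (at u)" for k u
  proof -
    from derivs[of k] obtain q where q: "real_polynomial_function q"
      "(deriv ^^ k) (\<lambda>u. p (cis (2 * pi * u))) = (\<lambda>u. q (cis (2 * pi * u)))" by blast
    from trig_has_derivative[OF q(1)] show ?thesis
      unfolding q(2) real_differentiable_def by blast
  qed
  moreover have "cis (2 * pi * (u + 1)) = cis (2 * pi * u)" for u
    by (simp add: ring_distribs flip: cis_mult)
  ultimately show ?thesis by (simp add: smooth_periodic_def)
qed

lemma smooth_periodic_orthogonal_closed:
  fixes g :: "real \<Rightarrow> 'a::euclidean_space" and C :: "complex set"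
  assumes g: "integrable circle g"
    and orth: "\<And>\<phi>. smooth_periodic \<phi> \<Longrightarrow> (LINT u|circle. \<phi> u *\<^sub>R g u) = 0"
    and C: "closed C"
  shows "(LINT u|circle. indicator C (cis (2 * pi * u)) *\<^sub>R g u) = 0"
proof (cases "C = {}")
  case False
  have meas: "(\<lambda>u. F (cis (2 * pi * u))) \<in> borel_measurable circle"
    if "F \<in> borel_measurable borel" for F :: "complex \<Rightarrow> real"
  proof -
    have "(\<lambda>u::real. cis (2 * pi * u)) \<in> borel_measurable borel"
      by (intro borel_measurable_continuous_onI continuous_intros)
    then show ?thesis using measurable_compose[OF _ that] by (intro borel_measurable_circleI)
  qed
  have cont0: "(LINT u|circle. F (cis (2 * pi * u)) *\<^sub>R g u) = 0"
    if F: "continuous_on UNIV F" for F :: "complex \<Rightarrow> real"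
  proof -
    let ?I = "LINT u|circle. F (cis (2 * pi * u)) *\<^sub>R g u"
    let ?G = "LINT u|circle. norm (g u)"
    have cF: "continuous_on UNIV (\<lambda>u. F (cis (2 * pi * u)))"
      by (intro continuous_on_compose2[OF F] continuous_intros) auto
    have est: "norm ?I \<le> e * ?G" if "e > 0" for e
    proof -
      obtain p where p: "real_polynomial_function p"
        "\<And>x. x \<in> sphere 0 1 \<Longrightarrow> \<bar>F x - p x\<bar> < e"
        using Stone_Weierstrass_real_polynomial_function[of "sphere 0 1" F e] \<open>e > 0\<close>
          continuous_on_subset[OF F] by auto
      let ?p = "\<lambda>u. p (cis (2 * pi * u))"
      note sp = smooth_periodic_trig[OF p(1)]
      have ip: "integrable circle (\<lambda>u. ?p u *\<^sub>R g u)"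
        by (rule integrable_circle_continuous_scaleR[OF g smooth_periodic_derivs(1)[OF sp]])
      have iF: "integrable circle (\<lambda>u. F (cis (2 * pi * u)) *\<^sub>R g u)"
        by (rule integrable_circle_continuous_scaleR[OF g cF])
      have "?I = (LINT u|circle. (F (cis (2 * pi * u)) - ?p u) *\<^sub>R g u)"
        using ip iF orth[OF sp] by (simp add: scaleR_diff_left)
      also have "norm \<dots> \<le> (LINT u|circle. e * norm (g u))"
      proof (rule Bochner_Integration.integral_norm_bound_integral)
        show "integrable circle (\<lambda>u. (F (cis (2 * pi * u)) - ?p u) *\<^sub>R g u)"
          using ip iF by (simp add: scaleR_diff_left)
        show "integrable circle (\<lambda>u. e * norm (g u))" using g by simp
        show "norm ((F (cis (2 * pi * u)) - ?p u) *\<^sub>R g u) \<le> e * norm (g u)" for u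
          using p(2)[of "cis (2 * pi * u)"] by (simp add: mult_right_mono less_imp_le)
      qed
      finally show ?thesis by simp
    qed
    have "norm ?I \<le> 0"
    proof (rule field_le_epsilon)
      fix d :: real assume "d > 0"
      have "?G \<ge> 0" by simp
      have "d / (G + 1) * G \<le> d" if "G \<ge> 0" for G
        using that \<open>d > 0\<close> by (simp add: divide_le_eq algebra_simps)
      then have "d / (?G + 1) * ?G \<le> d" using \<open>?G \<ge> 0\<close> by blast
      then show "norm ?I \<le> 0 + d"
        using est[of "d / (?G + 1)"] \<open>d > 0\<close> \<open>?G \<ge> 0\<close>
        by (smt (verit) divide_pos_pos)
    qed
    then show ?thesis by simp
  qed
  let ?F = "\<lambda>n z. max 0 (1 - real n * infdist z C)"
  have lim: "(\<lambda>n. ?F n z) \<longlonglongrightarrow> indicator C z" for z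
  proof (cases "z \<in> C")
    case True
    then show ?thesis by simp
  next
    case no: False
    then have pos: "infdist z C > 0"
      using C False by (metis in_closed_iff_infdist_zero infdist_nonneg less_eq_real_def)
    then obtain N where N: "1 < real N * infdist z C" using reals_Archimedean3 by blast
    have "eventually (\<lambda>n. ?F n z = 0) sequentially"
      using eventually_ge_at_top[of N]
    proof eventually_elim
      case (elim n)
      then have "real N * infdist z C \<le> real n * infdist z C" using pos by simp
      then show ?case using N by simp
    qed
    then show ?thesis using no by (simp add: tendsto_eventually)
  qed
  have "(\<lambda>n. LINT u|circle. ?F n (cis (2 * pi * u)) *\<^sub>R g u)
      \<longlonglongrightarrow> (LINT u|circle. indicator C (cis (2 * pi * u)) *\<^sub>R g u)"
  proof (rule integral_dominated_convergence[where w = "\<lambda>u. norm (g u)"])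
    show "(\<lambda>u. indicator C (cis (2 * pi * u)) *\<^sub>R g u) \<in> borel_measurable circle"
      using g C by (intro borel_measurable_scaleR meas) auto
    show "(\<lambda>u. ?F n (cis (2 * pi * u)) *\<^sub>R g u) \<in> borel_measurable circle" for n
      using g by (intro borel_measurable_scaleR meas borel_measurable_integrable
          borel_measurable_continuous_onI continuous_intros)
    show "integrable circle (\<lambda>u. norm (g u))" using g by simp
    show "AE u in circle. (\<lambda>n. ?F n (cis (2 * pi * u)) *\<^sub>R g u)
        \<longlonglongrightarrow> indicator C (cis (2 * pi * u)) *\<^sub>R g u"
      by (intro AE_I2 tendsto_scaleR lim tendsto_const)
    have "\<bar>?F n z\<bar> \<le> 1" for n z by (simp add: infdist_nonneg)
    then show "AE u in circle. norm (?F n (cis (2 * pi * u)) *\<^sub>R g u) \<le> norm (g u)" for n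
      by (intro AE_I2) (simp add: mult_left_le_one_le)
  qed
  moreover have "(LINT u|circle. ?F n (cis (2 * pi * u)) *\<^sub>R g u) = 0" for n
    by (intro cont0 continuous_intros)
  ultimately show ?thesis by (simp add: LIMSEQ_const_iff)
qed simp

lemma indicator_arc:
  assumes "0 \<le> a" "a < 1" "u \<in> {0..<1}"
  shows "indicator ((\<lambda>v. cis (2 * pi * v)) ` {0..a}) (cis (2 * pi * u)) = (indicator {..a} u :: real)"
proof -
  have eq: "u = v" if "cis (2 * pi * u) = cis (2 * pi * v)" "v \<in> {0..a}" for v
  proof -
    have "cis (2 * pi * (u - v)) = 1"
      using that(1) by (simp add: right_diff_distrib flip: cis_divide)
    then have "cos (2 * pi * (u - v)) = 1" by (simp add: complex_eq_iff)
    then obtain n :: int where "2 * pi * (u - v) = of_int n * 2 * pi"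
      by (auto simp: cos_one_2pi_int)
    then have "2 * pi * (u - v) = 2 * pi * of_int n" by (simp add: mult_ac)
    then have "u - v = of_int n" by simp
    moreover have "\<bar>u - v\<bar> < 1" using that(2) assms by auto
    ultimately have "n = 0" by linarith
    then show ?thesis using \<open>u - v = of_int n\<close> by simp
  qed
  have "cis (2 * pi * u) \<in> (\<lambda>v. cis (2 * pi * v)) ` {0..a} \<longleftrightarrow> u \<le> a"
  proof
    assume "cis (2 * pi * u) \<in> (\<lambda>v. cis (2 * pi * v)) ` {0..a}"
    then obtain v where "cis (2 * pi * u) = cis (2 * pi * v)" "v \<in> {0..a}" by blast
    then show "u \<le> a" using eq[of v] by simp
  next
    assume "u \<le> a"
    then show "cis (2 * pi * u) \<in> (\<lambda>v. cis (2 * pi * v)) ` {0..a}" using assms(3) by simp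
  qed
  then show ?thesis by (simp add: indicator_def)
qed

lemma smooth_periodic_orthogonal_imp_zero:
  fixes g :: "real \<Rightarrow> 'a::euclidean_space"
  assumes g: "integrable circle g"
    and orth: "\<And>\<phi>. smooth_periodic \<phi> \<Longrightarrow> (LINT u|circle. \<phi> u *\<^sub>R g u) = 0"
  shows "AE u in circle. g u = 0"
proof (rule circle.density_zero[OF g])
  note [measurable] = borel_measurable_integrable[OF g]
  have idm [measurable]: "A \<inter> {0..<1} \<in> sets circle" if "A \<in> sets borel" for A
    using that by (auto simp: sets_circle sets_restrict_space)
  have imeas: "(indicator A :: real \<Rightarrow> real) \<in> borel_measurable circle"
    if "A \<in> sets borel" for A
    using that by (intro borel_measurable_circleI) auto
  have int: "integrable circle (\<lambda>u. indicator A u *\<^sub>R g u)" if "A \<in> sets borel" for A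
    by (rule integrable_circle_scaleR[OF g imeas[OF that], of 1]) (simp add: indicator_def)
  have total: "(LINT u|circle. g u) = 0"
    using smooth_periodic_orthogonal_closed[OF assms, of UNIV] by simp
  have gen: "(LINT u|circle. indicator {..a} u *\<^sub>R g u) = 0" for a :: real
  proof -
    consider "a < 0" | "0 \<le> a" "a < 1" | "1 \<le> a" by linarith
    then show ?thesis
    proof cases
      case 1
      then have "(LINT u|circle. indicator {..a} u *\<^sub>R g u) = (LINT u|circle. 0)"
        by (intro Bochner_Integration.integral_cong) (auto simp: indicator_def)
      then show ?thesis by simp
    next
      case 2
      let ?C = "(\<lambda>v. cis (2 * pi * v)) ` {0..a}"
      have "closed ?C"
        by (intro compact_imp_closed compact_continuous_image continuous_intros) auto
      then have "(LINT u|circle. indicator ?C (cis (2 * pi * u)) *\<^sub>R g u) = 0"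
        by (intro smooth_periodic_orthogonal_closed g orth)
      moreover have "(LINT u|circle. indicator {..a} u *\<^sub>R g u)
          = (LINT u|circle. indicator ?C (cis (2 * pi * u)) *\<^sub>R g u)"
        using indicator_arc[OF 2] by (intro Bochner_Integration.integral_cong) auto
      ultimately show ?thesis by simp
    next
      case 3
      then have "(LINT u|circle. indicator {..a} u *\<^sub>R g u) = (LINT u|circle. g u)"
        by (intro Bochner_Integration.integral_cong) (auto simp: indicator_def)
      then show ?thesis using total by simp
    qed
  qed
  have all: "(LINT u|circle. indicator A u *\<^sub>R g u) = 0" if "A \<in> sets borel" for A
  proof -
    have "Int_stable (range (\<lambda>a::real. {..a}))" by (auto simp: Int_stable_def)
    moreover have "range (\<lambda>a::real. {..a}) \<subseteq> Pow UNIV" by simp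
    moreover have "A \<in> sigma_sets UNIV (range (\<lambda>a::real. {..a}))"
      using that by (simp add: borel_eq_atMost)
    ultimately show ?thesis
    proof (induction rule: sigma_sets_induct_disjoint)
      case (basic A)
      then show ?case using gen by auto
    next
      case empty
      then show ?case by simp
    next
      case (compl A)
      have A: "A \<in> sets borel" using compl(1) by (simp add: borel_eq_atMost)
      have "(LINT u|circle. indicator (UNIV - A) u *\<^sub>R g u)
          = (LINT u|circle. g u - indicator A u *\<^sub>R g u)"
        by (intro Bochner_Integration.integral_cong) (auto simp: indicator_def)
      then show ?case using int[OF A] g compl total by simp
    next
      case (union A)
      have A: "A i \<in> sets borel" for i using union(2) by (auto simp: borel_eq_atMost)
      have U: "(\<Union>i. A i) \<in> sets borel" using A by auto
      have "(\<lambda>n. LINT u|circle. indicator (\<Union>i<n. A i) u *\<^sub>R g u)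
        \<longlonglongrightarrow> (LINT u|circle. indicator (\<Union>i. A i) u *\<^sub>R g u)"
      proof (rule integral_dominated_convergence[where w = "\<lambda>u. norm (g u)"])
        show "(\<lambda>u. indicator (\<Union>i. A i) u *\<^sub>R g u) \<in> borel_measurable circle"
          by (rule borel_measurable_integrable[OF int[OF U]])
        show "(\<lambda>u. indicator (\<Union>i<n. A i) u *\<^sub>R g u) \<in> borel_measurable circle" for n
          using A by (intro borel_measurable_integrable int sets.finite_UN) auto
        show "AE u in circle. (\<lambda>n. indicator (\<Union>i<n. A i) u *\<^sub>R g u)
            \<longlonglongrightarrow> indicator (\<Union>i. A i) u *\<^sub>R g u"
          by (intro AE_I2 tendsto_scaleR LIMSEQ_indicator_UN tendsto_const)
        show "integrable circle (\<lambda>u. norm (g u))" using g by simp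
        show "AE u in circle. norm (indicator (\<Union>i<n. A i) u *\<^sub>R g u) \<le> norm (g u)" for n
          by (intro AE_I2) (simp add: indicator_def)
      qed
      moreover have "(LINT u|circle. indicator (\<Union>i<n. A i) u *\<^sub>R g u) = 0" for n
      proof -
        have "(LINT u|circle. indicator (\<Union>i<n. A i) u *\<^sub>R g u)
            = (LINT u|circle. (\<Sum>i<n. indicator (A i) u *\<^sub>R g u))"
          using union(1)
          by (subst indicator_UN_disjoint)
             (auto simp: scaleR_sum_left intro: disjoint_family_on_mono)
        also have "\<dots> = (\<Sum>i<n. LINT u|circle. indicator (A i) u *\<^sub>R g u)"
          by (rule Bochner_Integration.integral_sum) (rule int[OF A])
        also have "\<dots> = 0" using union(3) by simp
        finally show ?thesis .
      qed
      ultimately show ?case by (simp add: LIMSEQ_const_iff)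
    qed
  qed
  fix A assume "A \<in> sets circle"
  then obtain B where "B \<in> sets borel" "A = {0..<1} \<inter> B"
    by (auto simp: sets_circle sets_restrict_space)
  moreover have "(LINT u|circle. indicator ({0..<1} \<inter> B) u *\<^sub>R g u)
      = (LINT u|circle. indicator B u *\<^sub>R g u)"
    by (intro Bochner_Integration.integral_cong) (auto simp: indicator_def)
  ultimately show "set_lebesgue_integral circle A g = 0"
    using all by (simp add: set_lebesgue_integral_def)
qed

lemma has_weak_deriv_unique:
  assumes "has_weak_deriv f g" "has_weak_deriv f h"
  shows "AE u in circle. g u = h u"
proof -
  have "AE u in circle. g u - h u = 0"
  proof (rule smooth_periodic_orthogonal_imp_zero)
    show "integrable circle (\<lambda>u. g u - h u)"
      using assms by (auto simp: has_weak_deriv_def)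
    fix \<phi> assume \<phi>: "smooth_periodic \<phi>"
    note c = integrable_circle_continuous_scaleR[OF _ smooth_periodic_derivs(1)[OF \<phi>]]
    have "(LINT u|circle. \<phi> u *\<^sub>R g u) = (LINT u|circle. \<phi> u *\<^sub>R h u)"
    proof -
      have "(LINT u|circle. deriv \<phi> u *\<^sub>R f u) = - (LINT u|circle. \<phi> u *\<^sub>R g u)"
        "(LINT u|circle. deriv \<phi> u *\<^sub>R f u) = - (LINT u|circle. \<phi> u *\<^sub>R h u)"
        using assms \<phi> unfolding has_weak_deriv_def by blast+
      then show ?thesis by simp
    qed
    moreover have "integrable circle (\<lambda>u. \<phi> u *\<^sub>R g u)" "integrable circle (\<lambda>u. \<phi> u *\<^sub>R h u)"
      using assms by (auto simp: has_weak_deriv_def intro!: c)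
    ultimately show "(LINT u|circle. \<phi> u *\<^sub>R (g u - h u)) = 0"
      by (simp add: scaleR_diff_right)
  qed
  then show ?thesis by simp
qed

lemma has_weak_deriv_weak_deriv:
  "has_weak_deriv f g \<Longrightarrow> has_weak_deriv f (weak_deriv f)"
  unfolding weak_deriv_def by (rule someI[of "has_weak_deriv f"])

lemma weak_deriv_AE_eq:
  "has_weak_deriv f g \<Longrightarrow> AE u in circle. weak_deriv f u = g u"
  using has_weak_deriv_unique has_weak_deriv_weak_deriv by blast

lemma has_weak_deriv_zero: "has_weak_deriv (\<lambda>_. 0) (\<lambda>_. 0)"
  by (simp add: has_weak_deriv_def)

lemma has_weak_deriv_add:
  assumes "has_weak_deriv f f'" "has_weak_deriv g g'"
  shows "has_weak_deriv (\<lambda>u. f u + g u) (\<lambda>u. f' u + g' u)"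
  unfolding has_weak_deriv_def
proof (intro conjI allI impI)
  show "integrable circle (\<lambda>u. f u + g u)" "integrable circle (\<lambda>u. f' u + g' u)"
    using assms by (auto simp: has_weak_deriv_def)
  fix \<phi> assume \<phi>: "smooth_periodic \<phi>"
  note c = integrable_circle_continuous_scaleR[OF _ smooth_periodic_derivs(1)[OF \<phi>]]
    integrable_circle_continuous_scaleR[OF _ smooth_periodic_derivs(2)[OF \<phi>]]
  have add: "(LINT u|circle. \<psi> u *\<^sub>R (h u + k u))
      = (LINT u|circle. \<psi> u *\<^sub>R h u) + (LINT u|circle. \<psi> u *\<^sub>R k u)"
    if "continuous_on UNIV \<psi>" "integrable circle h" "integrable circle k"
    for \<psi> and h k :: "real \<Rightarrow> 'a"
    unfolding scaleR_add_right
    using that by (intro Bochner_Integration.integral_add integrable_circle_continuous_scaleR)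
  show "(LINT u|circle. deriv \<phi> u *\<^sub>R (f u + g u)) = - (LINT u|circle. \<phi> u *\<^sub>R (f' u + g' u))"
    using assms \<phi> smooth_periodic_derivs[OF \<phi>] by (simp add: has_weak_deriv_def add)
qed

lemma has_weak_deriv_scaleR:
  assumes "has_weak_deriv f f'"
  shows "has_weak_deriv (\<lambda>u. r *\<^sub>R f u) (\<lambda>u. r *\<^sub>R f' u)"
  unfolding has_weak_deriv_def
proof (intro conjI allI impI)
  show "integrable circle (\<lambda>u. r *\<^sub>R f u)" "integrable circle (\<lambda>u. r *\<^sub>R f' u)"
    using assms by (auto simp: has_weak_deriv_def)
  fix \<phi> assume \<phi>: "smooth_periodic \<phi>"
  have "(LINT u|circle. \<psi> u *\<^sub>R r *\<^sub>R h u) = r *\<^sub>R (LINT u|circle. \<psi> u *\<^sub>R h u)"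
    for \<psi> and h :: "real \<Rightarrow> 'a"
    unfolding scaleR_left_commute[of _ r] by (rule integral_scaleR_right)
  then show "(LINT u|circle. deriv \<phi> u *\<^sub>R r *\<^sub>R f u) = - (LINT u|circle. \<phi> u *\<^sub>R r *\<^sub>R f' u)"
    using assms \<phi> by (simp add: has_weak_deriv_def)
qed

lemma has_weak_deriv_cong_AE:
  assumes "has_weak_deriv f f'" "AE u in circle. f u = g u" "g \<in> borel_measurable circle"
  shows "has_weak_deriv g f'"
proof -
  have fm: "f \<in> borel_measurable circle" using assms(1) by (auto simp: has_weak_deriv_def)
  have "integrable circle g"
    using assms fm integrable_cong_AE[of f circle g] by (simp add: has_weak_deriv_def)
  moreover have "(LINT u|circle. deriv \<phi> u *\<^sub>R f u) = (LINT u|circle. deriv \<phi> u *\<^sub>R g u)"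
    if "smooth_periodic \<phi>" for \<phi>
  proof (rule integral_cong_AE)
    have "deriv \<phi> \<in> borel_measurable circle"
      using smooth_periodic_derivs(2)[OF that]
      by (intro borel_measurable_circleI borel_measurable_continuous_onI)
    then show "(\<lambda>u. deriv \<phi> u *\<^sub>R f u) \<in> borel_measurable circle"
        "(\<lambda>u. deriv \<phi> u *\<^sub>R g u) \<in> borel_measurable circle"
      using fm assms(3) by auto
    show "AE u in circle. deriv \<phi> u *\<^sub>R f u = deriv \<phi> u *\<^sub>R g u"
      using assms(2) by eventually_elim simp
  qed
  ultimately show ?thesis using assms(1) by (simp add: has_weak_deriv_def)
qed

lemma sq_integrable_zero: "sq_integrable (\<lambda>_. 0)"
  by (simp add: sq_integrable_def)

lemma sq_integrable_inner:
  assumes "sq_integrable f" "sq_integrable g"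
  shows "integrable circle (\<lambda>u. f u \<bullet> g u)"
proof (rule Bochner_Integration.integrable_bound)
  show "integrable circle (\<lambda>u. (norm (f u))\<^sup>2 + (norm (g u))\<^sup>2)"
    using assms by (simp add: sq_integrable_def)
  show "(\<lambda>u. f u \<bullet> g u) \<in> borel_measurable circle"
    using assms by (auto simp: sq_integrable_def)
  have "\<bar>f u \<bullet> g u\<bar> \<le> (norm (f u))\<^sup>2 + (norm (g u))\<^sup>2" for u
    using Cauchy_Schwarz_ineq2[of "f u" "g u"] sum_squares_bound[of "norm (f u)" "norm (g u)"]
      norm_ge_zero[of "f u"] norm_ge_zero[of "g u"] mult_nonneg_nonneg[of "norm (f u)" "norm (g u)"]
    by linarith
  then show "AE u in circle. norm (f u \<bullet> g u) \<le> norm ((norm (f u))\<^sup>2 + (norm (g u))\<^sup>2)"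
    by simp
qed

lemma sq_integrable_add:
  assumes "sq_integrable f" "sq_integrable g"
  shows "sq_integrable (\<lambda>u. f u + g u)"
proof -
  have "(norm (f u + g u))\<^sup>2 = (norm (f u))\<^sup>2 + (norm (g u))\<^sup>2 + 2 * (f u \<bullet> g u)" for u
    by (simp add: power2_norm_eq_inner inner_add inner_commute)
  then show ?thesis
    using assms sq_integrable_inner[OF assms] by (auto simp: sq_integrable_def)
qed

lemma sq_integrable_scaleR: "sq_integrable f \<Longrightarrow> sq_integrable (\<lambda>u. r *\<^sub>R f u)"
  by (auto simp: sq_integrable_def power_mult_distrib)

lemma sq_integrable_cong_AE:
  assumes "sq_integrable f" "AE u in circle. f u = g u" "g \<in> borel_measurable circle"
  shows "sq_integrable g"
proof -
  have "integrable circle (\<lambda>u. (norm (f u))\<^sup>2) \<longleftrightarrow> integrable circle (\<lambda>u. (norm (g u))\<^sup>2)"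
    using assms by (intro integrable_cong_AE) (auto simp: sq_integrable_def)
  then show ?thesis using assms by (simp add: sq_integrable_def)
qed

lemma sq_integrable_continuous:
  assumes "continuous_on UNIV f"
  shows "sq_integrable f"
proof -
  have m: "f \<in> borel_measurable circle"
    using assms by (intro borel_measurable_circleI borel_measurable_continuous_onI)
  have "continuous_on UNIV (\<lambda>u. (norm (f u))\<^sup>2)" using assms by (intro continuous_intros)
  from integrable_circle_continuous_scaleR[OF _ this, of "\<lambda>_. 1 :: real"]
  show ?thesis using m by (simp add: sq_integrable_def)
qed


subsection \<open>The Hilbert space structure\<close>

text \<open>
  An element of \<open>W\<^sup>2\<^sup>,\<^sup>2\<close> is represented by its unique continuous periodic representative, so that
  pointwise evaluation makes sense.
\<close>

definition W22 :: "(real \<Rightarrow> 'a::euclidean_space) \<Rightarrow> bool" where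
  "W22 f \<longleftrightarrow> sq_integrable f \<and>
     (\<exists>f' f''. sq_integrable f' \<and> has_weak_deriv f f' \<and>
               sq_integrable f'' \<and> has_weak_deriv f' f'')"

lemma W22_zero: "W22 (\<lambda>_. 0)"
  unfolding W22_def using sq_integrable_zero has_weak_deriv_zero by blast

lemma W22_add:
  assumes "W22 f" "W22 g"
  shows "W22 (\<lambda>u. f u + g u)"
proof -
  obtain f' f'' where f: "sq_integrable f" "sq_integrable f'" "has_weak_deriv f f'"
    "sq_integrable f''" "has_weak_deriv f' f''" using assms(1) unfolding W22_def by blast
  obtain g' g'' where g: "sq_integrable g" "sq_integrable g'" "has_weak_deriv g g'"
    "sq_integrable g''" "has_weak_deriv g' g''" using assms(2) unfolding W22_def by blast
  show ?thesis
    unfolding W22_def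
    by (rule conjI, rule sq_integrable_add[OF f(1) g(1)],
        rule exI[of _ "\<lambda>u. f' u + g' u"], rule exI[of _ "\<lambda>u. f'' u + g'' u"])
       (intro conjI sq_integrable_add has_weak_deriv_add f g)
qed

lemma W22_scaleR:
  assumes "W22 f"
  shows "W22 (\<lambda>u. r *\<^sub>R f u)"
proof -
  obtain f' f'' where f: "sq_integrable f" "sq_integrable f'" "has_weak_deriv f f'"
    "sq_integrable f''" "has_weak_deriv f' f''" using assms unfolding W22_def by blast
  show ?thesis
    unfolding W22_def
    by (rule conjI, rule sq_integrable_scaleR[OF f(1)],
        rule exI[of _ "\<lambda>u. r *\<^sub>R f' u"], rule exI[of _ "\<lambda>u. r *\<^sub>R f'' u"])
       (intro conjI sq_integrable_scaleR has_weak_deriv_scaleR f)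
qed

typedef (overloaded) 'a::euclidean_space H2 =
  "{f :: real \<Rightarrow> 'a. W22 f \<and> continuous_on UNIV f \<and> (\<forall>u. f (u + 1) = f u)}"
  morphisms fun_of Abs_H2
  by (rule exI[of _ "\<lambda>_. 0"]) (simp add: W22_zero)

setup_lifting type_definition_H2

definition d1 :: "'a::euclidean_space H2 \<Rightarrow> real \<Rightarrow> 'a" where
  "d1 f = weak_deriv (fun_of f)"

definition d2 :: "'a::euclidean_space H2 \<Rightarrow> real \<Rightarrow> 'a" where
  "d2 f = weak_deriv (d1 f)"

lemma H2_derivs:
  shows "has_weak_deriv (fun_of f) (d1 f)" "has_weak_deriv (d1 f) (d2 f)"
    and "sq_integrable (fun_of f)" "sq_integrable (d1 f)" "sq_integrable (d2 f)"
proof -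
  from fun_of[of f] obtain f' f'' where *:
    "sq_integrable (fun_of f)" "sq_integrable f'" "has_weak_deriv (fun_of f) f'"
    "sq_integrable f''" "has_weak_deriv f' f''" unfolding W22_def by blast
  show 1: "has_weak_deriv (fun_of f) (d1 f)"
    unfolding d1_def by (rule has_weak_deriv_weak_deriv[OF *(3)])
  have m1: "d1 f \<in> borel_measurable circle" using 1 by (auto simp: has_weak_deriv_def)
  have ae1: "AE u in circle. f' u = d1 f u" using has_weak_deriv_unique[OF *(3) 1] .
  have w: "has_weak_deriv (d1 f) f''" by (rule has_weak_deriv_cong_AE[OF *(5) ae1 m1])
  show 2: "has_weak_deriv (d1 f) (d2 f)"
    unfolding d2_def by (rule has_weak_deriv_weak_deriv[OF w])
  have m2: "d2 f \<in> borel_measurable circle" using 2 by (auto simp: has_weak_deriv_def)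
  show "sq_integrable (fun_of f)" by fact
  show "sq_integrable (d1 f)" by (rule sq_integrable_cong_AE[OF *(2) ae1 m1])
  show "sq_integrable (d2 f)"
    by (rule sq_integrable_cong_AE[OF *(4) has_weak_deriv_unique[OF w 2] m2])
qed

lemma d_AE_eq:
  assumes "has_weak_deriv (fun_of f) f'" "has_weak_deriv f' f''"
  shows "AE u in circle. d1 f u = f' u" "AE u in circle. d2 f u = f'' u"
proof -
  show 1: "AE u in circle. d1 f u = f' u"
    by (rule has_weak_deriv_unique[OF H2_derivs(1) assms(1)])
  have "has_weak_deriv f' (d2 f)"
    using has_weak_deriv_cong_AE[OF H2_derivs(2) 1] assms(2) by (auto simp: has_weak_deriv_def)
  then show "AE u in circle. d2 f u = f'' u" by (rule has_weak_deriv_unique[OF _ assms(2)])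
qed

instantiation H2 :: (euclidean_space) real_vector
begin

lift_definition zero_H2 :: "'a H2" is "\<lambda>_. 0"
  by (simp add: W22_zero)

lift_definition plus_H2 :: "'a H2 \<Rightarrow> 'a H2 \<Rightarrow> 'a H2" is "\<lambda>f g u. f u + g u"
  by (auto intro: W22_add continuous_on_add)

lift_definition scaleR_H2 :: "real \<Rightarrow> 'a H2 \<Rightarrow> 'a H2" is "\<lambda>r f u. r *\<^sub>R f u"
  by (auto intro: W22_scaleR continuous_on_scaleR)

definition uminus_H2 :: "'a H2 \<Rightarrow> 'a H2" where "- f = (-1) *\<^sub>R f" for f :: "'a H2"

definition minus_H2 :: "'a H2 \<Rightarrow> 'a H2 \<Rightarrow> 'a H2" where "f - g = f + (- g)" for f g :: "'a H2"

instance
proof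
  fix f g h :: "'a H2" and r s :: real
  show "f + g + h = f + (g + h)" by transfer (simp add: add.assoc)
  show "f + g = g + f" by transfer (simp add: add.commute)
  show "0 + f = f" by transfer simp
  show "- f + f = 0" unfolding uminus_H2_def by transfer simp
  show "f - g = f + - g" by (rule minus_H2_def)
  show "r *\<^sub>R (f + g) = r *\<^sub>R f + r *\<^sub>R g" by transfer (simp add: scaleR_add_right)
  show "(r + s) *\<^sub>R f = r *\<^sub>R f + s *\<^sub>R f" by transfer (simp add: scaleR_add_left)
  show "r *\<^sub>R s *\<^sub>R f = (r * s) *\<^sub>R f" by transfer simp
  show "1 *\<^sub>R f = f" by transfer simp
qed

end

lemma d_zero:
  "AE u in circle. d1 (0 :: 'a::euclidean_space H2) u = 0"
  "AE u in circle. d2 (0 :: 'a H2) u = 0"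
proof -
  have 1: "has_weak_deriv (fun_of (0 :: 'a H2)) (\<lambda>_. 0)"
    unfolding zero_H2.rep_eq by (intro has_weak_deriv_zero)
  have 2: "has_weak_deriv (\<lambda>_. 0) (\<lambda>_. 0)"
    by (intro has_weak_deriv_zero)
  show "AE u in circle. d1 (0 :: 'a H2) u = 0" by (rule d_AE_eq(1)[OF 1 2])
  show "AE u in circle. d2 (0 :: 'a H2) u = 0" by (rule d_AE_eq(2)[OF 1 2])
qed

lemma d_add:
  "AE u in circle. d1 (f + g) u = d1 f u + d1 g u"
  "AE u in circle. d2 (f + g) u = d2 f u + d2 g u"
proof -
  have 1: "has_weak_deriv (fun_of (f + g)) (\<lambda>u. d1 f u + d1 g u)"
    unfolding plus_H2.rep_eq by (intro has_weak_deriv_add H2_derivs)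
  have 2: "has_weak_deriv (\<lambda>u. d1 f u + d1 g u) (\<lambda>u. d2 f u + d2 g u)"
    by (intro has_weak_deriv_add H2_derivs)
  show "AE u in circle. d1 (f + g) u = d1 f u + d1 g u" by (rule d_AE_eq(1)[OF 1 2])
  show "AE u in circle. d2 (f + g) u = d2 f u + d2 g u" by (rule d_AE_eq(2)[OF 1 2])
qed

lemma d_scaleR:
  "AE u in circle. d1 (r *\<^sub>R f) u = r *\<^sub>R d1 f u"
  "AE u in circle. d2 (r *\<^sub>R f) u = r *\<^sub>R d2 f u"
proof -
  have 1: "has_weak_deriv (fun_of (r *\<^sub>R f)) (\<lambda>u. r *\<^sub>R d1 f u)"
    unfolding scaleR_H2.rep_eq by (intro has_weak_deriv_scaleR H2_derivs)
  have 2: "has_weak_deriv (\<lambda>u. r *\<^sub>R d1 f u) (\<lambda>u. r *\<^sub>R d2 f u)"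
    by (intro has_weak_deriv_scaleR H2_derivs)
  show "AE u in circle. d1 (r *\<^sub>R f) u = r *\<^sub>R d1 f u" by (rule d_AE_eq(1)[OF 1 2])
  show "AE u in circle. d2 (r *\<^sub>R f) u = r *\<^sub>R d2 f u" by (rule d_AE_eq(2)[OF 1 2])
qed

lemma H2_eq_zeroI:
  assumes ae: "AE u in circle. fun_of f u = 0"
  shows "f = 0"
proof -
  have cont: "continuous_on UNIV (fun_of f)" and per: "fun_of f (u + 1) = fun_of f u" for u
    using fun_of[of f] by auto
  let ?S = "{0<..<1} \<inter> fun_of f -` (- {0})"
  have "open ?S" using cont by (intro open_Int open_vimage) auto
  have "AE u in lborel. u \<in> {0..<1} \<longrightarrow> fun_of f u = 0"
    using ae unfolding circle_def by (subst (asm) AE_restrict_space_iff) auto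
  then have "AE u in lborel. u \<notin> ?S" by eventually_elim auto
  then have "?S \<in> null_sets lborel"
    using \<open>open ?S\<close> by (subst AE_iff_null_sets) auto
  then have "negligible ?S"
    unfolding negligible_iff_null_sets by (rule null_sets_completionI)
  then have "?S = {}" using \<open>open ?S\<close> open_not_negligible by blast
  then have mid: "fun_of f u = 0" if "u \<in> {0<..<1}" for u using that by auto
  have clo: "fun_of f u = 0" if "u \<in> {0..1}" for u
  proof (rule continuous_constant_on_closure[where S = "{0<..<1}" and f = "fun_of f"])
    show "continuous_on (closure {0<..<1}) (fun_of f)"
      using cont by (rule continuous_on_subset) simp
    show "u \<in> closure {0<..<1}" using that by simp
  qed (rule mid)
  have pern: "fun_of f (u + real k) = fun_of f u" for u k
  proof (induction k)
    case (Suc k)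
    have "fun_of f (u + real (Suc k)) = fun_of f ((u + real k) + 1)"
      by (simp add: algebra_simps)
    then show ?case using Suc per by metis
  qed simp
  have "fun_of f u = 0" for u
  proof (cases "\<lfloor>u\<rfloor> \<ge> 0")
    case True
    then have "u = frac u + real (nat \<lfloor>u\<rfloor>)" by (simp add: frac_def)
    then have "fun_of f u = fun_of f (frac u)" using pern by metis
    then show ?thesis using clo[of "frac u"] frac_lt_1[of u] by simp
  next
    case False
    then have "frac u = u + real (nat (- \<lfloor>u\<rfloor>))" by (simp add: frac_def)
    then have "fun_of f u = fun_of f (frac u)" using pern by metis
    then show ?thesis using clo[of "frac u"] frac_lt_1[of u] by simp
  qed
  then have "fun_of f = fun_of 0" by (auto simp: zero_H2.rep_eq)
  then show ?thesis by (simp add: fun_of_inject)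
qed

instantiation H2 :: (euclidean_space) real_inner
begin

definition inner_H2 :: "'a H2 \<Rightarrow> 'a H2 \<Rightarrow> real" where
  "inner_H2 f h =
     (LINT u|circle. fun_of f u \<bullet> fun_of h u + d1 f u \<bullet> d1 h u + d2 f u \<bullet> d2 h u)"

definition norm_H2 :: "'a H2 \<Rightarrow> real" where
  "norm_H2 f = sqrt (inner f f)"

definition sgn_H2 :: "'a H2 \<Rightarrow> 'a H2" where
  "sgn_H2 f = f /\<^sub>R norm f"

definition dist_H2 :: "'a H2 \<Rightarrow> 'a H2 \<Rightarrow> real" where
  "dist_H2 f g = norm (f - g)"

definition uniformity_H2 :: "('a H2 \<times> 'a H2) filter" where
  "uniformity_H2 = (INF e\<in>{0<..}. principal {(x, y). dist x y < e})"

definition open_H2 :: "'a H2 set \<Rightarrow> bool" where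
  "open_H2 U \<longleftrightarrow> (\<forall>x\<in>U. eventually (\<lambda>(x', y). x' = x \<longrightarrow> y \<in> U) uniformity)"

lemma inner_H2_integrable:
  "integrable circle (\<lambda>u. fun_of f u \<bullet> fun_of h u + d1 f u \<bullet> d1 h u + d2 f u \<bullet> d2 h u)"
  by (intro Bochner_Integration.integrable_add sq_integrable_inner H2_derivs)

lemma d_measurable [measurable]:
  "fun_of f \<in> borel_measurable circle"
  "d1 f \<in> borel_measurable circle" "d2 f \<in> borel_measurable circle"
  using H2_derivs[of f] by (auto simp: sq_integrable_def)

instance
proof
  fix f g h :: "'a H2" and r :: real
  show "inner f g = inner g f" by (simp add: inner_H2_def inner_commute)
  have "inner (f + g) h = (LINT u|circle.
      (fun_of f u \<bullet> fun_of h u + d1 f u \<bullet> d1 h u + d2 f u \<bullet> d2 h u) +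
      (fun_of g u \<bullet> fun_of h u + d1 g u \<bullet> d1 h u + d2 g u \<bullet> d2 h u))"
    unfolding inner_H2_def
  proof (rule integral_cong_AE)
    show "AE u in circle.
      fun_of (f + g) u \<bullet> fun_of h u + d1 (f + g) u \<bullet> d1 h u + d2 (f + g) u \<bullet> d2 h u =
      fun_of f u \<bullet> fun_of h u + d1 f u \<bullet> d1 h u + d2 f u \<bullet> d2 h u +
      (fun_of g u \<bullet> fun_of h u + d1 g u \<bullet> d1 h u + d2 g u \<bullet> d2 h u)"
      using d_add[of f g] by eventually_elim (simp add: plus_H2.rep_eq inner_add_left)
  qed auto
  also have "\<dots> = inner f h + inner g h"
    unfolding inner_H2_def by (intro Bochner_Integration.integral_add inner_H2_integrable)
  finally show "inner (f + g) h = inner f h + inner g h" .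
  have "inner (r *\<^sub>R f) h = (LINT u|circle.
      r * (fun_of f u \<bullet> fun_of h u + d1 f u \<bullet> d1 h u + d2 f u \<bullet> d2 h u))"
    unfolding inner_H2_def
  proof (rule integral_cong_AE)
    show "AE u in circle.
      fun_of (r *\<^sub>R f) u \<bullet> fun_of h u + d1 (r *\<^sub>R f) u \<bullet> d1 h u + d2 (r *\<^sub>R f) u \<bullet> d2 h u =
      r * (fun_of f u \<bullet> fun_of h u + d1 f u \<bullet> d1 h u + d2 f u \<bullet> d2 h u)"
      using d_scaleR[of r f] by eventually_elim (simp add: scaleR_H2.rep_eq distrib_left)
  qed auto
  also have "\<dots> = r * inner f h" unfolding inner_H2_def by (rule integral_mult_right_zero)
  finally show "inner (r *\<^sub>R f) h = r * inner f h" .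
  show ge0: "0 \<le> inner f f"
    unfolding inner_H2_def by (intro Bochner_Integration.integral_nonneg) auto
  show "inner f f = 0 \<longleftrightarrow> f = 0"
  proof
    assume "inner f f = 0"
    then have "AE u in circle. fun_of f u \<bullet> fun_of f u + d1 f u \<bullet> d1 f u + d2 f u \<bullet> d2 f u = 0"
      unfolding inner_H2_def using inner_H2_integrable[of f f]
      by (subst (asm) integral_nonneg_eq_0_iff_AE) auto
    then have "AE u in circle. fun_of f u = 0"
    proof eventually_elim
      case (elim u)
      then have "fun_of f u \<bullet> fun_of f u = 0"
        using inner_ge_zero[of "fun_of f u"] inner_ge_zero[of "d1 f u"] inner_ge_zero[of "d2 f u"]
        by linarith
      then show ?case by simp
    qed
    then show "f = 0" by (rule H2_eq_zeroI)
  next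
    assume "f = 0"
    have "inner f f = (LINT u|circle. 0)"
      unfolding inner_H2_def
    proof (rule integral_cong_AE)
      show "AE u in circle. fun_of f u \<bullet> fun_of f u + d1 f u \<bullet> d1 f u + d2 f u \<bullet> d2 f u = 0"
        using d_zero[where 'a = 'a] unfolding \<open>f = 0\<close> by eventually_elim (simp add: zero_H2.rep_eq)
    qed auto
    then show "inner f f = 0" by simp
  qed
  show "norm f = sqrt (inner f f)" by (rule norm_H2_def)
  show "sgn f = f /\<^sub>R norm f" by (rule sgn_H2_def)
  show "dist f g = norm (f - g)" by (rule dist_H2_def)
  show "uniformity = (INF e\<in>{0<..}. principal {(x, y::'a H2). dist x y < e})"
    by (rule uniformity_H2_def)
  show "open U \<longleftrightarrow> (\<forall>x\<in>U. eventually (\<lambda>(x', y). x' = x \<longrightarrow> y \<in> U) uniformity)"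
    for U :: "'a H2 set" by (rule open_H2_def)
qed

end


section \<open>Energies\<close>

definition arclength_deriv :: "'a::euclidean_space H2 \<Rightarrow> (real \<Rightarrow> 'a) \<Rightarrow> real \<Rightarrow> 'a" where
  "arclength_deriv \<gamma> f u = weak_deriv f u /\<^sub>R norm (d1 \<gamma> u)"

definition curvature :: "'a::euclidean_space H2 \<Rightarrow> real \<Rightarrow> real" where
  "curvature \<gamma> u = norm (arclength_deriv \<gamma> (arclength_deriv \<gamma> (fun_of \<gamma>)) u)"

definition bending_energy :: "'a::euclidean_space H2 \<Rightarrow> real" where
  "bending_energy \<gamma> = 1 / 2 * (LINT u|circle. (curvature \<gamma> u)\<^sup>2 * norm (d1 \<gamma> u))"

text \<open>The length of the shorter of the two arcs joining the points with parameters \<open>u, v \<in> [0, 1)\<close>.\<close>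

definition intrinsic_dist :: "'a::euclidean_space H2 \<Rightarrow> real \<Rightarrow> real \<Rightarrow> real" where
  "intrinsic_dist \<gamma> u v =
     (let l = (LINT w:{min u v..max u v}|circle. norm (d1 \<gamma> w))
      in min l ((LINT w|circle. norm (d1 \<gamma> w)) - l))"

text \<open>
  The integrand is nonnegative, and for injective regular curves of class \<open>W\<^sup>2\<^sup>,\<^sup>2\<close> the integral is
  finite, so the value 0 that Bochner integrals give to nonintegrable functions does not interfere.
\<close>

definition moebius_energy :: "'a::euclidean_space H2 \<Rightarrow> real" where
  "moebius_energy \<gamma> =
     (LINT u|circle. LINT v|circle.
        (1 / (norm (fun_of \<gamma> u - fun_of \<gamma> v))\<^sup>2 - 1 / (intrinsic_dist \<gamma> u v)\<^sup>2)
          * norm (d1 \<gamma> u) * norm (d1 \<gamma> v))"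

definition total_energy :: "real \<Rightarrow> 'a::euclidean_space H2 \<Rightarrow> real" where
  "total_energy \<theta> \<gamma> = bending_energy \<gamma> + \<theta> * moebius_energy \<gamma>"


section \<open>The arclength submanifold\<close>

definition arclength_curves :: "'a::euclidean_space \<Rightarrow> 'a H2 set" where
  "arclength_curves z =
     {\<gamma>. inj_on (fun_of \<gamma>) {0..<1} \<and> (AE u in circle. norm (d1 \<gamma> u) = 1) \<and> fun_of \<gamma> 0 = z}"

definition arclength_tangent :: "'a::euclidean_space H2 \<Rightarrow> 'a H2 set" where
  "arclength_tangent \<gamma> = {h. (AE u in circle. d1 \<gamma> u \<bullet> d1 h u = 0) \<and> fun_of h 0 = 0}"


section \<open>The Palais--Smale condition\<close>

text \<open>
  \<open>M\<close> is a submanifold of a normed space with tangent spaces \<open>T x\<close>. The differential at \<open>x\<close> of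
  the restriction of \<open>E\<close> to \<open>M\<close> is the restriction to \<open>T x\<close> of any derivative of \<open>E\<close> at \<open>x\<close> within
  \<open>M\<close>: such a derivative is determined on \<open>T x\<close>, though not in directions transversal to \<open>M\<close>.
\<close>

definition cotangent_norm :: "'x::real_normed_vector set \<Rightarrow> ('x \<Rightarrow> real) \<Rightarrow> real" where
  "cotangent_norm V D = (SUP h\<in>{h \<in> V. norm h \<le> 1}. \<bar>D h\<bar>)"

definition palais_smale_seq ::
  "('x::real_normed_vector \<Rightarrow> real) \<Rightarrow> 'x set \<Rightarrow> ('x \<Rightarrow> 'x set) \<Rightarrow> (nat \<Rightarrow> 'x) \<Rightarrow> bool" where
  "palais_smale_seq E M T x \<longleftrightarrow>
     range x \<subseteq> M \<and> bdd_above (range (\<lambda>k. E (x k))) \<and>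
     (\<exists>D. (\<forall>k. (E has_derivative D k) (at (x k) within M)) \<and>
          (\<lambda>k. cotangent_norm (T (x k)) (D k)) \<longlonglongrightarrow> 0)"

definition palais_smale_condition ::
  "('x::real_normed_vector \<Rightarrow> real) \<Rightarrow> 'x set \<Rightarrow> ('x \<Rightarrow> 'x set) \<Rightarrow> bool" where
  "palais_smale_condition E M T \<longleftrightarrow>
     (\<forall>x. palais_smale_seq E M T x \<longrightarrow>
        (\<exists>l\<in>M. \<exists>r. strict_mono r \<and> (x \<circ> r) \<longlonglongrightarrow> l))"

end

theory Submission
  imports Defs "HOL-Complex_Analysis.Great_Picard"
begin

text \<open>
  A bound on the total energy bounds the bending energy, that is, the \<open>L\<^sup>2\<close> norms of the second
  derivatives, and, since both energies are nonnegative, also the Moebius energy. By Hoelder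
  continuity of the velocities and the Arzela--Ascoli theorem a Palais--Smale sequence then has
  a subsequence whose velocities converge uniformly. It remains to show that the second
  derivatives of this subsequence converge strongly and that the limit is injective.

  Injectivity comes from the Moebius energy: a near self-contact of two distant pieces of the
  curve costs an amount of energy that is logarithmic in the distance, so energy bounds give a
  uniform bilipschitz constant (\<open>uniform_bilipschitz\<close>), which survives in the limit.

  For strong convergence one tests the derivative of the energy at a curve \<open>x\<close> of the sequence
  with the difference of \<open>x\<close> and another curve \<open>y\<close> of the sequence, modified so as to be tangent
  (\<open>tangent_test_field\<close>). The bending energy contributes the \<open>L\<^sup>2\<close> product of \<open>x''\<close> and
  \<open>x'' - y''\<close>, up to errors controlled by the uniform distance of the velocities. If the Moebius
  energy contributes little, then so does this product, and adding the same statement with \<open>x\<close>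
  and \<open>y\<close> exchanged shows that the second derivatives form a Cauchy sequence in \<open>L\<^sup>2\<close>.

  The Moebius energy is indeed of lower order in the sense needed here. On curves of unit speed
  the intrinsic distance does not change, and the squared chord \<open>\<bar>x u - x v\<bar>\<^sup>2\<close> differs from the
  squared arc length only by a covariance of the velocity over the arc (\<open>covariance_bound\<close>). The
  same identity, applied to \<open>y - x\<close> and \<open>y + x\<close>, whose velocities are orthogonal, bounds the
  difference of the Moebius energies of \<open>x\<close> and \<open>y\<close> by singular integrals that converge
  absolutely (\<open>moebius_energy_difference_le\<close>). Hence no derivative of the Moebius energy has to
  be computed: its difference quotients along a curve with tangent \<open>h\<close> are small if \<open>h'\<close> is
  uniformly small and \<open>h\<close> is bounded in the Sobolev norm.

  Finally, the derivative of a function within the manifold is evaluated in a tangent direction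
  by means of curves in the manifold (\<open>tangent_curve\<close>). They are obtained by perturbing the
  velocity, subtracting a constant vector, and normalizing; the constant that closes the curve
  exists by Brouwer's fixed point theorem, because closed curves are never straight
  (\<open>coercivity\<close>, \<open>closing_translation\<close>).
\<close>

section \<open>Integration over the circle\<close>

lemma interval_in_sets_circle:
  assumes "0 \<le> u" "v \<le> 1"
  shows "{u..<v} \<in> sets circle"
proof -
  have "{u..<v} = {0..<1} \<inter> {u..<v}" using assms by auto
  then show ?thesis
    unfolding sets_circle sets_restrict_space by (auto intro!: image_eqI[where x="{u..<v}"])
qed

lemma borel_in_sets_circle:
  assumes "A \<in> sets borel"
  shows "{0..<1} \<inter> A \<in> sets circle"
  using assms unfolding sets_circle sets_restrict_space by auto

lemma measure_circle_interval:
  assumes "0 \<le> u" "u \<le> v" "v \<le> 1"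
  shows "measure circle {u..<v} = v - u"
proof -
  have "emeasure circle {u..<v} = emeasure lborel {u..<v}"
    unfolding circle_def using assms by (intro emeasure_restrict_space) auto
  then show ?thesis using assms by (simp add: measure_def)
qed

lemma measure_circle_space: "measure circle {0..<1} = 1"
  using measure_circle_interval[of 0 1] by simp

lemma sq_integrable_imp_integrable:
  assumes "sq_integrable g"
  shows "integrable circle g"
proof (rule Bochner_Integration.integrable_bound)
  show "integrable circle (\<lambda>u. 1 + (norm (g u))\<^sup>2)"
    using assms by (auto simp: sq_integrable_def)
  show "g \<in> borel_measurable circle" using assms by (auto simp: sq_integrable_def)
  have "norm (g u) \<le> 1 + (norm (g u))\<^sup>2" for u
    using sum_squares_bound[of 1 "norm (g u)"] norm_ge_zero[of "g u"]
    by (simp del: norm_ge_zero)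
  then show "AE u in circle. norm (g u) \<le> norm (1 + (norm (g u))\<^sup>2)"
    by (intro AE_I2) (metis abs_ge_self order_trans real_norm_def)
qed

lemma set_integrable_circle:
  fixes g :: "real \<Rightarrow> 'a::euclidean_space"
  assumes "integrable circle g" "A \<in> sets circle"
  shows "set_integrable circle A g"
  using assms integrable_mult_indicator[of A circle g] by (simp add: set_integrable_def)

lemma sq_integrable_norm_sq:
  assumes "sq_integrable g"
  shows "integrable circle (\<lambda>u. (norm (g u))\<^sup>2)"
  using assms by (simp add: sq_integrable_def)

definition L2_sq :: "(real \<Rightarrow> 'a::euclidean_space) \<Rightarrow> real" where
  "L2_sq g = (LINT u|circle. (norm (g u))\<^sup>2)"

lemma L2_sq_nonneg: "L2_sq g \<ge> 0"
  unfolding L2_sq_def by (intro Bochner_Integration.integral_nonneg) auto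

text \<open>
  The usual discriminant argument, allowing the degenerate leading coefficient 0.
\<close>

lemma nonneg_quadratic_imp_discriminant:
  fixes a b c :: real
  assumes "c \<ge> 0" "\<And>m. 0 \<le> a - 2 * m * b + m\<^sup>2 * c"
  shows "b\<^sup>2 \<le> c * a"
proof (cases "c = 0")
  case True
  have "b = 0"
  proof (rule ccontr)
    assume "b \<noteq> 0"
    then show False using assms(2)[of "(a + 1) / (2 * b)"] True by simp
  qed
  then show ?thesis using True by simp
next
  case False
  then show ?thesis using assms(1) assms(2)[of "b / c"] by (simp add: power2_eq_square field_simps)
qed

lemma Cauchy_Schwarz_set:
  assumes g: "sq_integrable g" and A: "A \<in> sets circle"
  shows "(LINT s:A|circle. norm (g s))\<^sup>2 \<le> measure circle A * (LINT s:A|circle. (norm (g s))\<^sup>2)"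
proof (rule nonneg_quadratic_imp_discriminant[OF measure_nonneg])
  fix m :: real
  have i1: "set_integrable circle A (\<lambda>s. norm (g s))"
    using sq_integrable_imp_integrable[OF g] by (intro set_integrable_circle A) auto
  have i2: "set_integrable circle A (\<lambda>s. (norm (g s))\<^sup>2)"
    using sq_integrable_norm_sq[OF g] by (intro set_integrable_circle A)
  have i0: "set_integrable circle A (\<lambda>s. m\<^sup>2)"
    by (intro set_integrable_circle A) auto
  have i3: "set_integrable circle A (\<lambda>s. 2 * m * norm (g s))"
    using i1 by (rule set_integrable_mult_right)
  have "0 \<le> (LINT s:A|circle. (norm (g s) - m)\<^sup>2)"
    unfolding set_lebesgue_integral_def
    by (intro Bochner_Integration.integral_nonneg) auto
  also have "\<dots> = (LINT s:A|circle. (norm (g s))\<^sup>2 - 2 * m * norm (g s) + m\<^sup>2)"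
    by (simp add: power2_diff algebra_simps)
  also have "\<dots> = (LINT s:A|circle. (norm (g s))\<^sup>2) - 2 * m * (LINT s:A|circle. norm (g s))
      + (LINT s:A|circle. m\<^sup>2)"
    using i2 i3 i0 by (simp add: set_integral_add set_integral_diff)
  also have "(LINT s:A|circle. m\<^sup>2) = m\<^sup>2 * measure circle A"
    using A sets.sets_into_space[OF A]
    by (simp add: set_lebesgue_integral_def Int_absorb2 mult.commute)
  finally show "0 \<le> (LINT s:A|circle. (norm (g s))\<^sup>2) - 2 * m * (LINT s:A|circle. norm (g s))
      + m\<^sup>2 * measure circle A" .
qed

lemma set_integral_le_full:
  fixes g :: "real \<Rightarrow> real"
  assumes "integrable circle g" "\<And>s. g s \<ge> 0" "A \<in> sets circle"
  shows "(LINT s:A|circle. g s) \<le> (LINT s|circle. g s)"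
  unfolding set_lebesgue_integral_def
proof (rule integral_mono_AE)
  show "integrable circle (\<lambda>x. indicat_real A x *\<^sub>R g x)"
    using set_integrable_circle[OF assms(1,3)] by (simp add: set_integrable_def)
qed (use assms in \<open>auto simp: indicator_def\<close>)

lemma set_integral_norm_bound_circle:
  fixes g :: "real \<Rightarrow> 'a::euclidean_space"
  assumes "integrable circle g" "A \<in> sets circle"
  shows "norm (LINT s:A|circle. g s) \<le> (LINT s:A|circle. norm (g s))"
proof -
  have "norm (LINT s:A|circle. g s) \<le> (LINT s|circle. norm (indicator A s *\<^sub>R g s))"
    unfolding set_lebesgue_integral_def by (rule integral_norm_bound)
  also have "\<dots> = (LINT s:A|circle. norm (g s))"
    unfolding set_lebesgue_integral_def by (intro Bochner_Integration.integral_cong) auto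
  finally show ?thesis .
qed

lemma set_integral_interval_combine:
  fixes g :: "real \<Rightarrow> 'a::euclidean_space"
  assumes "integrable circle g" "0 \<le> u" "u \<le> v" "v \<le> w" "w \<le> 1"
  shows "(LINT s:{u..<w}|circle. g s) = (LINT s:{u..<v}|circle. g s) + (LINT s:{v..<w}|circle. g s)"
proof -
  have "{u..<w} = {u..<v} \<union> {v..<w}" using assms by auto
  moreover have "(LINT s:{u..<v} \<union> {v..<w}|circle. g s)
      = (LINT s:{u..<v}|circle. g s) + (LINT s:{v..<w}|circle. g s)"
    using assms by (intro set_integral_Un set_integrable_circle interval_in_sets_circle) auto
  ultimately show ?thesis by simp
qed

lemma set_integral_const_circle:
  fixes c :: "'a::euclidean_space"
  assumes "A \<in> sets circle"
  shows "(LINT s:A|circle. c) = measure circle A *\<^sub>R c"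
  unfolding set_lebesgue_integral_def using assms
  by (intro has_bochner_integral_integral_eq has_bochner_integral_indicator)
     (simp_all add: circle.emeasure_eq_measure)

lemma set_integral_bounded_linear_circle:
  fixes g :: "real \<Rightarrow> 'a::euclidean_space" and T :: "'a \<Rightarrow> 'b::euclidean_space"
  assumes "bounded_linear T" "integrable circle g" "A \<in> sets circle"
  shows "(LINT s:A|circle. T (g s)) = T (LINT s:A|circle. g s)"
proof -
  interpret bounded_linear T by fact
  have "integrable circle (\<lambda>s. indicator A s *\<^sub>R g s)"
    using set_integrable_circle[OF assms(2,3)] by (simp add: set_integrable_def)
  from integral_bounded_linear[OF assms(1) this]
  show ?thesis by (simp add: set_lebesgue_integral_def scaleR)
qed

lemma borel_measurable_circle_continuous_on:
  fixes f :: "real \<Rightarrow> 'a::euclidean_space"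
  assumes "continuous_on {0..1} f"
  shows "f \<in> borel_measurable circle"
proof -
  have "continuous_on {0..<1} f" using assms by (rule continuous_on_subset) auto
  then have "f \<in> borel_measurable (restrict_space borel {0..<1})"
    by (rule borel_measurable_continuous_on_restrict)
  then show ?thesis using measurable_cong_sets[OF sets_circle refl, of borel] by blast
qed

lemma continuous_on_unit_interval_bounded:
  fixes f :: "real \<Rightarrow> 'a::euclidean_space"
  assumes "continuous_on {0..1} f"
  obtains B where "B > 0" "\<And>u. u \<in> {0..1} \<Longrightarrow> norm (f u) \<le> B"
proof -
  have "bounded (f ` {0..1})"
    using assms by (intro compact_imp_bounded compact_continuous_image) auto
  then show thesis using that unfolding bounded_pos by blast
qed

lemma integrable_circle_bound:
  fixes g :: "real \<Rightarrow> 'a::euclidean_space" and k :: "real \<Rightarrow> 'b::euclidean_space"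
  assumes "integrable circle g" "k \<in> borel_measurable circle"
    and "\<And>s. s \<in> {0..<1} \<Longrightarrow> norm (k s) \<le> norm (g s)"
  shows "integrable circle k"
  by (rule Bochner_Integration.integrable_bound[OF assms(1,2)]) (use assms(3) in auto)

lemma sq_integrable_bound:
  fixes g :: "real \<Rightarrow> 'a::euclidean_space" and k :: "real \<Rightarrow> 'b::euclidean_space"
  assumes g: "sq_integrable g" and k: "k \<in> borel_measurable circle"
    and le: "\<And>s. s \<in> {0..<1} \<Longrightarrow> norm (k s) \<le> B * norm (g s)"
  shows "sq_integrable k"
  unfolding sq_integrable_def
proof
  show "integrable circle (\<lambda>u. (norm (k u))\<^sup>2)"
  proof (rule integrable_circle_bound)
    show "integrable circle (\<lambda>u. B\<^sup>2 * (norm (g u))\<^sup>2)"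
      using sq_integrable_norm_sq[OF g] by simp
    show "(\<lambda>u. (norm (k u))\<^sup>2) \<in> borel_measurable circle" using k by measurable
    show "norm ((norm (k s))\<^sup>2) \<le> norm (B\<^sup>2 * (norm (g s))\<^sup>2)" if "s \<in> {0..<1}" for s
      using power_mono[OF le[OF that], of 2] by (simp add: power_mult_distrib)
  qed
qed (rule k)

section \<open>Primitives of square-integrable functions\<close>

text \<open>
  On \<open>[0, 1]\<close> this says that \<open>f\<close> is absolutely continuous with derivative \<open>g\<close> in \<open>L\<^sup>2\<close>.
  Increments are integrals over half-open intervals, which makes them exactly additive and keeps
  them inside the fundamental domain.
\<close>

definition is_primitive :: "(real \<Rightarrow> 'a::euclidean_space) \<Rightarrow> (real \<Rightarrow> 'a) \<Rightarrow> bool" where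
  "is_primitive f g \<longleftrightarrow> sq_integrable g \<and>
     (\<forall>u v. 0 \<le> u \<and> u \<le> v \<and> v \<le> 1 \<longrightarrow> f v - f u = (LINT s:{u..<v}|circle. g s))"

lemma is_primitiveD:
  assumes "is_primitive f g"
  shows "sq_integrable g" "integrable circle g"
    and "\<And>u v. 0 \<le> u \<Longrightarrow> u \<le> v \<Longrightarrow> v \<le> 1 \<Longrightarrow> f v - f u = (LINT s:{u..<v}|circle. g s)"
  using assms sq_integrable_imp_integrable by (auto simp: is_primitive_def)

lemma is_primitive_increment_le:
  assumes "is_primitive f g" "0 \<le> u" "u \<le> v" "v \<le> 1"
  shows "norm (f v - f u) \<le> (LINT s:{u..<v}|circle. norm (g s))"
  using is_primitiveD[OF assms(1)] assms(2-)
  by (simp add: set_integral_norm_bound_circle interval_in_sets_circle)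

text \<open>
  By the Cauchy--Schwarz inequality; the same modulus serves whole families with bounded \<open>L\<^sup>2\<close>
  derivatives.
\<close>

lemma is_primitive_holder:
  assumes f: "is_primitive f g" and "u \<in> {0..1}" "v \<in> {0..1}"
  shows "norm (f v - f u) \<le> sqrt \<bar>v - u\<bar> * sqrt (L2_sq g)"
proof -
  have *: "norm (f v - f u) \<le> sqrt (v - u) * sqrt (L2_sq g)"
    if "0 \<le> u" "u \<le> v" "v \<le> 1" for u v
  proof -
    let ?A = "{u..<v}"
    have A: "?A \<in> sets circle" using that by (simp add: interval_in_sets_circle)
    have "norm (f v - f u) \<le> (LINT s:?A|circle. norm (g s))"
      using is_primitive_increment_le[OF f] that by simp
    also have "\<dots> \<le> sqrt ((v - u) * (LINT s:?A|circle. (norm (g s))\<^sup>2))"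
      using Cauchy_Schwarz_set[OF is_primitiveD(1)[OF f] A] that
      by (simp add: measure_circle_interval real_le_rsqrt)
    also have "\<dots> \<le> sqrt ((v - u) * L2_sq g)"
      using that A sq_integrable_norm_sq[OF is_primitiveD(1)[OF f]] unfolding L2_sq_def
      by (intro real_sqrt_le_mono mult_left_mono set_integral_le_full) auto
    finally show ?thesis by (simp add: real_sqrt_mult)
  qed
  show ?thesis
  proof (cases "u \<le> v")
    case True
    then show ?thesis using *[of u v] assms by simp
  next
    case False
    then show ?thesis using *[of v u] assms by (simp add: norm_minus_commute)
  qed
qed

lemma sqrt_modulus_small:
  fixes e K :: real
  assumes "e > 0" "K \<ge> 0"
  obtains d where "d > 0" "\<And>t. 0 \<le> t \<Longrightarrow> t < d \<Longrightarrow> sqrt t * K < e"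
proof
  show "(e / (K + 1))\<^sup>2 > 0" using assms by simp
  fix t assume t: "0 \<le> t" "t < (e / (K + 1))\<^sup>2"
  then have "sqrt t < e / (K + 1)" using assms by (intro real_less_lsqrt) auto
  then have "sqrt t * (K + 1) < e" using assms by (simp add: pos_less_divide_eq)
  moreover have "sqrt t * K \<le> sqrt t * (K + 1)" using t by (intro mult_left_mono) auto
  ultimately show "sqrt t * K < e" by simp
qed

lemma is_primitive_uniformly_continuous:
  assumes f: "is_primitive f g" and "e > 0"
  obtains d where "d > 0" "\<And>u v. u \<in> {0..1} \<Longrightarrow> v \<in> {0..1} \<Longrightarrow> \<bar>v - u\<bar> < d \<Longrightarrow> norm (f v - f u) < e"
proof -
  obtain d where d: "d > 0" "\<And>t. 0 \<le> t \<Longrightarrow> t < d \<Longrightarrow> sqrt t * sqrt (L2_sq g) < e"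
    using sqrt_modulus_small[OF \<open>e > 0\<close>, of "sqrt (L2_sq g)"] L2_sq_nonneg[of g] by auto
  show thesis
    by (rule that[OF d(1)])
       (use d(2) is_primitive_holder[OF f] in \<open>meson abs_ge_zero le_less_trans\<close>)
qed

lemma is_primitive_continuous:
  assumes "is_primitive f g"
  shows "continuous_on {0..1} f"
proof (rule uniformly_continuous_imp_continuous, unfold uniformly_continuous_on_def, intro allI impI)
  fix e :: real assume "e > 0"
  then obtain d where "d > 0"
    "\<And>u v. u \<in> {0..1} \<Longrightarrow> v \<in> {0..1} \<Longrightarrow> \<bar>v - u\<bar> < d \<Longrightarrow> norm (f v - f u) < e"
    using is_primitive_uniformly_continuous[OF assms] by blast
  then show "\<exists>d>0. \<forall>x\<in>{0..1}. \<forall>x'\<in>{0..1}. dist x' x < d \<longrightarrow> dist (f x') (f x) < e"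
    by (auto simp: dist_norm)
qed


text \<open>
  Both sides of the identity are additive in the interval, so an estimate on short intervals
  that is small relative to another additive quantity sums up to any interval. The product and
  chain rules below only have to verify such a local estimate, which replaces differentiation
  almost everywhere.
\<close>

lemma is_primitive_local_criterion:
  fixes H :: "real \<Rightarrow> 'a::euclidean_space" and m :: "real \<Rightarrow> real"
  assumes k: "sq_integrable k" and m: "integrable circle m"
    and loc: "\<And>e. e > 0 \<Longrightarrow> \<exists>d>0. \<forall>u v. 0 \<le> u \<longrightarrow> u \<le> v \<longrightarrow> v \<le> 1 \<longrightarrow> v - u < d \<longrightarrow>
        norm (H v - H u - (LINT s:{u..<v}|circle. k s)) \<le> e * (LINT s:{u..<v}|circle. m s)"
  shows "is_primitive H k"
  unfolding is_primitive_def
proof (intro conjI allI impI k; elim conjE)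
  define G where "G u v = H v - H u - (LINT s:{u..<v}|circle. k s)" for u v
  define N where "N u v = (LINT s:{u..<v}|circle. m s)" for u v
  note ik = sq_integrable_imp_integrable[OF k]
  have add: "G u w = G u v + G v w" "N u w = N u v + N v w"
    if "0 \<le> u" "u \<le> v" "v \<le> w" "w \<le> 1" for u v w
    using set_integral_interval_combine[OF ik that] set_integral_interval_combine[OF m that]
    by (simp_all add: G_def N_def)
  have le: "norm (G u v) \<le> e * N u v" if e: "e > 0" and uv: "0 \<le> u" "u \<le> v" "v \<le> 1" for e u v
  proof -
    obtain d where d: "d > 0"
      "\<And>u v. 0 \<le> u \<Longrightarrow> u \<le> v \<Longrightarrow> v \<le> 1 \<Longrightarrow> v - u < d \<Longrightarrow> norm (G u v) \<le> e * N u v"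
      using loc[OF e] unfolding G_def N_def by blast
    have "v - u \<le> real n * (d / 2) \<Longrightarrow> 0 \<le> u \<Longrightarrow> u \<le> v \<Longrightarrow> v \<le> 1 \<Longrightarrow> norm (G u v) \<le> e * N u v"
      for n u v
    proof (induction n arbitrary: u)
      case 0
      then show ?case using d by simp
    next
      case (Suc n)
      show ?case
      proof (cases "v - u < d")
        case False
        let ?w = "u + d / 2"
        have w: "0 \<le> ?w" "u \<le> ?w" "?w \<le> v" using False d(1) Suc.prems by auto
        have "norm (G u ?w) \<le> e * N u ?w" using d w Suc.prems by (intro d(2)) auto
        moreover have "norm (G ?w v) \<le> e * N ?w v"
          using Suc.prems w by (intro Suc.IH) (auto simp: algebra_simps)
        ultimately show ?thesis
          using add[of u ?w v] w Suc.prems norm_triangle_ineq[of "G u ?w" "G ?w v"]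
          by (simp add: distrib_left)
      qed (use d Suc.prems in auto)
    qed
    moreover obtain n where "(v - u) / (d / 2) < real n" using reals_Archimedean2 by blast
    then have "v - u \<le> real n * (d / 2)" using d(1) by (simp add: field_simps)
    ultimately show ?thesis using uv by blast
  qed
  fix u v :: real assume uv: "0 \<le> u" "u \<le> v" "v \<le> 1"
  have "norm (G u v) \<le> 0"
  proof (rule field_le_epsilon)
    fix e :: real assume "e > 0"
    have "norm (G u v) \<le> e / (\<bar>N u v\<bar> + 1) * N u v"
      using \<open>e > 0\<close> uv by (intro le) auto
    also have "\<dots> \<le> e / (\<bar>N u v\<bar> + 1) * (\<bar>N u v\<bar> + 1)"
      using \<open>e > 0\<close> by (intro mult_left_mono) auto
    finally show "norm (G u v) \<le> 0 + e" by simp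
  qed
  then show "H v - H u = (LINT s:{u..<v}|circle. k s)" by (simp add: G_def)
qed

lemma is_primitive_add:
  assumes "is_primitive f f'" "is_primitive g g'"
  shows "is_primitive (\<lambda>u. f u + g u) (\<lambda>u. f' u + g' u)"
  unfolding is_primitive_def
proof (intro conjI allI impI sq_integrable_add is_primitiveD(1)[OF assms(1)]
    is_primitiveD(1)[OF assms(2)]; elim conjE)
  fix u v :: real assume uv: "0 \<le> u" "u \<le> v" "v \<le> 1"
  then have A: "{u..<v} \<in> sets circle" by (intro interval_in_sets_circle)
  have "(LINT s:{u..<v}|circle. f' s + g' s) = (f v - f u) + (g v - g u)"
    unfolding is_primitiveD(3)[OF assms(1) uv] is_primitiveD(3)[OF assms(2) uv]
    by (intro set_integral_add set_integrable_circle A is_primitiveD(2)[OF assms(1)]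
        is_primitiveD(2)[OF assms(2)])
  then show "f v + g v - (f u + g u) = (LINT s:{u..<v}|circle. f' s + g' s)"
    by (simp only: add_diff_add)
qed

lemma is_primitive_linear:
  fixes T :: "'a::euclidean_space \<Rightarrow> 'b::euclidean_space"
  assumes T: "bounded_linear T" and f: "is_primitive f f'"
  shows "is_primitive (\<lambda>u. T (f u)) (\<lambda>u. T (f' u))"
proof -
  interpret bounded_linear T by fact
  obtain B where B: "\<And>x. norm (T x) \<le> B * norm x"
    using bounded by (metis mult.commute)
  have "f' \<in> borel_measurable circle" using is_primitiveD(1)[OF f] by (simp add: sq_integrable_def)
  then have m: "(\<lambda>u. T (f' u)) \<in> borel_measurable circle"
    by (rule measurable_compose)
       (rule borel_measurable_continuous_onI[OF linear_continuous_on[OF T]])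
  show ?thesis
    unfolding is_primitive_def
  proof (intro conjI allI impI sq_integrable_bound[OF is_primitiveD(1)[OF f] m B]; elim conjE)
    fix u v :: real assume uv: "0 \<le> u" "u \<le> v" "v \<le> 1"
    then have A: "{u..<v} \<in> sets circle" by (intro interval_in_sets_circle)
    show "T (f v) - T (f u) = (LINT s:{u..<v}|circle. T (f' s))"
      unfolding set_integral_bounded_linear_circle[OF T is_primitiveD(2)[OF f] A] diff[symmetric]
        is_primitiveD(3)[OF f uv] ..
  qed
qed

lemma is_primitive_scaleR:
  assumes "is_primitive f f'"
  shows "is_primitive (\<lambda>u. c *\<^sub>R f u) (\<lambda>u. c *\<^sub>R f' u)"
  by (rule is_primitive_linear[OF bounded_linear_scaleR_right assms])

lemma is_primitive_diff:
  assumes "is_primitive f f'" "is_primitive g g'"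
  shows "is_primitive (\<lambda>u. f u - g u) (\<lambda>u. f' u - g' u)"
  using is_primitive_add[OF assms(1) is_primitive_scaleR[OF assms(2), of "-1"]] by simp

lemma is_primitive_const: "is_primitive (\<lambda>_. c) (\<lambda>_. 0)"
  by (simp add: is_primitive_def sq_integrable_zero set_lebesgue_integral_def)

lemma is_primitive_measurable:
  assumes "is_primitive f f'"
  shows "f \<in> borel_measurable circle" "f' \<in> borel_measurable circle"
  using is_primitiveD(1)[OF assms] is_primitive_continuous[OF assms]
  by (auto simp: sq_integrable_def intro: borel_measurable_circle_continuous_on)

lemma set_integral_mono_circle:
  fixes f g :: "real \<Rightarrow> real"
  assumes "integrable circle f" "integrable circle g" "A \<in> sets circle"
    and "\<And>s. s \<in> A \<Longrightarrow> f s \<le> g s"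
  shows "(LINT s:A|circle. f s) \<le> (LINT s:A|circle. g s)"
  using assms by (intro set_integral_mono set_integrable_circle)

text \<open>
  The increment of the product over \<open>[u, v)\<close> is \<open>\<integral> f' g(v) + f(u) g'\<close>; replacing \<open>g(v)\<close> and
  \<open>f(u)\<close> by the values at the integration variable costs an amount controlled by the uniform
  continuity of \<open>f\<close> and \<open>g\<close>.
\<close>

lemma is_primitive_product:
  fixes prod :: "'a::euclidean_space \<Rightarrow> 'b::euclidean_space \<Rightarrow> 'c::euclidean_space"
  assumes bil: "bounded_bilinear prod" and f: "is_primitive f f'" and g: "is_primitive g g'"
  shows "is_primitive (\<lambda>u. prod (f u) (g u)) (\<lambda>u. prod (f' u) (g u) + prod (f u) (g' u))"
proof -
  interpret bounded_bilinear prod by fact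
  obtain K where K: "K > 0" "\<And>a b. norm (prod a b) \<le> norm a * norm b * K"
    using pos_bounded by blast
  obtain Bf where Bf: "Bf > 0" "\<And>u. u \<in> {0..1} \<Longrightarrow> norm (f u) \<le> Bf"
    using continuous_on_unit_interval_bounded[OF is_primitive_continuous[OF f]] by blast
  obtain Bg where Bg: "Bg > 0" "\<And>u. u \<in> {0..1} \<Longrightarrow> norm (g u) \<le> Bg"
    using continuous_on_unit_interval_bounded[OF is_primitive_continuous[OF g]] by blast
  note fm = is_primitive_measurable[OF f] and gm = is_primitive_measurable[OF g]
  have meas: "(\<lambda>u. prod (a u) (b u)) \<in> borel_measurable circle"
    if "a \<in> borel_measurable circle" "b \<in> borel_measurable circle" for a b
  proof (rule borel_measurable_continuous_Pair[OF that])
    show "continuous_on UNIV (\<lambda>x. prod (fst x) (snd x))"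
      by (rule bounded_bilinear.continuous_on[OF bil continuous_on_fst[OF continuous_on_id]
            continuous_on_snd[OF continuous_on_id]])
  qed
  have s1: "sq_integrable (\<lambda>u. prod (f' u) (g u))"
  proof (rule sq_integrable_bound[OF is_primitiveD(1)[OF f] meas[OF fm(2) gm(1)], of "Bg * K"])
    fix s :: real assume "s \<in> {0..<1}"
    then have "norm (f' s) * norm (g s) * K \<le> norm (f' s) * Bg * K"
      using Bg K by (intro mult_right_mono mult_left_mono) auto
    then show "norm (prod (f' s) (g s)) \<le> Bg * K * norm (f' s)"
      using K(2)[of "f' s" "g s"] by (simp add: mult_ac)
  qed
  have s2: "sq_integrable (\<lambda>u. prod (f u) (g' u))"
  proof (rule sq_integrable_bound[OF is_primitiveD(1)[OF g] meas[OF fm(1) gm(2)], of "Bf * K"])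
    fix s :: real assume "s \<in> {0..<1}"
    then have "norm (f s) * norm (g' s) * K \<le> Bf * norm (g' s) * K"
      using Bf K by (intro mult_right_mono) auto
    then show "norm (prod (f s) (g' s)) \<le> Bf * K * norm (g' s)"
      using K(2)[of "f s" "g' s"] by (simp add: mult_ac)
  qed
  let ?k = "\<lambda>u. prod (f' u) (g u) + prod (f u) (g' u)"
  let ?m = "\<lambda>s. norm (f' s) + norm (g' s)"
  note if' = is_primitiveD(2)[OF f] and ig' = is_primitiveD(2)[OF g]
  have im: "integrable circle ?m" using if' ig' by simp
  have sk: "sq_integrable ?k" by (rule sq_integrable_add[OF s1 s2])
  note ik = sq_integrable_imp_integrable[OF sk]
  show ?thesis
  proof (rule is_primitive_local_criterion[OF sk im])
    fix e :: real assume "e > 0"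
    then have eK: "e / K > 0" using K by simp
    obtain d1 where d1: "d1 > 0"
      "\<And>u v. u \<in> {0..1} \<Longrightarrow> v \<in> {0..1} \<Longrightarrow> \<bar>v - u\<bar> < d1 \<Longrightarrow> norm (f v - f u) < e / K"
      using is_primitive_uniformly_continuous[OF f eK] by blast
    obtain d2 where d2: "d2 > 0"
      "\<And>u v. u \<in> {0..1} \<Longrightarrow> v \<in> {0..1} \<Longrightarrow> \<bar>v - u\<bar> < d2 \<Longrightarrow> norm (g v - g u) < e / K"
      using is_primitive_uniformly_continuous[OF g eK] by blast
    have "norm (prod (f v) (g v) - prod (f u) (g u) - (LINT s:{u..<v}|circle. ?k s))
        \<le> e * (LINT s:{u..<v}|circle. ?m s)"
      if uv: "0 \<le> u" "u \<le> v" "v \<le> 1" "v - u < min d1 d2" for u v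
    proof -
      let ?A = "{u..<v}"
      have A: "?A \<in> sets circle" using uv by (intro interval_in_sets_circle)
      let ?r = "\<lambda>s. prod (f' s) (g v) + prod (f u) (g' s)"
      have i1: "integrable circle (\<lambda>s. prod (f' s) (g v))"
        by (rule integrable_bounded_linear[OF bounded_linear_left if'])
      have i2: "integrable circle (\<lambda>s. prod (f u) (g' s))"
        by (rule integrable_bounded_linear[OF bounded_linear_right ig'])
      have ir: "integrable circle ?r" using i1 i2 by simp
      have "prod (f v) (g v) - prod (f u) (g u) = prod (f v - f u) (g v) + prod (f u) (g v - g u)"
        by (simp add: diff_left diff_right)
      also have "\<dots> = (LINT s:?A|circle. prod (f' s) (g v)) + (LINT s:?A|circle. prod (f u) (g' s))"
        using is_primitiveD(3)[OF f uv(1-3)] is_primitiveD(3)[OF g uv(1-3)]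
          set_integral_bounded_linear_circle[OF bounded_linear_left if' A]
          set_integral_bounded_linear_circle[OF bounded_linear_right ig' A] by simp
      also have "\<dots> = (LINT s:?A|circle. ?r s)"
        using i1 i2 A by (simp add: set_integral_add set_integrable_circle)
      finally have "prod (f v) (g v) - prod (f u) (g u) - (LINT s:?A|circle. ?k s)
          = (LINT s:?A|circle. ?r s - ?k s)"
        using ir ik A by (subst set_integral_diff) (auto intro: set_integrable_circle)
      also have "norm \<dots> \<le> (LINT s:?A|circle. norm (?r s - ?k s))"
        by (intro set_integral_norm_bound_circle Bochner_Integration.integrable_diff ir ik A)
      also have "\<dots> \<le> (LINT s:?A|circle. e * ?m s)"
      proof (rule set_integral_mono_circle[OF _ _ A])
        show "integrable circle (\<lambda>s. norm (?r s - ?k s))" using ir ik by auto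
        show "integrable circle (\<lambda>s. e * ?m s)" using im by simp
        fix s assume s: "s \<in> ?A"
        have "norm (g v - g s) \<le> e / K" "norm (f u - f s) \<le> e / K"
          using d1(2)[of s u] d2(2)[of s v] s uv by (auto simp: less_imp_le)
        then have "norm (f' s) * norm (g v - g s) * K \<le> norm (f' s) * (e / K) * K"
          "norm (f u - f s) * norm (g' s) * K \<le> (e / K) * norm (g' s) * K"
          using K(1) by (auto intro!: mult_right_mono mult_left_mono simp del: times_divide_eq_right times_divide_eq_left)
        then have "norm (prod (f' s) (g v - g s)) \<le> e * norm (f' s)"
          "norm (prod (f u - f s) (g' s)) \<le> e * norm (g' s)"
          using K(2)[of "f' s" "g v - g s"] K(2)[of "f u - f s" "g' s"] K(1) by (simp_all add: mult_ac)
        moreover have "?r s - ?k s = prod (f' s) (g v - g s) + prod (f u - f s) (g' s)"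
          by (simp add: diff_left diff_right)
        ultimately show "norm (?r s - ?k s) \<le> e * ?m s"
          using norm_triangle_ineq[of "prod (f' s) (g v - g s)" "prod (f u - f s) (g' s)"]
          by (simp add: distrib_left)
      qed
      also have "\<dots> = e * (LINT s:?A|circle. ?m s)" by simp
      finally show ?thesis .
    qed
    then show "\<exists>d>0. \<forall>u v. 0 \<le> u \<longrightarrow> u \<le> v \<longrightarrow> v \<le> 1 \<longrightarrow> v - u < d \<longrightarrow>
        norm (prod (f v) (g v) - prod (f u) (g u) - (LINT s:{u..<v}|circle. ?k s))
        \<le> e * (LINT s:{u..<v}|circle. ?m s)"
      using d1(1) d2(1) by (intro exI[of _ "min d1 d2"]) auto
  qed
qed

lemmas is_primitive_inner = is_primitive_product[OF bounded_bilinear_inner]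
lemmas is_primitive_scaleR_fun = is_primitive_product[OF bounded_bilinear_scaleR]

text \<open>
  By the mean value theorem an increment is \<open>\<phi>' \<xi> * \<integral> q'\<close> with \<open>\<xi>\<close> between two values of \<open>q\<close>,
  and \<open>\<phi>' \<xi>\<close> is uniformly close to \<open>\<phi>' (q s)\<close> on short intervals.
\<close>

lemma is_primitive_chain:
  fixes q :: "real \<Rightarrow> real"
  assumes q: "is_primitive q q'"
    and deriv: "\<And>t. t \<in> q ` {0..1} \<Longrightarrow> (\<phi> has_real_derivative \<phi>' t) (at t)"
    and cont: "continuous_on (q ` {0..1}) \<phi>'"
  shows "is_primitive (\<lambda>u. \<phi> (q u)) (\<lambda>u. \<phi>' (q u) * q' u)"
proof -
  let ?C = "q ` {0..1}"
  note cq = is_primitive_continuous[OF q]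
  have C: "compact ?C" "connected ?C"
    using cq by (auto intro: compact_continuous_image connected_continuous_image)
  have cc: "continuous_on {0..1} (\<lambda>u. \<phi>' (q u))"
    by (rule continuous_on_compose2[OF cont cq]) auto
  obtain B where B: "B > 0" "\<And>u. u \<in> {0..1} \<Longrightarrow> norm (\<phi>' (q u)) \<le> B"
    using continuous_on_unit_interval_bounded[OF cc] by blast
  let ?k = "\<lambda>u. \<phi>' (q u) * q' u"
  let ?m = "\<lambda>u. \<bar>q' u\<bar>"
  have sk: "sq_integrable ?k"
  proof (rule sq_integrable_bound[OF is_primitiveD(1)[OF q], of _ B])
    show "?k \<in> borel_measurable circle"
      by (intro borel_measurable_times borel_measurable_circle_continuous_on[OF cc]
          is_primitive_measurable(2)[OF q])
    show "norm (?k s) \<le> B * norm (q' s)" if "s \<in> {0..<1}" for s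
      unfolding norm_mult using B(2)[of s] that by (intro mult_right_mono) auto
  qed
  note ik = sq_integrable_imp_integrable[OF sk] and iq = is_primitiveD(2)[OF q]
  have im: "integrable circle ?m" using iq by simp
  show ?thesis
  proof (rule is_primitive_local_criterion[OF sk im])
    fix e :: real assume "e > 0"
    then obtain d where d: "d > 0"
      "\<And>x y. x \<in> ?C \<Longrightarrow> y \<in> ?C \<Longrightarrow> \<bar>x - y\<bar> < d \<Longrightarrow> \<bar>\<phi>' x - \<phi>' y\<bar> < e"
      using compact_uniformly_continuous[OF cont C(1)]
      unfolding uniformly_continuous_on_def by (metis dist_real_def)
    have "d / 2 > 0" using d by simp
    then obtain d' where d': "d' > 0"
      "\<And>u v. u \<in> {0..1} \<Longrightarrow> v \<in> {0..1} \<Longrightarrow> \<bar>v - u\<bar> < d' \<Longrightarrow> norm (q v - q u) < d / 2"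
      using is_primitive_uniformly_continuous[OF q] by blast
    have "norm (\<phi> (q v) - \<phi> (q u) - (LINT s:{u..<v}|circle. ?k s)) \<le> e * (LINT s:{u..<v}|circle. ?m s)"
      if uv: "0 \<le> u" "u \<le> v" "v \<le> 1" "v - u < d'" for u v
    proof -
      let ?A = "{u..<v}"
      have A: "?A \<in> sets circle" using uv by (intro interval_in_sets_circle)
      have sub: "{min (q u) (q v)..max (q u) (q v)} \<subseteq> ?C"
        using connected_contains_Icc[OF C(2)] uv by (auto simp: min_def max_def)
      obtain \<xi> where \<xi>: "\<xi> \<in> {min (q u) (q v)..max (q u) (q v)}"
        "\<phi> (q v) - \<phi> (q u) = \<phi>' \<xi> * (q v - q u)"
      proof -
        have *: "\<exists>\<xi>\<in>{a..b}. \<phi> b - \<phi> a = \<phi>' \<xi> * (b - a)" if "a < b" "{a..b} \<subseteq> ?C" for a b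
        proof -
          have "\<And>x. a \<le> x \<Longrightarrow> x \<le> b \<Longrightarrow> (\<phi> has_real_derivative \<phi>' x) (at x)"
            using deriv that(2) by auto
          from MVT2[OF \<open>a < b\<close> this] obtain z where "a < z" "z < b" "\<phi> b - \<phi> a = (b - a) * \<phi>' z"
            by blast
          then show ?thesis by (intro bexI[of _ z]) (auto simp: mult.commute)
        qed
        consider "q u < q v" | "q u = q v" | "q v < q u" by linarith
        then show thesis
        proof cases
          case 1
          then show thesis using *[of "q u" "q v"] sub that by auto
        next
          case 2
          then show thesis using that[of "q u"] by simp
        next
          case 3
          then obtain \<xi> where "\<xi> \<in> {q v..q u}" "\<phi> (q u) - \<phi> (q v) = \<phi>' \<xi> * (q u - q v)"
            using *[of "q v" "q u"] sub by auto
          then show thesis using 3 that[of \<xi>] by (auto simp: algebra_simps)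
        qed
      qed
      have ir: "integrable circle (\<lambda>s. \<phi>' \<xi> * q' s)" using iq by simp
      have "\<phi> (q v) - \<phi> (q u) = (LINT s:?A|circle. \<phi>' \<xi> * q' s)"
        using \<xi>(2) is_primitiveD(3)[OF q uv(1-3)] by simp
      then have "\<phi> (q v) - \<phi> (q u) - (LINT s:?A|circle. ?k s)
          = (LINT s:?A|circle. \<phi>' \<xi> * q' s - ?k s)"
        using set_integral_diff[OF set_integrable_circle[OF ir A] set_integrable_circle[OF ik A]]
        by simp
      also have "norm \<dots> \<le> (LINT s:?A|circle. norm (\<phi>' \<xi> * q' s - ?k s))"
        by (intro set_integral_norm_bound_circle Bochner_Integration.integrable_diff ir ik A)
      also have "\<dots> \<le> (LINT s:?A|circle. e * ?m s)"
      proof (rule set_integral_mono_circle[OF _ _ A])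
        show "integrable circle (\<lambda>s. norm (\<phi>' \<xi> * q' s - ?k s))" using ir ik by auto
        show "integrable circle (\<lambda>s. e * ?m s)" using im by simp
        fix s assume s: "s \<in> ?A"
        have "\<bar>q u - q s\<bar> < d / 2" "\<bar>q v - q s\<bar> < d / 2"
          using d'(2)[of s u] d'(2)[of s v] s uv by auto
        then have "\<bar>\<xi> - q s\<bar> < d" using \<xi>(1) d(1)
          by (auto simp: min_def max_def split: if_splits; linarith)
        then have "\<bar>\<phi>' \<xi> - \<phi>' (q s)\<bar> < e" using sub \<xi>(1) s uv by (intro d(2)) auto
        then have "\<bar>\<phi>' \<xi> - \<phi>' (q s)\<bar> * \<bar>q' s\<bar> \<le> e * \<bar>q' s\<bar>"
          by (intro mult_right_mono) auto
        then show "norm (\<phi>' \<xi> * q' s - ?k s) \<le> e * ?m s"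
          by (simp add: abs_mult[symmetric] left_diff_distrib)
      qed
      also have "\<dots> = e * (LINT s:?A|circle. ?m s)" by simp
      finally show ?thesis .
    qed
    then show "\<exists>d>0. \<forall>u v. 0 \<le> u \<longrightarrow> u \<le> v \<longrightarrow> v \<le> 1 \<longrightarrow> v - u < d \<longrightarrow>
        norm (\<phi> (q v) - \<phi> (q u) - (LINT s:{u..<v}|circle. ?k s)) \<le> e * (LINT s:{u..<v}|circle. ?m s)"
      using d'(1) by blast
  qed
qed

section \<open>Weak derivatives and primitives\<close>

lemma set_integral_circle_full:
  "(LINT s:{0..<1}|circle. g s) = (LINT s|circle. g s)"
  unfolding set_lebesgue_integral_def by (intro Bochner_Integration.integral_cong) auto

lemma is_primitive_total:
  assumes "is_primitive f g"
  shows "f 1 - f 0 = (LINT s|circle. g s)"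
  using is_primitiveD(3)[OF assms, of 0 1] by (simp add: set_integral_circle_full)

lemma C1_is_primitive:
  fixes f :: "real \<Rightarrow> 'a::euclidean_space"
  assumes der: "\<And>u. (f has_vector_derivative g u) (at u)" and cont: "continuous_on UNIV g"
  shows "is_primitive f g"
  unfolding is_primitive_def
proof (intro conjI allI impI sq_integrable_continuous[OF cont]; elim conjE)
  fix u v :: real assume uv: "0 \<le> u" "u \<le> v" "v \<le> 1"
  have "(LINT s:{u..<v}|circle. g s) = (LINT s|lborel. indicator {0..<1} s *\<^sub>R (indicator {u..<v} s *\<^sub>R g s))"
    unfolding set_lebesgue_integral_def circle_def by (rule integral_restrict_space) simp
  also have "\<dots> = (LINT s|lborel. indicator {u..v} s *\<^sub>R g s)"
  proof (rule integral_cong_AE)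
    have gm [measurable]: "g \<in> borel_measurable borel"
      using cont by (rule borel_measurable_continuous_onI)
    show "(\<lambda>s. indicator {0..<1} s *\<^sub>R (indicator {u..<v} s *\<^sub>R g s)) \<in> borel_measurable lborel"
      "(\<lambda>s. indicator {u..v} s *\<^sub>R g s) \<in> borel_measurable lborel"
      by (auto intro!: borel_measurable_scaleR gm borel_measurable_indicator)
    have "AE s in lborel. s \<noteq> v" by (rule AE_lborel_singleton)
    then show "AE s in lborel. indicator {0..<1} s *\<^sub>R (indicator {u..<v} s *\<^sub>R g s)
        = indicator {u..v} s *\<^sub>R g s"
      by eventually_elim (use uv in \<open>auto simp: indicator_def\<close>)
  qed
  also have "\<dots> = f v - f u"
    using uv(2)
    by (intro integral_FTC_atLeastAtMost has_vector_derivative_at_within[OF der]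
        continuous_on_subset[OF cont]) auto
  finally show "f v - f u = (LINT s:{u..<v}|circle. g s)" ..
qed

lemma smooth_periodic_is_primitive:
  assumes "smooth_periodic \<phi>"
  shows "is_primitive \<phi> (deriv \<phi>)"
proof (rule C1_is_primitive[OF _ smooth_periodic_derivs(2)[OF assms]])
  fix u
  have "(deriv ^^ 0) \<phi> differentiable (at u)" using assms unfolding smooth_periodic_def by blast
  then show "(\<phi> has_vector_derivative deriv \<phi> u) (at u)"
    by (simp add: DERIV_deriv_iff_real_differentiable has_real_derivative_iff_has_vector_derivative[symmetric])
qed

lemma smooth_periodic_ends: "smooth_periodic \<phi> \<Longrightarrow> \<phi> 1 = \<phi> 0"
  unfolding smooth_periodic_def by (metis add_0)

text \<open>
  Integration by parts against a test function; the boundary terms cancel by periodicity.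
\<close>

lemma is_primitive_has_weak_deriv:
  assumes f: "is_primitive f g" and ends: "f 0 = f 1"
  shows "has_weak_deriv f g"
  unfolding has_weak_deriv_def
proof (intro conjI allI impI)
  show "integrable circle g" by (rule is_primitiveD(2)[OF f])
  have cf: "continuous_on {0..1} f" by (rule is_primitive_continuous[OF f])
  then obtain B where "\<And>u. u \<in> {0..1} \<Longrightarrow> norm (f u) \<le> B"
    using continuous_on_unit_interval_bounded by blast
  then show "integrable circle f"
    using is_primitive_measurable(1)[OF f]
    by (intro circle.integrable_const_bound[of _ B]) auto
  fix \<phi> assume \<phi>: "smooth_periodic \<phi>"
  note P = is_primitive_scaleR_fun[OF smooth_periodic_is_primitive[OF \<phi>] f]
  have i1: "integrable circle (\<lambda>u. deriv \<phi> u *\<^sub>R f u)"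
    by (rule integrable_circle_continuous_scaleR[OF \<open>integrable circle f\<close> smooth_periodic_derivs(2)[OF \<phi>]])
  have i2: "integrable circle (\<lambda>u. \<phi> u *\<^sub>R g u)"
    by (rule integrable_circle_continuous_scaleR[OF \<open>integrable circle g\<close> smooth_periodic_derivs(1)[OF \<phi>]])
  have "(LINT u|circle. deriv \<phi> u *\<^sub>R f u) + (LINT u|circle. \<phi> u *\<^sub>R g u) = 0"
    using is_primitive_total[OF P] ends smooth_periodic_ends[OF \<phi>] i1 i2 by simp
  then show "(LINT u|circle. deriv \<phi> u *\<^sub>R f u) = - (LINT u|circle. \<phi> u *\<^sub>R g u)"
    by (simp add: eq_neg_iff_add_eq_0)
qed

lemma smooth_periodic_const: "smooth_periodic (\<lambda>_. c)"
  using smooth_periodic_trig[OF real_polynomial_function.intros(2), of c] by simp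

lemma has_weak_deriv_integral_zero:
  assumes "has_weak_deriv f g"
  shows "(LINT u|circle. g u) = 0"
  using assms smooth_periodic_const[of 1] unfolding has_weak_deriv_def by force

text \<open>
  Subtracting the mean makes the antiderivative periodic.
\<close>

lemma smooth_periodic_antiderivative:
  assumes \<psi>: "smooth_periodic \<psi>"
  obtains \<phi> where "smooth_periodic \<phi>" "\<And>u. deriv \<phi> u = \<psi> u - (LINT s|circle. \<psi> s)"
proof -
  let ?m = "LINT s|circle. \<psi> s"
  have cont: "continuous_on UNIV (\<lambda>u. \<psi> u - ?m)"
    using smooth_periodic_derivs(1)[OF \<psi>] by (intro continuous_intros)
  have "\<exists>\<phi>. \<forall>u::real. - \<infinity> < ereal u \<longrightarrow> ereal u < \<infinity> \<longrightarrow> (\<phi> has_vector_derivative (\<psi> u - ?m)) (at u)"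
    using cont by (intro einterval_antiderivative) (auto simp: continuous_on_eq_continuous_at)
  then obtain \<phi> where \<phi>: "\<And>u. (\<phi> has_vector_derivative (\<psi> u - ?m)) (at u)" by auto
  have D: "(\<phi> has_real_derivative (\<psi> u - ?m)) (at u)" for u
    using \<phi> by (simp add: has_real_derivative_iff_has_vector_derivative)
  have d: "deriv \<phi> = (\<lambda>u. \<psi> u - ?m)" using D by (intro ext DERIV_imp_deriv)
  have prim: "is_primitive \<phi> (\<lambda>u. \<psi> u - ?m)" by (rule C1_is_primitive[OF \<phi> cont])
  have "integrable circle \<psi>"
    using sq_integrable_imp_integrable[OF sq_integrable_continuous[OF smooth_periodic_derivs(1)[OF \<psi>]]] .
  then have "\<phi> 1 - \<phi> 0 = 0"
    using is_primitive_total[OF prim] by (simp add: measure_circle_space)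
  have per: "\<phi> (u + 1) = \<phi> u" for u
  proof -
    have "((\<lambda>u. \<phi> (u + 1) - \<phi> u) has_real_derivative 0) (at w)" for w
    proof -
      have "((\<lambda>u. \<phi> (u + 1)) has_real_derivative (\<psi> (w + 1) - ?m)) (at w)"
        using D[of "w + 1"] by (simp add: DERIV_shift)
      from DERIV_diff[OF this D[of w]] show ?thesis
        using \<psi> by (simp add: smooth_periodic_def)
    qed
    then have "\<phi> (u + 1) - \<phi> u = \<phi> (0 + 1) - \<phi> 0"
      using DERIV_isconst_all[of "\<lambda>u. \<phi> (u + 1) - \<phi> u" u 0] by simp
    then show ?thesis using \<open>\<phi> 1 - \<phi> 0 = 0\<close> by simp
  qed
  have iter: "\<exists>c. (deriv ^^ k) (\<lambda>u. \<psi> u - ?m) = (\<lambda>u. (deriv ^^ k) \<psi> u - c)" for k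
  proof (induction k)
    case (Suc k)
    then obtain c where c: "(deriv ^^ k) (\<lambda>u. \<psi> u - ?m) = (\<lambda>u. (deriv ^^ k) \<psi> u - c)" by blast
    have "(deriv ^^ k) \<psi> differentiable (at u)" for u
      using \<psi> unfolding smooth_periodic_def by blast
    then have "((\<lambda>u. (deriv ^^ k) \<psi> u - c) has_real_derivative deriv ((deriv ^^ k) \<psi>) u - 0) (at u)" for u
      by (intro DERIV_diff DERIV_const) (simp add: DERIV_deriv_iff_real_differentiable)
    then have "deriv (\<lambda>u. (deriv ^^ k) \<psi> u - c) = (\<lambda>u. deriv ((deriv ^^ k) \<psi>) u - 0)"
      by (intro ext DERIV_imp_deriv)
    then show ?case by (intro exI[of _ 0]) (simp add: c)
  qed auto
  have "(deriv ^^ k) \<phi> differentiable (at u)" for k u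
  proof (cases k)
    case 0
    then show ?thesis using D[of u] by (auto simp: real_differentiable_def)
  next
    case (Suc j)
    obtain c where "(deriv ^^ j) (\<lambda>u. \<psi> u - ?m) = (\<lambda>u. (deriv ^^ j) \<psi> u - c)" using iter by blast
    then have "(deriv ^^ k) \<phi> = (\<lambda>u. (deriv ^^ j) \<psi> u - c)"
      unfolding Suc funpow_Suc_right o_def d by simp
    moreover have "(deriv ^^ j) \<psi> differentiable (at u)"
      using \<psi> unfolding smooth_periodic_def by blast
    ultimately show ?thesis by simp
  qed
  then have "smooth_periodic \<phi>" using per by (simp add: smooth_periodic_def)
  then show thesis using that d by simp
qed

text \<open>
  Every test function minus its mean is the derivative of a test function, so the function minus
  its mean is orthogonal to all test functions.
\<close>

lemma has_weak_deriv_zero_imp_const: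
  assumes "has_weak_deriv f (\<lambda>_. 0)"
  shows "AE u in circle. f u = (LINT s|circle. f s)"
proof -
  let ?c = "LINT s|circle. f s"
  have f: "integrable circle f" using assms by (simp add: has_weak_deriv_def)
  have "AE u in circle. f u - ?c = 0"
  proof (rule smooth_periodic_orthogonal_imp_zero)
    show "integrable circle (\<lambda>u. f u - ?c)" using f by simp
    fix \<psi> assume \<psi>: "smooth_periodic \<psi>"
    let ?m = "LINT s|circle. \<psi> s"
    obtain \<phi> where \<phi>: "smooth_periodic \<phi>" "\<And>u. deriv \<phi> u = \<psi> u - ?m"
      using smooth_periodic_antiderivative[OF \<psi>] by blast
    have i: "integrable circle (\<lambda>u. \<psi> u *\<^sub>R g u)" if "integrable circle g" for g :: "real \<Rightarrow> 'a"
      by (rule integrable_circle_continuous_scaleR[OF that smooth_periodic_derivs(1)[OF \<psi>]])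
    have i\<psi>: "integrable circle \<psi>"
      using sq_integrable_imp_integrable[OF sq_integrable_continuous[OF smooth_periodic_derivs(1)[OF \<psi>]]] .
    have "(LINT u|circle. deriv \<phi> u *\<^sub>R f u) = 0"
      using assms \<phi>(1) by (auto simp: has_weak_deriv_def)
    then have "(LINT u|circle. \<psi> u *\<^sub>R f u) = ?m *\<^sub>R ?c"
      using i[OF f] f by (simp add: \<phi>(2) scaleR_diff_left)
    then show "(LINT u|circle. \<psi> u *\<^sub>R (f u - ?c)) = 0"
      using i[OF f] i\<psi> by (simp add: scaleR_diff_right)
  qed
  then show ?thesis by simp
qed

lemma is_primitive_indefinite_integral:
  fixes g :: "real \<Rightarrow> 'a::euclidean_space"
  assumes "sq_integrable g"
  shows "is_primitive (\<lambda>u. c + (LINT s:{0..<u}|circle. g s)) g"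
  unfolding is_primitive_def
proof (intro conjI allI impI assms; elim conjE)
  fix u v :: real assume "0 \<le> u" "u \<le> v" "v \<le> 1"
  from set_integral_interval_combine[OF sq_integrable_imp_integrable[OF assms] order.refl this]
  show "c + (LINT s:{0..<v}|circle. g s) - (c + (LINT s:{0..<u}|circle. g s))
      = (LINT s:{u..<v}|circle. g s)" by simp
qed

text \<open>
  The indefinite integral of the weak derivative has the same weak derivative, so the two
  functions differ by a constant almost everywhere.
\<close>

lemma has_weak_deriv_imp_primitive:
  assumes f: "has_weak_deriv f g" and g: "sq_integrable g"
  obtains F where "is_primitive F g" "F 0 = F 1" "AE u in circle. f u = F u"
proof -
  define G where "G u = 0 + (LINT s:{0..<u}|circle. g s)" for u
  have G: "is_primitive G g" unfolding G_def by (rule is_primitive_indefinite_integral[OF g])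
  have "G 1 - G 0 = 0" using is_primitive_total[OF G] has_weak_deriv_integral_zero[OF f] by simp
  then have ends: "G 0 = G 1" by simp
  have wG: "has_weak_deriv G g" by (rule is_primitive_has_weak_deriv[OF G ends])
  have "has_weak_deriv (\<lambda>u. f u + (-1) *\<^sub>R G u) (\<lambda>u. g u + (-1) *\<^sub>R g u)"
    by (intro has_weak_deriv_add f has_weak_deriv_scaleR wG)
  then have "has_weak_deriv (\<lambda>u. f u - G u) (\<lambda>_. 0)" by simp
  from has_weak_deriv_zero_imp_const[OF this] obtain c where c: "AE u in circle. f u - G u = c" by blast
  show thesis
  proof
    show "is_primitive (\<lambda>u. c + G u) g" using is_primitive_add[OF is_primitive_const G, of c] by simp
    show "AE u in circle. f u = c + G u" using c by eventually_elim (simp add: algebra_simps)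
  qed (simp add: ends)
qed

text \<open>
  Continuity turns almost-everywhere identities into pointwise ones, end points included.
\<close>

lemma continuous_AE_eq:
  fixes f g :: "real \<Rightarrow> 'a::euclidean_space"
  assumes f: "continuous_on {0..1} f" and g: "continuous_on {0..1} g"
    and ae: "AE u in circle. f u = g u" and u: "u \<in> {0..1}"
  shows "f u = g u"
proof -
  let ?D = "\<lambda>u. f u - g u"
  have cont: "continuous_on {0..1} ?D" using f g by (intro continuous_intros)
  have cont': "continuous_on {0<..<1} ?D" by (rule continuous_on_subset[OF cont]) auto
  let ?S = "{0<..<1} \<inter> ?D -` (- {0})"
  have "open ?S" by (rule continuous_open_preimage[OF cont']) auto
  have "AE u in lborel. u \<in> {0..<1} \<longrightarrow> f u = g u"
    using ae unfolding circle_def by (subst (asm) AE_restrict_space_iff) auto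
  then have "AE u in lborel. u \<notin> ?S" by eventually_elim auto
  then have "?S \<in> null_sets lborel"
    using \<open>open ?S\<close> by (subst AE_iff_null_sets) auto
  then have "negligible ?S"
    unfolding negligible_iff_null_sets by (rule null_sets_completionI)
  then have "?S = {}" using \<open>open ?S\<close> open_not_negligible by blast
  then have mid: "?D u = 0" if "u \<in> {0<..<1}" for u using that by auto
  have "?D u = 0"
  proof (rule continuous_constant_on_closure[where S = "{0<..<1}" and f = ?D])
    show "continuous_on (closure {0<..<1}) ?D"
      using cont by (rule continuous_on_subset) simp
    show "u \<in> closure {0<..<1}" using u by simp
  qed (rule mid)
  then show ?thesis by simp
qed

lemma is_primitive_cong_AE:
  assumes f: "is_primitive f g" and ae: "AE u in circle. g u = g' u"
    and m: "g' \<in> borel_measurable circle"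
  shows "is_primitive f g'"
  unfolding is_primitive_def
proof (intro conjI allI impI; (elim conjE)?)
  show "sq_integrable g'" by (rule sq_integrable_cong_AE[OF is_primitiveD(1)[OF f] ae m])
  fix u v :: real assume uv: "0 \<le> u" "u \<le> v" "v \<le> 1"
  then have A: "{u..<v} \<in> sets circle" by (intro interval_in_sets_circle)
  have "(LINT s:{u..<v}|circle. g s) = (LINT s:{u..<v}|circle. g' s)"
    unfolding set_lebesgue_integral_def
  proof (rule integral_cong_AE)
    show "(\<lambda>x. indicat_real {u..<v} x *\<^sub>R g x) \<in> borel_measurable circle"
      "(\<lambda>x. indicat_real {u..<v} x *\<^sub>R g' x) \<in> borel_measurable circle"
      using A m is_primitive_measurable(2)[OF f] by auto
    show "AE x in circle. indicat_real {u..<v} x *\<^sub>R g x = indicat_real {u..<v} x *\<^sub>R g' x"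
      using ae by eventually_elim simp
  qed
  then show "f v - f u = (LINT s:{u..<v}|circle. g' s)"
    using is_primitiveD(3)[OF f uv] by simp
qed

lemma is_primitive_cong:
  assumes "is_primitive f g" "\<And>u. u \<in> {0..1} \<Longrightarrow> f u = f' u"
  shows "is_primitive f' g"
  using assms by (auto simp: is_primitive_def)

lemma is_primitive_unique:
  assumes f: "is_primitive f g" and f': "is_primitive f' g'"
    and eq: "\<And>u. u \<in> {0..1} \<Longrightarrow> f u = f' u"
  shows "AE u in circle. g u = g' u"
proof -
  let ?h = "\<lambda>u. f u - f' u"
  have h: "is_primitive ?h (\<lambda>u. g u - g' u)" by (rule is_primitive_diff[OF f f'])
  have h0: "is_primitive ?h (\<lambda>_. 0)"
    by (rule is_primitive_cong[OF is_primitive_const[of 0]]) (use eq in auto)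
  have "?h 0 = ?h 1" using eq[of 0] eq[of 1] by simp
  then have "AE u in circle. g u - g' u = 0"
    using has_weak_deriv_unique[OF is_primitive_has_weak_deriv[OF h] is_primitive_has_weak_deriv[OF h0]]
    by blast
  then show ?thesis by simp
qed

section \<open>The velocity of a curve in the Sobolev space\<close>

text \<open>
  The weak derivative \<open>d1\<close> is only a choice of representative. This is its continuous
  representative on \<open>[0, 1]\<close>, and the estimates below are stated for it.
\<close>

definition velocity :: "'a::euclidean_space H2 \<Rightarrow> real \<Rightarrow> 'a" where
  "velocity x = (SOME T. is_primitive T (d2 x) \<and> T 0 = T 1 \<and> (AE u in circle. d1 x u = T u))"

lemma velocity:
  shows velocity_primitive: "is_primitive (velocity x) (d2 x)"
    and velocity_ends: "velocity x 0 = velocity x 1"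
    and velocity_AE: "AE u in circle. d1 x u = velocity x u"
proof -
  obtain T where "is_primitive T (d2 x)" "T 0 = T 1" "AE u in circle. d1 x u = T u"
    using has_weak_deriv_imp_primitive[OF H2_derivs(2,5)] by blast
  then have "\<exists>T. is_primitive T (d2 x) \<and> T 0 = T 1 \<and> (AE u in circle. d1 x u = T u)" by blast
  from someI_ex[OF this]
  show "is_primitive (velocity x) (d2 x)" "velocity x 0 = velocity x 1"
    "AE u in circle. d1 x u = velocity x u"
    unfolding velocity_def by blast+
qed

lemma velocity_continuous: "continuous_on {0..1} (velocity x)"
  by (rule is_primitive_continuous[OF velocity_primitive])

lemma velocity_eqI:
  assumes "continuous_on {0..1} T" "AE u in circle. d1 x u = T u" "u \<in> {0..1}"
  shows "velocity x u = T u"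
proof (rule continuous_AE_eq[OF velocity_continuous assms(1) _ assms(3)])
  show "AE u in circle. velocity x u = T u"
    using velocity_AE[of x] assms(2) by eventually_elim simp
qed

lemma fun_of_primitive: "is_primitive (fun_of x) (velocity x)"
proof -
  obtain F where F: "is_primitive F (d1 x)" "AE u in circle. fun_of x u = F u"
    using has_weak_deriv_imp_primitive[OF H2_derivs(1,4)] by blast
  have "continuous_on {0..1} (fun_of x)"
    using fun_of[of x] by (auto intro: continuous_on_subset)
  then have "F u = fun_of x u" if "u \<in> {0..1}" for u
    using continuous_AE_eq[OF _ is_primitive_continuous[OF F(1)] F(2) that] by simp
  then have "is_primitive (fun_of x) (d1 x)" by (rule is_primitive_cong[OF F(1)])
  then show ?thesis
    by (rule is_primitive_cong_AE[OF _ velocity_AE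
          is_primitive_measurable(1)[OF velocity_primitive]])
qed

lemma fun_of_periodic: "fun_of x (u + 1) = fun_of x u"
  using fun_of[of x] by auto

lemma fun_of_ends: "fun_of x 0 = fun_of x 1"
  using fun_of_periodic[of x 0] by simp

lemma velocity_integral_zero: "(LINT u|circle. velocity x u) = 0"
  using is_primitive_total[OF fun_of_primitive[of x]] fun_of_ends[of x] by simp

lemma periodic_extension_continuous:
  fixes F :: "real \<Rightarrow> 'a::euclidean_space"
  assumes F: "continuous_on {0..1} F" and ends: "F 0 = F 1"
  shows "continuous_on UNIV (\<lambda>u. F (frac u))"
  unfolding continuous_on_iff
proof (intro ballI allI impI)
  fix u e :: real assume "e > 0"
  then have "e / 2 > 0" by simp
  then obtain d where d: "d > 0"
    "\<And>s t. s \<in> {0..1} \<Longrightarrow> t \<in> {0..1} \<Longrightarrow> dist s t < d \<Longrightarrow> dist (F s) (F t) < e / 2"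
    using compact_uniformly_continuous[OF F] unfolding uniformly_continuous_on_def by (metis compact_Icc)
  have main: "dist (F (frac s)) (F (frac t)) < e" if st: "s \<le> t" "t - s < min d 1" for s t
  proof -
    have fr: "frac s \<in> {0..1}" "frac t \<in> {0..1}"
      using frac_lt_1[of s] frac_lt_1[of t] by (auto simp: less_imp_le)
    have "\<lfloor>s\<rfloor> \<le> \<lfloor>t\<rfloor>" using st by (intro floor_mono)
    moreover have "\<lfloor>t\<rfloor> \<le> \<lfloor>s\<rfloor> + 1" using st by linarith
    ultimately consider "\<lfloor>t\<rfloor> = \<lfloor>s\<rfloor>" | "\<lfloor>t\<rfloor> = \<lfloor>s\<rfloor> + 1" by linarith
    then show ?thesis
    proof cases
      case 1
      then have "dist (frac s) (frac t) < d" using st by (simp add: frac_def dist_real_def)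
      then show ?thesis using d(2)[OF fr] \<open>e > 0\<close> by linarith
    next
      case 2
      then have "frac t + (1 - frac s) = t - s" by (simp add: frac_def)
      moreover have "0 \<le> frac t" "0 \<le> 1 - frac s" using fr by auto
      ultimately have "1 - frac s < d" "frac t < d" using st by linarith+
      then have "dist (frac s) 1 < d" "dist 0 (frac t) < d"
        using \<open>0 \<le> frac t\<close> \<open>0 \<le> 1 - frac s\<close> by (simp_all add: dist_real_def abs_minus_commute)
      then have "dist (F (frac s)) (F 1) < e / 2" "dist (F 0) (F (frac t)) < e / 2"
        using d(2)[of "frac s" 1] d(2)[of 0 "frac t"] fr by auto
      then show ?thesis using dist_triangle[of "F (frac s)" "F (frac t)" "F 1"] ends by simp
    qed
  qed
  show "\<exists>d>0. \<forall>t\<in>UNIV. dist t u < d \<longrightarrow> dist (F (frac t)) (F (frac u)) < e"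
  proof (intro exI[of _ "min d 1"] conjI ballI impI)
    fix t :: real assume "dist t u < min d 1"
    then show "dist (F (frac t)) (F (frac u)) < e"
      using main[of t u] main[of u t] by (cases "t \<le> u") (auto simp: dist_real_def dist_commute)
  qed (use d in auto)
qed

text \<open>
  All curves of the proof are prescribed by a closed velocity with a square-integrable
  derivative: the deformations of a given curve, the tangent fields used for testing, and the
  limit curve.
\<close>

lemma H2_from_velocity:
  fixes T :: "real \<Rightarrow> 'a::euclidean_space"
  assumes T: "is_primitive T p" and ends: "T 0 = T 1" and closed: "(LINT s|circle. T s) = 0"
  obtains x where "fun_of x 0 = z" "\<And>u. u \<in> {0..1} \<Longrightarrow> velocity x u = T u"
    "AE u in circle. d1 x u = T u" "AE u in circle. d2 x u = p u"
proof -
  obtain B where B: "\<And>u. u \<in> {0..1} \<Longrightarrow> norm (T u) \<le> B"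
    using continuous_on_unit_interval_bounded[OF is_primitive_continuous[OF T]] by blast
  have sT: "sq_integrable T"
    by (rule sq_integrable_bound[OF sq_integrable_continuous[of "\<lambda>_. 1 :: real"]
          is_primitive_measurable(1)[OF T], of B])
       (use B in auto)
  define F where "F u = z + (LINT s:{0..<u}|circle. T s)" for u
  have F: "is_primitive F T" unfolding F_def by (rule is_primitive_indefinite_integral[OF sT])
  have F1: "F 0 = F 1" using is_primitive_total[OF F] closed by simp
  define f where "f u = F (frac u)" for u
  have fF: "F u = f u" if "u \<in> {0..1}" for u
  proof (cases "u = 1")
    case False
    then have "frac u = u" using that by (simp add: frac_eq)
    then show ?thesis by (simp add: f_def)
  qed (simp add: f_def F1)
  have f: "is_primitive f T" by (rule is_primitive_cong[OF F fF])
  have cf: "continuous_on UNIV f"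
    unfolding f_def by (rule periodic_extension_continuous[OF is_primitive_continuous[OF F] F1])
  have per: "f (u + 1) = f u" for u by (simp add: f_def frac_1_eq)
  have w1: "has_weak_deriv f T" using is_primitive_has_weak_deriv[OF f] per[of 0] by simp
  have w2: "has_weak_deriv T p" by (rule is_primitive_has_weak_deriv[OF T ends])
  have "W22 f"
    unfolding W22_def
    using sq_integrable_continuous[OF cf] sT w1 w2 is_primitiveD(1)[OF T] by blast
  then have fx: "fun_of (Abs_H2 f) = f" using cf per by (intro Abs_H2_inverse) auto
  note D = d_AE_eq[of "Abs_H2 f", unfolded fx, OF w1 w2]
  show thesis
  proof (rule that[of "Abs_H2 f"])
    show "fun_of (Abs_H2 f) 0 = z"
      unfolding fx using fF[of 0] by (simp add: F_def set_lebesgue_integral_def)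
    show "velocity (Abs_H2 f) u = T u" if "u \<in> {0..1}" for u
      by (rule velocity_eqI[OF is_primitive_continuous[OF T] D(1) that])
  qed (use D in auto)
qed

lemma L2_sq_cong_AE:
  assumes "AE u in circle. f u = g u" "f \<in> borel_measurable circle" "g \<in> borel_measurable circle"
  shows "L2_sq f = L2_sq g"
  unfolding L2_sq_def
  by (rule integral_cong_AE) (use assms in \<open>auto\<close>)

lemma norm_H2_sq: "(norm x)\<^sup>2 = L2_sq (fun_of x) + L2_sq (velocity x) + L2_sq (d2 x)"
proof -
  have "(norm x)\<^sup>2 = inner x x" by (rule power2_norm_eq_inner)
  also have "\<dots> = L2_sq (fun_of x) + L2_sq (d1 x) + L2_sq (d2 x)"
  proof -
    note i = sq_integrable_norm_sq[OF H2_derivs(3)[of x]] sq_integrable_norm_sq[OF H2_derivs(4)[of x]]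
      sq_integrable_norm_sq[OF H2_derivs(5)[of x]]
    show ?thesis
      unfolding inner_H2_def dot_square_norm L2_sq_def
      by (rule trans[OF Bochner_Integration.integral_add[OF
              Bochner_Integration.integrable_add[OF i(1,2)] i(3)]])
         (simp only: Bochner_Integration.integral_add[OF i(1,2)])
  qed
  also have "L2_sq (d1 x) = L2_sq (velocity x)"
    by (rule L2_sq_cong_AE[OF velocity_AE])
       (auto intro: is_primitive_measurable(1)[OF velocity_primitive])
  finally show ?thesis .
qed

lemma
  shows fun_of_diff: "fun_of (x - y) u = fun_of x u - fun_of y u"
    and d2_diff: "AE u in circle. d2 (x - y) u = d2 x u - d2 y u"
    and velocity_diff: "u \<in> {0..1} \<Longrightarrow> velocity (x - y) u = velocity x u - velocity y u"
proof -
  show "fun_of (x - y) u = fun_of x u - fun_of y u"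
    unfolding minus_H2_def uminus_H2_def plus_H2.rep_eq scaleR_H2.rep_eq by simp
  show "AE u in circle. d2 (x - y) u = d2 x u - d2 y u"
    using d_add(2)[of x "(-1) *\<^sub>R y"] d_scaleR(2)[of "-1" y]
    unfolding minus_H2_def uminus_H2_def by eventually_elim simp
  assume u: "u \<in> {0..1}"
  show "velocity (x - y) u = velocity x u - velocity y u"
  proof (rule velocity_eqI[OF _ _ u])
    show "continuous_on {0..1} (\<lambda>u. velocity x u - velocity y u)"
      by (intro continuous_intros velocity_continuous)
    show "AE u in circle. d1 (x - y) u = velocity x u - velocity y u"
      using d_add(1)[of x "(-1) *\<^sub>R y"] d_scaleR(1)[of "-1" y] velocity_AE[of x] velocity_AE[of y]
      unfolding minus_H2_def uminus_H2_def by eventually_elim simp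
  qed
qed

lemma velocity_scaleR:
  assumes u: "u \<in> {0..1}"
  shows "velocity (r *\<^sub>R x) u = r *\<^sub>R velocity x u"
proof (rule velocity_eqI[OF _ _ u])
  show "continuous_on {0..1} (\<lambda>u. r *\<^sub>R velocity x u)"
    by (intro continuous_intros velocity_continuous)
  show "AE u in circle. d1 (r *\<^sub>R x) u = r *\<^sub>R velocity x u"
    using d_scaleR(1)[of r x] velocity_AE[of x] by eventually_elim simp
qed

section \<open>Chords and arcs of curves of unit speed\<close>

definition circle_dist :: "real \<Rightarrow> real \<Rightarrow> real" where
  "circle_dist u v = min \<bar>u - v\<bar> (1 - \<bar>u - v\<bar>)"

text \<open>
  The shorter of the two arcs between two parameters, as a subset of the fundamental domain. An
  arc through the parameter 0 appears as the complement of an interval.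
\<close>

definition short_arc :: "real \<Rightarrow> real \<Rightarrow> real set" where
  "short_arc u v = (if \<bar>u - v\<bar> \<le> 1 / 2 then {min u v..<max u v} else {0..<1} - {min u v..<max u v})"

lemma circle_dist_bounds:
  assumes "u \<in> {0..<1}" "v \<in> {0..<1}"
  shows "0 \<le> circle_dist u v" "circle_dist u v \<le> 1 / 2" "circle_dist u v = 0 \<longleftrightarrow> u = v" "circle_dist u v = circle_dist v u"
  using assms by (auto simp: circle_dist_def min_def abs_minus_commute)

lemma
  assumes "u \<in> {0..<1}" "v \<in> {0..<1}"
  shows arc_sets: "short_arc u v \<in> sets circle"
    and measure_arc: "measure circle (short_arc u v) = circle_dist u v"
    and arc_subset: "short_arc u v \<subseteq> {0..<1}"
proof -
  have I: "{min u v..<max u v} \<in> sets circle"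
    using assms by (intro interval_in_sets_circle) auto
  have m: "measure circle {min u v..<max u v} = \<bar>u - v\<bar>"
    using assms by (subst measure_circle_interval) (auto simp: min_def max_def)
  have S: "{0..<1} \<in> sets circle" using interval_in_sets_circle[of 0 1] by simp
  show "short_arc u v \<in> sets circle" using I S by (simp add: short_arc_def sets.Diff)
  have "measure circle ({0..<1} - {min u v..<max u v}) = 1 - \<bar>u - v\<bar>"
    using circle.finite_measure_Diff[OF S I] assms by (auto simp: m measure_circle_space)
  then show "measure circle (short_arc u v) = circle_dist u v"
    by (cases "\<bar>u - v\<bar> \<le> 1 / 2") (simp_all add: short_arc_def m circle_dist_def min_absorb1 min_absorb2)
  show "short_arc u v \<subseteq> {0..<1}" using assms by (auto simp: short_arc_def min_def max_def)
qed

lemma arc_commute: "short_arc u v = short_arc v u"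
  by (simp add: short_arc_def abs_minus_commute min.commute max.commute)

text \<open>
  Over the complementary interval the increment is computed the other way around, because the
  function takes the same value at 0 and 1. The sign depends only on \<open>u\<close> and \<open>v\<close> and drops out
  of inner products.
\<close>

lemma arc_increment:
  assumes F: "is_primitive F g" and ends: "F 0 = F 1" and uv: "u \<in> {0..<1}" "v \<in> {0..<1}"
  shows "F v - F u = (if (\<bar>u - v\<bar> \<le> 1 / 2) = (u \<le> v) then 1 else - 1) *\<^sub>R (LINT s:short_arc u v|circle. g s)"
proof -
  have ord: "F v - F u = (if \<bar>u - v\<bar> \<le> 1 / 2 then 1 else - 1) *\<^sub>R (LINT s:short_arc u v|circle. g s)"
    if uv: "u \<in> {0..<1}" "v \<in> {0..<1}" "u \<le> v" for u v
  proof (cases "\<bar>u - v\<bar> \<le> 1 / 2")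
    case True
    then show ?thesis using is_primitiveD(3)[OF F, of u v] uv by (simp add: short_arc_def)
  next
    case False
    let ?A = "{0..<u} \<union> {v..<1}"
    have short_arc: "short_arc u v = ?A" using uv False by (auto simp: short_arc_def)
    have s: "{0..<u} \<in> sets circle" "{v..<1} \<in> sets circle"
      using uv by (auto intro: interval_in_sets_circle)
    note i = set_integrable_circle[OF is_primitiveD(2)[OF F]]
    have "(LINT s:?A|circle. g s) = (LINT s:{0..<u}|circle. g s) + (LINT s:{v..<1}|circle. g s)"
      using uv by (intro set_integral_Un i s) auto
    also have "\<dots> = (F u - F 0) + (F 1 - F v)"
      using is_primitiveD(3)[OF F, of 0 u] is_primitiveD(3)[OF F, of v 1] uv by simp
    finally show ?thesis using False ends by (simp add: short_arc)
  qed
  show ?thesis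
  proof (cases "u \<le> v")
    case True
    then show ?thesis using ord[OF uv True] by simp
  next
    case False
    then have "F v - F u = - (F u - F v)" "v \<le> u" by simp_all
    then show ?thesis using ord[OF uv(2,1)] False
      by (simp add: arc_commute[of v u] abs_minus_commute[of v u] split: if_splits)
  qed
qed

lemma arc_increment_inner:
  assumes "is_primitive F g" "F 0 = F 1" "is_primitive G h" "G 0 = G 1" "u \<in> {0..<1}" "v \<in> {0..<1}"
  shows "(F v - F u) \<bullet> (G v - G u) = (LINT s:short_arc u v|circle. g s) \<bullet> (LINT s:short_arc u v|circle. h s)"
  unfolding arc_increment[OF assms(1,2,5,6)] arc_increment[OF assms(3,4,5,6)] by simp

lemma set_integral_mono_sets:
  fixes g :: "real \<Rightarrow> real"
  assumes "integrable circle g" "\<And>s. g s \<ge> 0" "A \<subseteq> B" "A \<in> sets circle" "B \<in> sets circle"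
  shows "(LINT s:A|circle. g s) \<le> (LINT s:B|circle. g s)"
  unfolding set_lebesgue_integral_def
proof (rule integral_mono_AE)
  show "integrable circle (\<lambda>s. indicat_real A s *\<^sub>R g s)" "integrable circle (\<lambda>s. indicat_real B s *\<^sub>R g s)"
    using set_integrable_circle[OF assms(1)] assms(4,5) by (simp_all add: set_integrable_def)
qed (use assms in \<open>auto simp: indicator_def\<close>)

text \<open>
  If the arc passes through 0, the oscillation is split there.
\<close>

lemma arc_oscillation:
  assumes T: "is_primitive T p" and ends: "T 0 = T 1" and uv: "u \<in> {0..<1}" "v \<in> {0..<1}"
    and sr: "s \<in> short_arc u v" "r \<in> short_arc u v"
  shows "norm (T s - T r) \<le> (LINT w:short_arc u v|circle. norm (p w))"
proof -
  have ip: "integrable circle (\<lambda>w. norm (p w))" using is_primitiveD(2)[OF T] by simp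
  note A = arc_sets[OF uv]
  have main: "norm (T r - T s) \<le> (LINT w:short_arc u v|circle. norm (p w))"
    if sr: "s \<in> short_arc u v" "r \<in> short_arc u v" "s \<le> r" for s r
  proof (cases "{s..<r} \<subseteq> short_arc u v")
    case True
    have "s \<in> {0..<1}" "r \<in> {0..<1}" using sr arc_subset[OF uv] by auto
    then have I: "{s..<r} \<in> sets circle" by (intro interval_in_sets_circle) auto
    have "norm (T r - T s) \<le> (LINT w:{s..<r}|circle. norm (p w))"
      using is_primitive_increment_le[OF T, of s r] sr \<open>s \<in> {0..<1}\<close> \<open>r \<in> {0..<1}\<close> by simp
    also have "\<dots> \<le> (LINT w:short_arc u v|circle. norm (p w))"
      by (rule set_integral_mono_sets[OF ip _ True I A]) simp
    finally show ?thesis .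
  next
    case False
    then have far: "\<not> \<bar>u - v\<bar> \<le> 1 / 2" using sr by (auto simp: short_arc_def)
    have 01: "s \<in> {0..<1}" "r \<in> {0..<1}" using sr arc_subset[OF uv] by auto
    have sep: "s < min u v" "max u v \<le> r"
      using False far sr 01 by (auto simp: short_arc_def subset_iff)
    then have sub: "{0..<s} \<union> {r..<1} \<subseteq> short_arc u v" using far 01 by (auto simp: short_arc_def)
    have I: "{0..<s} \<in> sets circle" "{r..<1} \<in> sets circle"
      using 01 by (auto intro: interval_in_sets_circle)
    have "T r - T s = - ((T s - T 0) + (T 1 - T r))" using ends by simp
    then have "norm (T r - T s) \<le> norm (T s - T 0) + norm (T 1 - T r)"
      by (metis norm_minus_cancel norm_triangle_ineq)
    also have "\<dots> \<le> (LINT w:{0..<s}|circle. norm (p w)) + (LINT w:{r..<1}|circle. norm (p w))"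
      using is_primitive_increment_le[OF T, of 0 s] is_primitive_increment_le[OF T, of r 1] 01 by simp
    also have "\<dots> = (LINT w:{0..<s} \<union> {r..<1}|circle. norm (p w))"
      using sr by (intro set_integral_Un[symmetric] set_integrable_circle ip I) auto
    also have "\<dots> \<le> (LINT w:short_arc u v|circle. norm (p w))"
      by (rule set_integral_mono_sets[OF ip _ sub _ A]) (use I in auto)
    finally show ?thesis .
  qed
  show ?thesis
    using main[of s r] main[of r s] sr by (cases "s \<le> r") (auto simp: norm_minus_commute)
qed

lemma circle_dist_arc_le:
  assumes "u \<in> {0..<1}" "v \<in> {0..<1}" "s \<in> short_arc u v"
  shows "circle_dist u s \<le> circle_dist u v" "circle_dist v s \<le> circle_dist u v"
  using assms by (auto simp: short_arc_def circle_dist_def min_def max_def abs_if split: if_splits)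

lemma set_integral_dev_bound:
  fixes E :: "real \<Rightarrow> 'a::euclidean_space"
  assumes A: "A \<in> sets circle" and E: "integrable circle E"
    and osc: "\<And>s r. s \<in> A \<Longrightarrow> r \<in> A \<Longrightarrow> norm (E s - E r) \<le> a" and s: "s \<in> A"
  shows "norm (measure circle A *\<^sub>R E s - (LINT r:A|circle. E r)) \<le> measure circle A * a"
proof -
  have ic: "integrable circle (\<lambda>_. c)" for c :: 'a by simp
  have "measure circle A *\<^sub>R E s - (LINT r:A|circle. E r) = (LINT r:A|circle. E s - E r)"
    using set_integral_diff[OF set_integrable_circle[OF ic A] set_integrable_circle[OF E A]]
    by (simp add: set_integral_const_circle[OF A])
  also have "norm \<dots> \<le> (LINT r:A|circle. norm (E s - E r))"
    by (intro set_integral_norm_bound_circle Bochner_Integration.integrable_diff ic E A)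
  also have "\<dots> \<le> (LINT r:A|circle. a)"
    by (rule set_integral_mono_circle[OF _ _ A]) (use E s osc in auto)
  finally show ?thesis by (simp add: set_integral_const_circle[OF A])
qed

text \<open>
  The left-hand side divided by the measure is, up to sign, the integral of the inner product of
  the deviations of \<open>E\<close> and \<open>F\<close> from their means, and each deviation is bounded by the
  oscillation.
\<close>

lemma covariance_bound:
  fixes E F :: "real \<Rightarrow> 'a::euclidean_space"
  assumes A: "A \<in> sets circle" and E: "sq_integrable E" and F: "sq_integrable F"
    and a: "\<And>s r. s \<in> A \<Longrightarrow> r \<in> A \<Longrightarrow> norm (E s - E r) \<le> a"
    and b: "\<And>s r. s \<in> A \<Longrightarrow> r \<in> A \<Longrightarrow> norm (F s - F r) \<le> b"
  shows "\<bar>measure circle A * (LINT s:A|circle. E s \<bullet> F s)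
      - (LINT s:A|circle. E s) \<bullet> (LINT s:A|circle. F s)\<bar> \<le> (measure circle A)\<^sup>2 * a * b"
proof (cases "measure circle A = 0")
  case True
  have "(LINT s:A|circle. E s) = 0"
  proof -
    have "emeasure circle A = 0" using True by (simp add: circle.emeasure_eq_measure)
    then have "AE s in circle. s \<notin> A" using A by (auto intro: AE_not_in null_setsI)
    then have "AE s in circle. indicator A s *\<^sub>R E s = 0"
      by eventually_elim simp
    then show ?thesis unfolding set_lebesgue_integral_def by (rule integral_eq_zero_AE)
  qed
  then show ?thesis using True by simp
next
  case False
  define m where "m = measure circle A"
  have m: "m > 0" using False measure_nonneg[of circle A] unfolding m_def by linarith
  define IE where "IE = (LINT s:A|circle. E s)"
  define IF where "IF = (LINT s:A|circle. F s)"
  note iE = sq_integrable_imp_integrable[OF E] and iF = sq_integrable_imp_integrable[OF F]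
  note iEF = sq_integrable_inner[OF E F]
  have ne: "A \<noteq> {}" using False by auto
  then obtain s0 where s0: "s0 \<in> A" by blast
  have a0: "a \<ge> 0" "b \<ge> 0" using a[OF s0 s0] b[OF s0 s0] by simp_all
  let ?h = "\<lambda>s. (m *\<^sub>R E s - IE) \<bullet> (m *\<^sub>R F s - IF)"
  have i1: "integrable circle (\<lambda>s. m\<^sup>2 * (E s \<bullet> F s))" using iEF by simp
  have i2: "integrable circle (\<lambda>s. m * (E s \<bullet> IF))" using iE by simp
  have i3: "integrable circle (\<lambda>s. m * (IE \<bullet> F s))" using iF by simp
  have i4: "integrable circle (\<lambda>s. IE \<bullet> IF)" by simp
  have h: "?h s = m\<^sup>2 * (E s \<bullet> F s) - m * (E s \<bullet> IF) - m * (IE \<bullet> F s) + IE \<bullet> IF" for s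
    by (simp add: inner_diff inner_commute power2_eq_square algebra_simps)
  have ih: "integrable circle ?h" unfolding h using i1 i2 i3 by simp
  have si: "set_integrable circle A f" if "integrable circle f" for f :: "real \<Rightarrow> real"
    by (rule set_integrable_circle[OF that A])
  have "(LINT s:A|circle. ?h s) = (LINT s:A|circle. m\<^sup>2 * (E s \<bullet> F s)) - (LINT s:A|circle. m * (E s \<bullet> IF))
      - (LINT s:A|circle. m * (IE \<bullet> F s)) + (LINT s:A|circle. IE \<bullet> IF)"
    unfolding h using i1 i2 i3 i4
    by (simp only: set_integral_add set_integral_diff si Bochner_Integration.integrable_diff)
  also have "(LINT s:A|circle. m * (E s \<bullet> IF)) = m * (IE \<bullet> IF)"
    using set_integral_bounded_linear_circle[OF bounded_linear_inner_left iE A, of IF]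
    by (simp add: IE_def)
  also have "(LINT s:A|circle. m * (IE \<bullet> F s)) = m * (IE \<bullet> IF)"
    using set_integral_bounded_linear_circle[OF bounded_linear_inner_right iF A, of IE]
    by (simp add: IF_def)
  also have "(LINT s:A|circle. IE \<bullet> IF) = m * (IE \<bullet> IF)"
    by (simp add: set_integral_const_circle[OF A] m_def)
  finally have eq: "(LINT s:A|circle. ?h s) = m * (m * (LINT s:A|circle. E s \<bullet> F s) - IE \<bullet> IF)"
    by (simp add: power2_eq_square algebra_simps)
  have "\<bar>LINT s:A|circle. ?h s\<bar> \<le> (LINT s:A|circle. \<bar>?h s\<bar>)"
    using set_integral_norm_bound_circle[OF ih A] by simp
  also have "\<dots> \<le> (LINT s:A|circle. (m * a) * (m * b))"
  proof (rule set_integral_mono_circle[OF _ _ A])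
    show "integrable circle (\<lambda>s. \<bar>?h s\<bar>)" using ih by simp
    fix s assume s: "s \<in> A"
    have "norm (m *\<^sub>R E s - IE) \<le> m * a" "norm (m *\<^sub>R F s - IF) \<le> m * b"
      unfolding m_def IE_def IF_def
      by (intro set_integral_dev_bound A iE iF a b s; assumption)+
    then have "norm (m *\<^sub>R E s - IE) * norm (m *\<^sub>R F s - IF) \<le> (m * a) * (m * b)"
      using m a0 by (intro mult_mono) auto
    then show "\<bar>?h s\<bar> \<le> (m * a) * (m * b)"
      using Cauchy_Schwarz_ineq2[of "m *\<^sub>R E s - IE" "m *\<^sub>R F s - IF"] by linarith
  qed simp
  also have "\<dots> = m * (m\<^sup>2 * a * b)"
    by (simp add: set_integral_const_circle[OF A] m_def[symmetric] power2_eq_square)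
  finally have "m * \<bar>m * (LINT s:A|circle. E s \<bullet> F s) - IE \<bullet> IF\<bar> \<le> m * (m\<^sup>2 * a * b)"
    unfolding eq using m by (simp add: abs_mult)
  then show ?thesis using m by (simp add: m_def IE_def IF_def)
qed

definition unit_speed :: "'a::euclidean_space H2 \<Rightarrow> bool" where
  "unit_speed x \<longleftrightarrow> (\<forall>u\<in>{0..1}. norm (velocity x u) = 1)"

lemma velocity_sq_integrable: "sq_integrable (velocity x)"
  by (rule is_primitiveD(1)[OF fun_of_primitive])

lemma arc_norm_sq_bound:
  assumes p: "sq_integrable p" and uv: "u \<in> {0..<1}" "v \<in> {0..<1}"
  shows "(LINT s:short_arc u v|circle. norm (p s))\<^sup>2 \<le> circle_dist u v * (LINT s:short_arc u v|circle. (norm (p s))\<^sup>2)"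
  using Cauchy_Schwarz_set[OF p arc_sets[OF uv]] by (simp add: measure_arc[OF uv])

text \<open>
  With \<open>E = F\<close> equal to the velocity \<open>T\<close>, the covariance measures how much shorter than the arc
  the chord is. The oscillation of \<open>T\<close> is at most \<open>\<integral> \<bar>T'\<bar>\<close>, whose square is at most the arc
  length times \<open>\<integral> \<bar>T'\<bar>\<^sup>2\<close>.
\<close>

lemma unit_speed_chord_deficit:
  assumes x: "unit_speed x" and uv: "u \<in> {0..<1}" "v \<in> {0..<1}"
  shows "(norm (fun_of x v - fun_of x u))\<^sup>2 \<le> (circle_dist u v)\<^sup>2"
    and "(circle_dist u v)\<^sup>2 - (norm (fun_of x v - fun_of x u))\<^sup>2
      \<le> circle_dist u v ^ 3 * (LINT s:short_arc u v|circle. (norm (d2 x s))\<^sup>2)"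
proof -
  let ?A = "short_arc u v"
  note A = arc_sets[OF uv] and mA = measure_arc[OF uv] and c0 = circle_dist_bounds(1)[OF uv]
  let ?T = "velocity x"
  have inc: "(norm (fun_of x v - fun_of x u))\<^sup>2 = (LINT s:?A|circle. ?T s) \<bullet> (LINT s:?A|circle. ?T s)"
    using arc_increment_inner[OF fun_of_primitive fun_of_ends fun_of_primitive fun_of_ends uv, of x x]
    by (simp add: power2_norm_eq_inner)
  have T1: "norm (?T s) = 1" if "s \<in> ?A" for s
    using x arc_subset[OF uv] that unfolding unit_speed_def by force
  have iT: "integrable circle ?T" by (rule sq_integrable_imp_integrable[OF velocity_sq_integrable])
  have "norm (LINT s:?A|circle. ?T s) \<le> (LINT s:?A|circle. norm (?T s))"
    by (rule set_integral_norm_bound_circle[OF iT A])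
  also have "\<dots> \<le> (LINT s:?A|circle. 1)"
    by (rule set_integral_mono_circle[OF _ _ A]) (use iT T1 in auto)
  also have "\<dots> = circle_dist u v" using set_integral_const_circle[OF A, of "1::real"] mA by simp
  finally show "(norm (fun_of x v - fun_of x u))\<^sup>2 \<le> (circle_dist u v)\<^sup>2"
    unfolding inc power2_norm_eq_inner[symmetric] by (intro power_mono) auto
  have TT: "(LINT s:?A|circle. ?T s \<bullet> ?T s) = circle_dist u v"
  proof -
    have "(LINT s:?A|circle. ?T s \<bullet> ?T s) = (LINT s:?A|circle. 1)"
      unfolding set_lebesgue_integral_def
      by (intro Bochner_Integration.integral_cong) (auto simp: T1 dot_square_norm indicator_def)
    then show ?thesis using set_integral_const_circle[OF A, of "1::real"] mA by simp
  qed
  let ?a = "LINT s:?A|circle. norm (d2 x s)"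
  have osc: "norm (?T s - ?T r) \<le> ?a" if "s \<in> ?A" "r \<in> ?A" for s r
    by (rule arc_oscillation[OF velocity_primitive velocity_ends uv that])
  have "\<bar>circle_dist u v * circle_dist u v - (norm (fun_of x v - fun_of x u))\<^sup>2\<bar> \<le> (circle_dist u v)\<^sup>2 * ?a * ?a"
    using covariance_bound[OF A velocity_sq_integrable velocity_sq_integrable osc osc]
    by (simp only: TT mA inc)
  moreover have "(circle_dist u v)\<^sup>2 * ?a\<^sup>2 \<le> (circle_dist u v)\<^sup>2 * (circle_dist u v * (LINT s:?A|circle. (norm (d2 x s))\<^sup>2))"
    by (intro mult_left_mono arc_norm_sq_bound H2_derivs uv) auto
  ultimately show "(circle_dist u v)\<^sup>2 - (norm (fun_of x v - fun_of x u))\<^sup>2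
      \<le> circle_dist u v ^ 3 * (LINT s:?A|circle. (norm (d2 x s))\<^sup>2)"
    by (simp add: power2_eq_square power3_eq_cube mult_ac)
qed

text \<open>
  The difference of the squared chords is the inner product of the increments of \<open>y - x\<close> and
  \<open>y + x\<close>. Since both curves have unit speed, the velocities of \<open>y - x\<close> and \<open>y + x\<close> are
  orthogonal at each parameter, so the covariance bound gains two oscillations, that is, a power
  of the arc length that compensates the singularity of the energy. The parameter \<open>l\<close> balances
  the two factors: one is of the size of the deformation and the other is not.
\<close>

lemma unit_speed_chord_difference:
  assumes x: "unit_speed x" and y: "unit_speed y" and uv: "u \<in> {0..<1}" "v \<in> {0..<1}" and l: "l > 0"
    and B: "\<And>s. s \<in> {0..1} \<Longrightarrow> norm (velocity y s - velocity x s) \<le> B"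
  defines "D \<equiv> \<bar>(norm (fun_of y v - fun_of y u))\<^sup>2 - (norm (fun_of x v - fun_of x u))\<^sup>2\<bar>"
  shows "D \<le> circle_dist u v ^ 3 / 2 * (LINT s:short_arc u v|circle. l * (norm (d2 y s - d2 x s))\<^sup>2
        + (norm (d2 y s + d2 x s))\<^sup>2 / l)"
    and "D \<le> 2 * (circle_dist u v)\<^sup>2 * B"
proof -
  let ?A = "short_arc u v"
  note A = arc_sets[OF uv] and mA = measure_arc[OF uv] and c0 = circle_dist_bounds(1)[OF uv]
  let ?E = "\<lambda>s. velocity y s - velocity x s" and ?F = "\<lambda>s. velocity y s + velocity x s"
  let ?p = "\<lambda>s. d2 y s - d2 x s" and ?q = "\<lambda>s. d2 y s + d2 x s"
  have E: "is_primitive ?E ?p" "?E 0 = ?E 1" and F: "is_primitive ?F ?q" "?F 0 = ?F 1"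
    by (auto intro!: is_primitive_diff is_primitive_add velocity_primitive simp: velocity_ends)
  have f: "is_primitive (\<lambda>s. fun_of y s - fun_of x s) ?E"
    "is_primitive (\<lambda>s. fun_of y s + fun_of x s) ?F"
    by (intro is_primitive_diff is_primitive_add fun_of_primitive)+
  have fe: "fun_of y 0 - fun_of x 0 = fun_of y 1 - fun_of x 1"
    "fun_of y 0 + fun_of x 0 = fun_of y 1 + fun_of x 1" by (simp_all add: fun_of_ends)
  let ?I = "(LINT s:?A|circle. ?E s) \<bullet> (LINT s:?A|circle. ?F s)"
  have "(norm (fun_of y v - fun_of y u))\<^sup>2 - (norm (fun_of x v - fun_of x u))\<^sup>2
      = (fun_of y v - fun_of x v - (fun_of y u - fun_of x u))
        \<bullet> (fun_of y v + fun_of x v - (fun_of y u + fun_of x u))"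
    by (simp add: power2_norm_eq_inner inner_diff inner_add inner_commute)
  also have "\<dots> = ?I" by (rule arc_increment_inner[OF f(1) fe(1) f(2) fe(2) uv])
  finally have D: "D = \<bar>?I\<bar>" by (simp add: D_def)
  have sub: "s \<in> {0..1}" if "s \<in> ?A" for s using arc_subset[OF uv] that by force
  have orth: "?E s \<bullet> ?F s = 0" if "s \<in> ?A" for s
  proof -
    have "?E s \<bullet> ?F s = (norm (velocity y s))\<^sup>2 - (norm (velocity x s))\<^sup>2"
      by (simp add: power2_norm_eq_inner inner_diff inner_add inner_commute)
    then show ?thesis using x y sub[OF that] by (simp add: unit_speed_def)
  qed
  have EF: "(LINT s:?A|circle. ?E s \<bullet> ?F s) = 0"
  proof -
    have "(LINT s:?A|circle. ?E s \<bullet> ?F s) = (LINT s:?A|circle. 0)"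
      unfolding set_lebesgue_integral_def
      by (intro Bochner_Integration.integral_cong) (auto simp: orth indicator_def)
    then show ?thesis by simp
  qed
  note sE = is_primitiveD(1)[OF f(1)] and sF = is_primitiveD(1)[OF f(2)]
  let ?a = "LINT s:?A|circle. norm (?p s)" and ?b = "LINT s:?A|circle. norm (?q s)"
  let ?a2 = "LINT s:?A|circle. (norm (?p s))\<^sup>2" and ?b2 = "LINT s:?A|circle. (norm (?q s))\<^sup>2"
  have osc: "norm (?E s - ?E r) \<le> ?a" "norm (?F s - ?F r) \<le> ?b" if "s \<in> ?A" "r \<in> ?A" for s r
    by (rule arc_oscillation[OF E uv that], rule arc_oscillation[OF F uv that])
  have "\<bar>circle_dist u v * 0 - ?I\<bar> \<le> (circle_dist u v)\<^sup>2 * ?a * ?b"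
    using covariance_bound[OF A sE sF osc] by (simp only: EF mA)
  then have D1: "D \<le> (circle_dist u v)\<^sup>2 * (?a * ?b)" unfolding D by (simp add: mult.assoc)
  have ab: "?a * ?b \<le> (l * ?a\<^sup>2 + ?b\<^sup>2 / l) / 2"
  proof -
    have "0 \<le> (l * ?a - ?b)\<^sup>2 / l" using l by simp
    also have "\<dots> = l * ?a\<^sup>2 + ?b\<^sup>2 / l - 2 * (?a * ?b)"
      using l by (simp add: power2_eq_square field_simps)
    finally show ?thesis by simp
  qed
  also have "\<dots> \<le> (l * (circle_dist u v * ?a2) + (circle_dist u v * ?b2) / l) / 2"
    using l arc_norm_sq_bound[OF is_primitiveD(1)[OF E(1)] uv]
      arc_norm_sq_bound[OF is_primitiveD(1)[OF F(1)] uv]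
    by (intro divide_right_mono add_mono mult_left_mono) auto
  also have "\<dots> = circle_dist u v / 2 * (l * ?a2 + ?b2 / l)" by (simp add: field_simps)
  also have "l * ?a2 + ?b2 / l = (LINT s:?A|circle. l * (norm (?p s))\<^sup>2 + (norm (?q s))\<^sup>2 / l)"
  proof -
    have i: "set_integrable circle ?A (\<lambda>s. l * (norm (?p s))\<^sup>2)"
      "set_integrable circle ?A (\<lambda>s. (norm (?q s))\<^sup>2 / l)"
      using sq_integrable_norm_sq[OF is_primitiveD(1)[OF E(1)]]
        sq_integrable_norm_sq[OF is_primitiveD(1)[OF F(1)]]
      by (auto intro!: set_integrable_circle A)
    show ?thesis using set_integral_add(2)[OF i] by simp
  qed
  finally have ab': "?a * ?b \<le> circle_dist u v / 2 * (LINT s:?A|circle. l * (norm (?p s))\<^sup>2 + (norm (?q s))\<^sup>2 / l)" .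
  have "D \<le> (circle_dist u v)\<^sup>2 * (circle_dist u v / 2 * (LINT s:?A|circle. l * (norm (?p s))\<^sup>2 + (norm (?q s))\<^sup>2 / l))"
    by (rule order_trans[OF D1 mult_left_mono[OF ab']]) simp
  then show "D \<le> circle_dist u v ^ 3 / 2 * (LINT s:?A|circle. l * (norm (?p s))\<^sup>2 + (norm (?q s))\<^sup>2 / l)"
    by (simp add: power2_eq_square power3_eq_cube)
  have bnd: "norm (LINT s:?A|circle. G s) \<le> circle_dist u v * C"
    if "integrable circle G" "\<And>s. s \<in> ?A \<Longrightarrow> norm (G s) \<le> C" for G :: "real \<Rightarrow> 'a" and C
  proof -
    have "norm (LINT s:?A|circle. G s) \<le> (LINT s:?A|circle. norm (G s))"
      by (rule set_integral_norm_bound_circle[OF that(1) A])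
    also have "\<dots> \<le> (LINT s:?A|circle. C)"
      by (rule set_integral_mono_circle[OF _ _ A]) (use that in auto)
    finally show ?thesis using set_integral_const_circle[OF A, of C] mA by simp
  qed
  have "norm (?F s) \<le> 2" if "s \<in> ?A" for s
    using norm_triangle_ineq[of "velocity y s" "velocity x s"] x y sub[OF that]
    by (simp add: unit_speed_def)
  then have "norm (LINT s:?A|circle. ?F s) \<le> circle_dist u v * 2"
    by (intro bnd is_primitiveD(2)[OF f(2)])
  moreover have "norm (LINT s:?A|circle. ?E s) \<le> circle_dist u v * B"
    using B sub by (intro bnd is_primitiveD(2)[OF f(1)]) auto
  moreover have "B \<ge> 0" using order_trans[OF norm_ge_zero B[of 0]] by simp
  ultimately have "norm (LINT s:?A|circle. ?E s) * norm (LINT s:?A|circle. ?F s)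
      \<le> (circle_dist u v * B) * (circle_dist u v * 2)"
    using c0 by (intro mult_mono) auto
  then show "D \<le> 2 * (circle_dist u v)\<^sup>2 * B"
    unfolding D using Cauchy_Schwarz_ineq2[of "LINT s:?A|circle. ?E s" "LINT s:?A|circle. ?F s"]
    by (simp add: power2_eq_square mult_ac)
qed

section \<open>A singular integral over pairs of points\<close>

interpretation circle2: pair_sigma_finite circle circle
  by standard

lemma borel_measurable_id_circle [measurable]: "(\<lambda>u. u) \<in> borel_measurable circle"
  by (rule borel_measurable_circleI) simp

text \<open>
  The exponent has to exceed 1/2, so that two factors dominate the singularity \<open>1 / d\<close> of the
  energy, with a power to spare, and be less than 1, so that the kernel is integrable.
\<close>

definition riesz_kernel :: "real \<Rightarrow> real \<Rightarrow> real" where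
  "riesz_kernel u s = circle_dist u s powr (- 3 / 4)"

lemma circle_dist_measurable [measurable]:
  assumes [measurable]: "f \<in> borel_measurable M" "g \<in> borel_measurable M"
  shows "(\<lambda>x. circle_dist (f x) (g x)) \<in> borel_measurable M"
  unfolding circle_dist_def by measurable

lemma riesz_kernel_measurable [measurable]:
  assumes [measurable]: "f \<in> borel_measurable M" "g \<in> borel_measurable M"
  shows "(\<lambda>x. riesz_kernel (f x) (g x)) \<in> borel_measurable M"
  unfolding riesz_kernel_def by measurable

lemma nn_integral_powr_interval_finite:
  "(\<integral>\<^sup>+t. indicator {-2..2} t * ennreal (\<bar>t\<bar> powr (- 3 / 4)) \<partial>lborel) < \<infinity>"
proof -
  let ?f = "\<lambda>t::real. t powr (- 3 / 4)"
  let ?h = "\<lambda>t. ennreal (indicator {0..2} t * ?f t)"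
  have "(?f has_integral (2 powr (- 3 / 4 + 1) / (- 3 / 4 + 1))) {0..2}"
    by (rule has_integral_powr_from_0) auto
  from nn_integral_has_integral_lebesgue[OF _ this]
  have fin: "(\<integral>\<^sup>+t. ?h t \<partial>lborel) < \<infinity>" by simp
  have "(\<integral>\<^sup>+t. ?h t \<partial>lborel) = ennreal \<bar>-1\<bar> * (\<integral>\<^sup>+t. ?h (0 + (-1) * t) \<partial>lborel)"
    by (rule nn_integral_real_affine) auto
  then have fin': "(\<integral>\<^sup>+t. ?h (- t) \<partial>lborel) < \<infinity>" using fin by simp
  have "(\<integral>\<^sup>+t. indicator {-2..2} t * ennreal (\<bar>t\<bar> powr (- 3 / 4)) \<partial>lborel)
      \<le> (\<integral>\<^sup>+t. ?h t + ?h (- t) \<partial>lborel)"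
    by (intro nn_integral_mono) (auto simp: indicator_def)
  also have "\<dots> = (\<integral>\<^sup>+t. ?h t \<partial>lborel) + (\<integral>\<^sup>+t. ?h (- t) \<partial>lborel)"
    by (rule nn_integral_add) auto
  also have "\<dots> < \<infinity>" using fin fin' by simp
  finally show ?thesis .
qed

text \<open>
  The distance on the circle is the distance on the line to one of the translates by -1, 0 and
  1, so the kernel is dominated by three translates of an integrable function on the line.
\<close>

lemma riesz_kernel_mass_bounded:
  obtains C where "C \<ge> 0"
    "\<And>s. s \<in> {0..<1} \<Longrightarrow> (\<integral>\<^sup>+u. ennreal (riesz_kernel u s) \<partial>circle) \<le> ennreal C"
proof -
  define h where "h t = indicator {-2..2} t * ennreal (\<bar>t\<bar> powr (- 3 / 4))" for t :: real
  have h [measurable]: "h \<in> borel_measurable borel" unfolding h_def by measurable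
  define I where "I = (\<integral>\<^sup>+t. h t \<partial>lborel)"
  have I: "I < \<infinity>" unfolding I_def h_def by (rule nn_integral_powr_interval_finite)
  have shift: "(\<integral>\<^sup>+u. h (c + u) \<partial>lborel) = I" for c
    unfolding I_def using nn_integral_real_affine[OF h, of 1 c] by simp
  show thesis
  proof (rule that[of "enn2real (I + I + I)"])
    fix s :: real assume s: "s \<in> {0..<1}"
    have "(\<integral>\<^sup>+u. ennreal (riesz_kernel u s) \<partial>circle)
        = (\<integral>\<^sup>+u. ennreal (riesz_kernel u s) * indicator {0..<1} u \<partial>lborel)"
      unfolding circle_def by (rule nn_integral_restrict_space) simp
    also have "\<dots> \<le> (\<integral>\<^sup>+u. h (- s + u) + h (1 - s + u) + h (- 1 - s + u) \<partial>lborel)"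
    proof (rule nn_integral_mono)
      fix u :: real
      show "ennreal (riesz_kernel u s) * indicator {0..<1} u
          \<le> h (- s + u) + h (1 - s + u) + h (- 1 - s + u)"
      proof (cases "u \<in> {0..<1}")
        case True
        have "\<exists>t\<in>{- s + u, 1 - s + u, - 1 - s + u}. circle_dist u s = \<bar>t\<bar> \<and> t \<in> {-2..2}"
          using s True by (auto simp: circle_dist_def min_def abs_if)
        then obtain t where t: "t \<in> {- s + u, 1 - s + u, - 1 - s + u}" "circle_dist u s = \<bar>t\<bar>" "t \<in> {-2..2}"
          by blast
        have "ennreal (riesz_kernel u s) = h t"
          using t(2,3) by (simp add: riesz_kernel_def h_def)
        also have "\<dots> \<le> h (- s + u) + h (1 - s + u) + h (- 1 - s + u)"
          using t(1) by (auto intro: add_increasing add_increasing2)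
        finally show ?thesis using True by simp
      qed simp
    qed
    also have "\<dots> = I + I + I"
    proof -
      have m: "(\<lambda>u. h (c + u)) \<in> borel_measurable lborel" for c
        by (rule measurable_compose[OF _ h]) simp
      show ?thesis by (simp only: nn_integral_add m borel_measurable_add shift)
    qed
    also have "\<dots> = ennreal (enn2real (I + I + I))"
      using I by simp
    finally show "(\<integral>\<^sup>+u. ennreal (riesz_kernel u s) \<partial>circle) \<le> ennreal (enn2real (I + I + I))" .
  qed simp
qed

lemma AE_circle_neq: "AE s in circle. s \<noteq> u"
  unfolding circle_def by (subst AE_restrict_space_iff) (use AE_lborel_singleton[of u] in auto)

definition riesz_potential :: "(real \<Rightarrow> real) \<Rightarrow> real \<Rightarrow> real \<Rightarrow> ennreal" where
  "riesz_potential g u v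
    = (\<integral>\<^sup>+s. ennreal (g s) * (ennreal (riesz_kernel u s) * ennreal (riesz_kernel v s)) \<partial>circle)"

text \<open>
  A point of the shorter arc from \<open>u\<close> to \<open>v\<close> is at most as far from \<open>u\<close> and from \<open>v\<close> as these
  are from each other, so the average over the arc is dominated by a product of two kernels.
\<close>

lemma arc_integral_le_potential:
  assumes g: "integrable circle g" "\<And>s. g s \<ge> 0" and uv: "u \<in> {0..<1}" "v \<in> {0..<1}"
  shows "ennreal (circle_dist u v powr (- 3 / 2) * (LINT s:short_arc u v|circle. g s)) \<le> riesz_potential g u v"
proof -
  let ?A = "short_arc u v"
  note A = arc_sets[OF uv]
  have i: "integrable circle (\<lambda>s. indicat_real ?A s * g s)"
    using set_integrable_circle[OF g(1) A] by (simp add: set_integrable_def)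
  have gm [measurable]: "g \<in> borel_measurable circle" using g(1) by auto
  have Am [measurable]: "?A \<in> sets circle" by (rule A)
  have "ennreal (circle_dist u v powr (- 3 / 2) * (LINT s:?A|circle. g s))
      = ennreal (circle_dist u v powr (- 3 / 2)) * (\<integral>\<^sup>+s. ennreal (indicat_real ?A s * g s) \<partial>circle)"
    using nn_integral_eq_integral[OF i] g(2)
    by (simp add: set_lebesgue_integral_def ennreal_mult')
  also have "\<dots> = (\<integral>\<^sup>+s. ennreal (circle_dist u v powr (- 3 / 2)) * ennreal (indicat_real ?A s * g s) \<partial>circle)"
    by (rule nn_integral_cmult[symmetric]) measurable
  also have "\<dots> \<le> riesz_potential g u v"
    unfolding riesz_potential_def
  proof (rule nn_integral_mono_AE)
    have "AE s in circle. s \<in> {0..<1}" by (rule AE_I2) simp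
    then show "AE s in circle. ennreal (circle_dist u v powr (- 3 / 2)) * ennreal (indicat_real ?A s * g s)
        \<le> ennreal (g s) * (ennreal (riesz_kernel u s) * ennreal (riesz_kernel v s))"
      using AE_circle_neq[of u] AE_circle_neq[of v]
    proof eventually_elim
      case (elim s)
      show ?case
      proof (cases "s \<in> ?A")
        case True
        have pos: "0 < circle_dist u s" "0 < circle_dist v s"
          using elim circle_dist_bounds(1,3)[OF uv(1), of s] circle_dist_bounds(1,3)[OF uv(2), of s]
          by (auto simp: less_le)
        have k: "circle_dist u v powr (- 3 / 4) \<le> riesz_kernel u s"
          "circle_dist u v powr (- 3 / 4) \<le> riesz_kernel v s"
          unfolding riesz_kernel_def using pos circle_dist_arc_le[OF uv True]
          by (intro powr_mono2'; simp)+
        have "circle_dist u v powr (- 3 / 2) = circle_dist u v powr (- 3 / 4) * circle_dist u v powr (- 3 / 4)"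
          by (simp flip: powr_add)
        also have "\<dots> \<le> riesz_kernel u s * riesz_kernel v s"
          using k by (intro mult_mono) (auto simp: riesz_kernel_def)
        finally have "circle_dist u v powr (- 3 / 2) * g s \<le> g s * (riesz_kernel u s * riesz_kernel v s)"
          using g(2)[of s] by (simp add: mult.commute mult_left_mono)
        then show ?thesis
          using True g(2)[of s]
          by (simp add: ennreal_mult'[symmetric] ennreal_mult[symmetric] riesz_kernel_def ennreal_leI)
      qed simp
    qed
  qed
  finally show ?thesis .
qed

lemma riesz_potential_measurable:
  assumes [measurable]: "g \<in> borel_measurable circle"
  shows "(\<lambda>(u, v). riesz_potential g u v) \<in> borel_measurable (circle \<Otimes>\<^sub>M circle)"
  unfolding riesz_potential_def by measurable

text \<open>
  By Tonelli's theorem the integrals over \<open>u\<close> and \<open>v\<close> separate, and each is bounded by the mass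
  of the kernel.
\<close>

lemma riesz_potential_integral_le:
  assumes g: "integrable circle g" "\<And>s. g s \<ge> 0"
    and C: "C \<ge> 0" "\<And>s. s \<in> {0..<1} \<Longrightarrow> (\<integral>\<^sup>+u. ennreal (riesz_kernel u s) \<partial>circle) \<le> ennreal C"
  shows "(\<integral>\<^sup>+(u, v). riesz_potential g u v \<partial>(circle \<Otimes>\<^sub>M circle)) \<le> ennreal (C\<^sup>2 * (LINT s|circle. g s))"
proof -
  have gm [measurable]: "g \<in> borel_measurable circle" using g(1) by auto
  have inner: "(\<integral>\<^sup>+v. riesz_potential g u v \<partial>circle)
      \<le> (\<integral>\<^sup>+s. ennreal C * (ennreal (g s) * ennreal (riesz_kernel u s)) \<partial>circle)"
    if u: "u \<in> {0..<1}" for u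
  proof -
    have um [measurable]: "(\<lambda>_. u) \<in> borel_measurable (circle \<Otimes>\<^sub>M circle)" "(\<lambda>_. u) \<in> borel_measurable circle"
      by auto
    have "(\<integral>\<^sup>+v. riesz_potential g u v \<partial>circle)
        = (\<integral>\<^sup>+s. (\<integral>\<^sup>+v. ennreal (g s) * (ennreal (riesz_kernel u s) * ennreal (riesz_kernel v s)) \<partial>circle) \<partial>circle)"
      unfolding riesz_potential_def
      by (rule circle2.Fubini') measurable
    also have "\<dots> = (\<integral>\<^sup>+s. (ennreal (g s) * ennreal (riesz_kernel u s)) * (\<integral>\<^sup>+v. ennreal (riesz_kernel v s) \<partial>circle) \<partial>circle)"
      unfolding mult.assoc[symmetric]
      by (intro nn_integral_cong nn_integral_cmult) measurable
    also have "\<dots> \<le> (\<integral>\<^sup>+s. (ennreal (g s) * ennreal (riesz_kernel u s)) * ennreal C \<partial>circle)"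
      using C(2) by (intro nn_integral_mono mult_left_mono) auto
    finally show ?thesis by (simp add: mult.commute)
  qed
  have "(\<integral>\<^sup>+(u, v). riesz_potential g u v \<partial>(circle \<Otimes>\<^sub>M circle))
      = (\<integral>\<^sup>+u. \<integral>\<^sup>+v. riesz_potential g u v \<partial>circle \<partial>circle)"
    using circle.nn_integral_fst[OF riesz_potential_measurable[OF gm]] by simp
  also have "\<dots> \<le> (\<integral>\<^sup>+u. \<integral>\<^sup>+s. ennreal C * (ennreal (g s) * ennreal (riesz_kernel u s)) \<partial>circle \<partial>circle)"
    using inner by (intro nn_integral_mono[of circle "\<lambda>u. \<integral>\<^sup>+v. riesz_potential g u v \<partial>circle"]) auto
  also have "\<dots> = (\<integral>\<^sup>+s. \<integral>\<^sup>+u. ennreal C * (ennreal (g s) * ennreal (riesz_kernel u s)) \<partial>circle \<partial>circle)"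
    by (rule circle2.Fubini') measurable
  also have "\<dots> = (\<integral>\<^sup>+s. (ennreal C * ennreal (g s)) * (\<integral>\<^sup>+u. ennreal (riesz_kernel u s) \<partial>circle) \<partial>circle)"
    unfolding mult.assoc[symmetric]
    by (intro nn_integral_cong nn_integral_cmult) measurable
  also have "\<dots> \<le> (\<integral>\<^sup>+s. (ennreal C * ennreal (g s)) * ennreal C \<partial>circle)"
    using C(2) by (intro nn_integral_mono mult_left_mono) auto
  also have "\<dots> = (\<integral>\<^sup>+s. ennreal (C\<^sup>2) * ennreal (g s) \<partial>circle)"
    using C(1) by (simp add: power2_eq_square ennreal_mult mult_ac)
  also have "\<dots> = ennreal (C\<^sup>2) * (\<integral>\<^sup>+s. ennreal (g s) \<partial>circle)"
    by (rule nn_integral_cmult) measurable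
  also have "\<dots> = ennreal (C\<^sup>2 * (LINT s|circle. g s))"
    using nn_integral_eq_integral[OF g(1)] g(2) by (simp add: ennreal_mult')
  finally show ?thesis .
qed

section \<open>The Moebius energy of curves of unit speed\<close>

definition moebius_integrand :: "'a::euclidean_space H2 \<Rightarrow> real \<Rightarrow> real \<Rightarrow> real" where
  "moebius_integrand x u v = 1 / (norm (fun_of x u - fun_of x v))\<^sup>2 - 1 / (circle_dist u v)\<^sup>2"

text \<open>
  Only the lower bound is recorded, as the upper bound with constant 1 holds for every curve of
  unit speed.
\<close>

definition bilipschitz :: "real \<Rightarrow> 'a::euclidean_space H2 \<Rightarrow> bool" where
  "bilipschitz c x \<longleftrightarrow> (\<forall>u\<in>{0..<1}. \<forall>v\<in>{0..<1}. c * circle_dist u v \<le> norm (fun_of x u - fun_of x v))"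

lemma fun_of_measurable [measurable]: "fun_of x \<in> borel_measurable borel"
  using fun_of[of x] by (intro borel_measurable_continuous_onI) auto

lemma moebius_integrand_measurable [measurable]:
  assumes [measurable]: "f \<in> borel_measurable M" "g \<in> borel_measurable M"
  shows "(\<lambda>w. moebius_integrand x (f w) (g w)) \<in> borel_measurable M"
  unfolding moebius_integrand_def by measurable

lemma arclength_curves_unit_speed:
  assumes "x \<in> arclength_curves z"
  shows "unit_speed x"
  unfolding unit_speed_def
proof
  fix u :: real assume u: "u \<in> {0..1}"
  have "AE u in circle. norm (d1 x u) = 1" using assms by (simp add: arclength_curves_def)
  then have ae: "AE u in circle. norm (velocity x u) = 1"
    using velocity_AE[of x] by eventually_elim simp
  show "norm (velocity x u) = 1"
    by (rule continuous_AE_eq[OF _ _ ae u]) (intro continuous_intros velocity_continuous)+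
qed

lemma unit_speed_AE:
  assumes "unit_speed x"
  shows "AE u in circle. norm (d1 x u) = 1"
  using velocity_AE[of x] AE_space
  by eventually_elim (use assms in \<open>auto simp: unit_speed_def\<close>)

lemma intrinsic_dist_unit_speed:
  assumes x: "unit_speed x" and uv: "u \<in> {0..<1}" "v \<in> {0..<1}"
  shows "intrinsic_dist x u v = circle_dist u v"
proof -
  have ae: "(LINT w:A|circle. norm (d1 x w)) = measure circle A" if "A \<in> sets circle" for A
  proof -
    have "(LINT w:A|circle. norm (d1 x w)) = (LINT w:A|circle. 1)"
      unfolding set_lebesgue_integral_def
    proof (rule integral_cong_AE)
      show "AE w in circle. indicat_real A w *\<^sub>R norm (d1 x w) = indicat_real A w *\<^sub>R 1"
        using unit_speed_AE[OF x] by eventually_elim simp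
    qed (use that in auto)
    then show ?thesis using set_integral_const_circle[OF that, of "1::real"] by simp
  qed
  let ?J = "{min u v..max u v}"
  have "?J = {0..<1} \<inter> ?J" using uv by auto
  then have J: "?J \<in> sets circle" using borel_in_sets_circle[of ?J] by simp
  have "emeasure circle ?J = emeasure lborel ?J"
    unfolding circle_def using uv by (intro emeasure_restrict_space) auto
  then have m: "measure circle ?J = \<bar>u - v\<bar>" by (simp add: measure_def min_def max_def)
  have "(LINT w|circle. norm (d1 x w)) = 1"
    using ae[of "{0..<1}"] interval_in_sets_circle[of 0 1]
    by (simp add: set_integral_circle_full measure_circle_space)
  then show ?thesis by (simp add: intrinsic_dist_def ae[OF J] m circle_dist_def Let_def)
qed

lemma moebius_energy_unit_speed:
  assumes x: "unit_speed x"
  shows "moebius_energy x = (LINT u|circle. LINT v|circle. moebius_integrand x u v)"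
proof -
  have inner: "(LINT v|circle. (1 / (norm (fun_of x u - fun_of x v))\<^sup>2 - 1 / (intrinsic_dist x u v)\<^sup>2)
      * norm (d1 x u) * norm (d1 x v)) = norm (d1 x u) * (LINT v|circle. moebius_integrand x u v)"
    if u: "u \<in> {0..<1}" for u
  proof -
    have "(LINT v|circle. (1 / (norm (fun_of x u - fun_of x v))\<^sup>2 - 1 / (intrinsic_dist x u v)\<^sup>2)
        * norm (d1 x u) * norm (d1 x v))
        = (LINT v|circle. norm (d1 x u) * moebius_integrand x u v * norm (d1 x v))"
      by (intro Bochner_Integration.integral_cong)
         (auto simp: intrinsic_dist_unit_speed[OF x u] moebius_integrand_def)
    also have "\<dots> = (LINT v|circle. norm (d1 x u) * moebius_integrand x u v)"
    proof (rule integral_cong_AE)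
      show "AE v in circle. norm (d1 x u) * moebius_integrand x u v * norm (d1 x v)
          = norm (d1 x u) * moebius_integrand x u v"
        using unit_speed_AE[OF x] by eventually_elim simp
    qed measurable
    finally show ?thesis by simp
  qed
  have "moebius_energy x = (LINT u|circle. norm (d1 x u) * (LINT v|circle. moebius_integrand x u v))"
    unfolding moebius_energy_def by (intro Bochner_Integration.integral_cong) (auto simp: inner)
  also have "\<dots> = (LINT u|circle. LINT v|circle. moebius_integrand x u v)"
  proof (rule integral_cong_AE)
    show "AE u in circle. norm (d1 x u) * (LINT v|circle. moebius_integrand x u v)
        = (LINT v|circle. moebius_integrand x u v)"
      using unit_speed_AE[OF x] by eventually_elim simp
  qed measurable
  finally show ?thesis .
qed

lemma moebius_integrand_nonneg:
  assumes "unit_speed x" "u \<in> {0..<1}" "v \<in> {0..<1}" "fun_of x u \<noteq> fun_of x v \<or> u = v"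
  shows "0 \<le> moebius_integrand x u v"
proof (cases "u = v")
  case False
  have "(norm (fun_of x u - fun_of x v))\<^sup>2 \<le> (circle_dist u v)\<^sup>2"
    using unit_speed_chord_deficit(1)[OF assms(1,2,3)] by (simp add: norm_minus_commute)
  then show ?thesis unfolding moebius_integrand_def
    using False assms(4) by (simp add: frac_le)
qed (simp add: moebius_integrand_def circle_dist_def)

lemma bilipschitz_inj:
  assumes "bilipschitz c x" "c > 0"
  shows "inj_on (fun_of x) {0..<1}"
proof (rule inj_onI)
  fix u v :: real assume uv: "u \<in> {0..<1}" "v \<in> {0..<1}" "fun_of x u = fun_of x v"
  then have "c * circle_dist u v \<le> 0" using assms(1) unfolding bilipschitz_def by (metis norm_zero right_minus_eq)
  then have "circle_dist u v = 0" using assms(2) circle_dist_bounds(1)[OF uv(1,2)] by (simp add: mult_le_0_iff)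
  then show "u = v" using circle_dist_bounds(3)[OF uv(1,2)] by simp
qed

text \<open>
  The integrand is the chord deficit divided by the squares of chord and arc length, hence at
  most a constant times \<open>1 / d\<close> times an integral over the arc.
\<close>

lemma moebius_integrand_le_potential:
  assumes x: "unit_speed x" and c: "bilipschitz c x" "c > 0" and uv: "u \<in> {0..<1}" "v \<in> {0..<1}"
  shows "ennreal \<bar>moebius_integrand x u v\<bar> \<le> ennreal (1 / c\<^sup>2) * riesz_potential (\<lambda>s. (norm (d2 x s))\<^sup>2) u v"
proof (cases "u = v")
  case False
  define d where "d = circle_dist u v"
  define N where "N = norm (fun_of x u - fun_of x v)"
  define J where "J = (LINT s:short_arc u v|circle. (norm (d2 x s))\<^sup>2)"
  have d: "0 < d" "d \<le> 1 / 2"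
    using circle_dist_bounds[OF uv] False unfolding d_def by linarith+
  have N: "c * d \<le> N" using c uv by (simp add: bilipschitz_def d_def N_def)
  have N0: "0 < N" using c(2) d N by (smt (verit) mult_pos_pos)
  have J: "J \<ge> 0" unfolding J_def set_lebesgue_integral_def
    by (intro Bochner_Integration.integral_nonneg) auto
  have def1: "N\<^sup>2 \<le> d\<^sup>2" and def2: "d\<^sup>2 - N\<^sup>2 \<le> d ^ 3 * J"
    using unit_speed_chord_deficit[OF x uv] by (simp_all add: N_def d_def J_def norm_minus_commute)
  have "\<bar>moebius_integrand x u v\<bar> = (d\<^sup>2 - N\<^sup>2) / (N\<^sup>2 * d\<^sup>2)"
    using d N0 def1 unfolding moebius_integrand_def N_def[symmetric] d_def[symmetric]
    by (subst abs_of_nonneg) (simp_all add: frac_le field_simps)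
  also have "\<dots> \<le> (d ^ 3 * J) / ((c * d)\<^sup>2 * d\<^sup>2)"
    using d N c(2) def1 def2 J by (intro frac_le mult_right_mono power_mono) auto
  also have "\<dots> = 1 / c\<^sup>2 * (J / d)"
    using d c(2) by (simp add: power2_eq_square power3_eq_cube field_simps)
  also have "\<dots> \<le> 1 / c\<^sup>2 * (d powr (- 3 / 2) * J)"
  proof -
    have "1 / d = d powr (- 1)" using d by (simp add: powr_minus_divide)
    also have "\<dots> \<le> d powr (- 3 / 2)" using d by (intro powr_mono') auto
    finally have "1 / d * J \<le> d powr (- 3 / 2) * J" using J by (rule mult_right_mono)
    then show ?thesis by (intro mult_left_mono) auto
  qed
  finally have "ennreal \<bar>moebius_integrand x u v\<bar> \<le> ennreal (1 / c\<^sup>2 * (d powr (- 3 / 2) * J))"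
    by (rule ennreal_leI)
  also have "\<dots> = ennreal (1 / c\<^sup>2) * ennreal (d powr (- 3 / 2) * J)"
    using J by (intro ennreal_mult) auto
  also have "\<dots> \<le> ennreal (1 / c\<^sup>2) * riesz_potential (\<lambda>s. (norm (d2 x s))\<^sup>2) u v"
    unfolding d_def J_def
    by (intro mult_left_mono arc_integral_le_potential uv sq_integrable_norm_sq H2_derivs) auto
  finally show ?thesis .
qed (simp add: moebius_integrand_def circle_dist_def)

lemma moebius_integrand_integrable:
  assumes x: "unit_speed x" and c: "bilipschitz c x" "c > 0"
  shows "integrable (circle \<Otimes>\<^sub>M circle) (\<lambda>(u, v). moebius_integrand x u v)"
proof (rule integrableI_bounded)
  show "(\<lambda>(u, v). moebius_integrand x u v) \<in> borel_measurable (circle \<Otimes>\<^sub>M circle)"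
    by measurable
  obtain C where C: "C \<ge> 0"
    "\<And>s. s \<in> {0..<1} \<Longrightarrow> (\<integral>\<^sup>+u. ennreal (riesz_kernel u s) \<partial>circle) \<le> ennreal C"
    using riesz_kernel_mass_bounded by blast
  let ?g = "\<lambda>s. (norm (d2 x s))\<^sup>2"
  have g: "integrable circle ?g" by (intro sq_integrable_norm_sq H2_derivs)
  have gm: "?g \<in> borel_measurable circle" using g by auto
  have "(\<integral>\<^sup>+w. ennreal (norm (case w of (u, v) \<Rightarrow> moebius_integrand x u v)) \<partial>(circle \<Otimes>\<^sub>M circle))
      \<le> (\<integral>\<^sup>+w. ennreal (1 / c\<^sup>2) * (case w of (u, v) \<Rightarrow> riesz_potential ?g u v) \<partial>(circle \<Otimes>\<^sub>M circle))"
    using moebius_integrand_le_potential[OF x c]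
    by (intro nn_integral_mono) (auto simp: space_pair_measure)
  also have "\<dots> = ennreal (1 / c\<^sup>2) * (\<integral>\<^sup>+(u, v). riesz_potential ?g u v \<partial>(circle \<Otimes>\<^sub>M circle))"
    by (rule nn_integral_cmult) (rule riesz_potential_measurable[OF gm])
  also have "\<dots> \<le> ennreal (1 / c\<^sup>2) * ennreal (C\<^sup>2 * (LINT s|circle. ?g s))"
    by (intro mult_left_mono riesz_potential_integral_le g C) auto
  also have "\<dots> < \<infinity>" by (simp add: ennreal_mult_less_top)
  finally show "(\<integral>\<^sup>+w. ennreal (norm (case w of (u, v) \<Rightarrow> moebius_integrand x u v)) \<partial>(circle \<Otimes>\<^sub>M circle)) < \<infinity>" .
qed

text \<open>
  Integrability over pairs makes the iterated integral equal to the integral over the product.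
  It also excludes the value 0 that a nonintegrable function would receive, so that bounds on
  the energy carry information.
\<close>

lemma moebius_energy_pair:
  assumes x: "unit_speed x" and c: "bilipschitz c x" "c > 0"
  shows "moebius_energy x = integral\<^sup>L (circle \<Otimes>\<^sub>M circle) (\<lambda>(u, v). moebius_integrand x u v)"
  using circle2.integral_fst[OF moebius_integrand_integrable[OF assms]] moebius_energy_unit_speed[OF x]
  by simp

text \<open>
  For pairs at distance at most \<open>\<delta>\<close> the quadratic gain in the chord difference is used, and the
  power of the distance to spare becomes the factor \<open>sqrt \<delta>\<close>. For distant pairs there is no
  singularity and the uniform distance of the velocities suffices.
\<close>

lemma moebius_integrand_difference_le:
  assumes x: "unit_speed x" "bilipschitz c x" and y: "unit_speed y" "bilipschitz c y" and c: "c > 0"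
    and l: "l > 0" and \<delta>: "\<delta> > 0" and uv: "u \<in> {0..<1}" "v \<in> {0..<1}"
    and B: "\<And>s. s \<in> {0..1} \<Longrightarrow> norm (velocity y s - velocity x s) \<le> B"
  shows "ennreal \<bar>moebius_integrand y u v - moebius_integrand x u v\<bar>
     \<le> ennreal (sqrt \<delta> / (2 * c ^ 4)) * riesz_potential (\<lambda>s. l * (norm (d2 y s - d2 x s))\<^sup>2
          + (norm (d2 y s + d2 x s))\<^sup>2 / l) u v + ennreal (2 * B / (c ^ 4 * \<delta>\<^sup>2))"
proof (cases "u = v")
  case False
  define d where "d = circle_dist u v"
  define N where "N w = norm (fun_of w u - fun_of w v)" for w :: "'a H2"
  define g where "g s = l * (norm (d2 y s - d2 x s))\<^sup>2 + (norm (d2 y s + d2 x s))\<^sup>2 / l" for s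
  define J where "J = (LINT s:short_arc u v|circle. g s)"
  have d: "0 < d" "d \<le> 1 / 2"
    using circle_dist_bounds[OF uv] False unfolding d_def by linarith+
  have N: "c * d \<le> N x" "c * d \<le> N y" using x y uv by (simp_all add: bilipschitz_def d_def N_def)
  have cd: "0 < c * d" using c d by simp
  then have N0: "0 < N x" "0 < N y" using N by linarith+
  have g0: "g s \<ge> 0" for s unfolding g_def using l by simp
  have B0: "B \<ge> 0" using order_trans[OF norm_ge_zero B[of 0]] by simp
  have J: "J \<ge> 0" unfolding J_def set_lebesgue_integral_def
    using g0 by (intro Bochner_Integration.integral_nonneg) auto
  have D: "\<bar>(N y)\<^sup>2 - (N x)\<^sup>2\<bar> \<le> d ^ 3 / 2 * J" "\<bar>(N y)\<^sup>2 - (N x)\<^sup>2\<bar> \<le> 2 * d\<^sup>2 * B"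
    using unit_speed_chord_difference[OF x(1) y(1) uv l B]
    by (simp_all add: N_def d_def J_def g_def norm_minus_commute)
  have "moebius_integrand y u v - moebius_integrand x u v = ((N x)\<^sup>2 - (N y)\<^sup>2) / ((N y)\<^sup>2 * (N x)\<^sup>2)"
    using N0 by (simp add: moebius_integrand_def N_def[symmetric] field_simps)
  then have "\<bar>moebius_integrand y u v - moebius_integrand x u v\<bar>
      = \<bar>(N y)\<^sup>2 - (N x)\<^sup>2\<bar> / ((N y)\<^sup>2 * (N x)\<^sup>2)"
    by (simp add: abs_minus_commute)
  also have "\<dots> \<le> \<bar>(N y)\<^sup>2 - (N x)\<^sup>2\<bar> / ((c * d)\<^sup>2 * (c * d)\<^sup>2)"
    using cd N by (intro divide_left_mono mult_mono power_mono mult_pos_pos zero_less_power) (auto simp: N0 c d less_imp_le[OF cd])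
  also have "\<dots> = \<bar>(N y)\<^sup>2 - (N x)\<^sup>2\<bar> / (c * d) ^ 4"
    by (simp flip: power_add)
  finally have est: "\<bar>moebius_integrand y u v - moebius_integrand x u v\<bar>
      \<le> \<bar>(N y)\<^sup>2 - (N x)\<^sup>2\<bar> / (c * d) ^ 4" .
  have "\<bar>(N y)\<^sup>2 - (N x)\<^sup>2\<bar> / (c * d) ^ 4
      \<le> sqrt \<delta> / (2 * c ^ 4) * (d powr (- 3 / 2) * J) + 2 * B / (c ^ 4 * \<delta>\<^sup>2)"
  proof (cases "d \<le> \<delta>")
    case True
    have "\<bar>(N y)\<^sup>2 - (N x)\<^sup>2\<bar> / (c * d) ^ 4 \<le> (d ^ 3 / 2 * J) / (c * d) ^ 4"
      using D(1) cd by (intro divide_right_mono) auto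
    also have "\<dots> = 1 / (2 * c ^ 4) * (1 / d * J)"
      using d c by (simp add: power_mult_distrib field_simps power4_eq_xxxx power3_eq_cube)
    also have "1 / d = d powr (1 / 2) * d powr (- 3 / 2)"
    proof -
      have "1 / d = d powr (1 / 2 + - 3 / 2)" using d by (simp add: powr_minus_divide)
      then show ?thesis by (simp only: powr_add)
    qed
    also have "d powr (1 / 2) = sqrt d" using d by (simp add: powr_half_sqrt)
    also have "1 / (2 * c ^ 4) * (sqrt d * d powr (- 3 / 2) * J)
        \<le> 1 / (2 * c ^ 4) * (sqrt \<delta> * d powr (- 3 / 2) * J)"
      using True J c by (intro mult_left_mono mult_right_mono) auto
    also have "\<dots> = sqrt \<delta> / (2 * c ^ 4) * (d powr (- 3 / 2) * J)" by simp
    also have "\<dots> \<le> \<dots> + 2 * B / (c ^ 4 * \<delta>\<^sup>2)" using B0 c by simp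
    finally show ?thesis .
  next
    case False
    have "\<bar>(N y)\<^sup>2 - (N x)\<^sup>2\<bar> / (c * d) ^ 4 \<le> (2 * d\<^sup>2 * B) / (c * d) ^ 4"
      using D(2) cd by (intro divide_right_mono) auto
    also have "\<dots> = 2 * B / (c ^ 4 * d\<^sup>2)"
      using d c by (simp add: power_mult_distrib field_simps power4_eq_xxxx power2_eq_square)
    also have "\<dots> \<le> 2 * B / (c ^ 4 * \<delta>\<^sup>2)"
      using False \<delta> c B0 d by (intro divide_left_mono mult_left_mono power_mono mult_pos_pos zero_less_power) auto
    also have "\<dots> \<le> sqrt \<delta> / (2 * c ^ 4) * (d powr (- 3 / 2) * J) + 2 * B / (c ^ 4 * \<delta>\<^sup>2)"
      using J c \<delta> by simp
    finally show ?thesis .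
  qed
  with est have "ennreal \<bar>moebius_integrand y u v - moebius_integrand x u v\<bar>
      \<le> ennreal (sqrt \<delta> / (2 * c ^ 4) * (d powr (- 3 / 2) * J) + 2 * B / (c ^ 4 * \<delta>\<^sup>2))"
    by (intro ennreal_leI) linarith
  also have "\<dots> = ennreal (sqrt \<delta> / (2 * c ^ 4)) * ennreal (d powr (- 3 / 2) * J) + ennreal (2 * B / (c ^ 4 * \<delta>\<^sup>2))"
    using J B0 c \<delta> by (subst ennreal_plus) (auto simp flip: ennreal_mult)
  also have "\<dots> \<le> ennreal (sqrt \<delta> / (2 * c ^ 4)) * riesz_potential g u v + ennreal (2 * B / (c ^ 4 * \<delta>\<^sup>2))"
  proof -
    have "integrable circle g"
      unfolding g_def
      using sq_integrable_norm_sq[OF is_primitiveD(1)[OF is_primitive_diff[OF velocity_primitive[of y] velocity_primitive[of x]]]]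
        sq_integrable_norm_sq[OF is_primitiveD(1)[OF is_primitive_add[OF velocity_primitive[of y] velocity_primitive[of x]]]]
      by simp
    then show ?thesis unfolding d_def J_def
      by (intro add_right_mono mult_left_mono arc_integral_le_potential uv g0) auto
  qed
  finally show ?thesis unfolding g_def .
qed (simp add: moebius_integrand_def circle_dist_def)

text \<open>
  This is the form of continuity of the Moebius energy that the proof rests on. If \<open>y\<close> differs
  from \<open>x\<close> by a small multiple \<open>t\<close> of a field \<open>h\<close>, then with \<open>l = 1 / t\<close> the bound is \<open>t\<close> times
  a quantity that is small when \<open>\<delta>\<close> is small and then \<open>h'\<close> is uniformly small, while \<open>h\<close> is
  merely bounded in the Sobolev norm.
\<close>

lemma moebius_energy_difference_le:
  assumes C: "C \<ge> 0" "\<And>s. s \<in> {0..<1} \<Longrightarrow> (\<integral>\<^sup>+u. ennreal (riesz_kernel u s) \<partial>circle) \<le> ennreal C"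
    and x: "unit_speed x" "bilipschitz c x" and y: "unit_speed y" "bilipschitz c y" and c: "c > 0"
    and l: "l > 0" and \<delta>: "\<delta> > 0"
    and B: "\<And>s. s \<in> {0..1} \<Longrightarrow> norm (velocity y s - velocity x s) \<le> B"
  shows "\<bar>moebius_energy y - moebius_energy x\<bar>
     \<le> sqrt \<delta> / (2 * c ^ 4) * (C\<^sup>2 * (l * L2_sq (\<lambda>s. d2 y s - d2 x s) + L2_sq (\<lambda>s. d2 y s + d2 x s) / l))
        + 2 * B / (c ^ 4 * \<delta>\<^sup>2)"
proof -
  let ?P = "circle \<Otimes>\<^sub>M circle"
  let ?f = "\<lambda>w. (\<lambda>(u, v). moebius_integrand y u v) w - (\<lambda>(u, v). moebius_integrand x u v) w"
  define g where "g s = l * (norm (d2 y s - d2 x s))\<^sup>2 + (norm (d2 y s + d2 x s))\<^sup>2 / l" for s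
  have g0: "g s \<ge> 0" for s unfolding g_def using l by simp
  have B0: "B \<ge> 0" using order_trans[OF norm_ge_zero B[of 0]] by simp
  note i1 = sq_integrable_norm_sq[OF is_primitiveD(1)[OF is_primitive_diff[OF velocity_primitive[of y] velocity_primitive[of x]]]]
  note i2 = sq_integrable_norm_sq[OF is_primitiveD(1)[OF is_primitive_add[OF velocity_primitive[of y] velocity_primitive[of x]]]]
  have g: "integrable circle g" unfolding g_def using i1 i2 by simp
  have gm: "g \<in> borel_measurable circle" using g by auto
  have Ig: "(LINT s|circle. g s) = l * L2_sq (\<lambda>s. d2 y s - d2 x s) + L2_sq (\<lambda>s. d2 y s + d2 x s) / l"
    unfolding g_def L2_sq_def using i1 i2 by simp
  note iy = moebius_integrand_integrable[OF y c] and ix = moebius_integrand_integrable[OF x c]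
  have if': "integrable ?P ?f" by (rule Bochner_Integration.integrable_diff[OF iy ix])
  let ?R = "sqrt \<delta> / (2 * c ^ 4) * (C\<^sup>2 * (LINT s|circle. g s)) + 2 * B / (c ^ 4 * \<delta>\<^sup>2)"
  have I0: "(LINT s|circle. g s) \<ge> 0" using g0 by (intro Bochner_Integration.integral_nonneg) auto
  have em: "emeasure ?P (space ?P) = 1"
    using circle.emeasure_pair_measure_Times[of "space circle" circle "space circle"] sets.top[of circle]
    by (simp add: space_pair_measure emeasure_circle del: sets.top)
  have "ennreal (LINT w|?P. norm (?f w)) = (\<integral>\<^sup>+w. ennreal (norm (?f w)) \<partial>?P)"
    by (rule nn_integral_eq_integral[symmetric]) (use if' in auto)
  also have "\<dots> \<le> (\<integral>\<^sup>+w. ennreal (sqrt \<delta> / (2 * c ^ 4)) * (case w of (u, v) \<Rightarrow> riesz_potential g u v)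
      + ennreal (2 * B / (c ^ 4 * \<delta>\<^sup>2)) \<partial>?P)"
    using moebius_integrand_difference_le[OF x y c l \<delta> _ _ B] unfolding g_def
    by (intro nn_integral_mono) (auto simp: space_pair_measure)
  also have "\<dots> = ennreal (sqrt \<delta> / (2 * c ^ 4)) * (\<integral>\<^sup>+(u, v). riesz_potential g u v \<partial>?P)
      + ennreal (2 * B / (c ^ 4 * \<delta>\<^sup>2))"
    using riesz_potential_measurable[OF gm]
    by (subst nn_integral_add) (auto simp: nn_integral_cmult em)
  also have "\<dots> \<le> ennreal (sqrt \<delta> / (2 * c ^ 4)) * ennreal (C\<^sup>2 * (LINT s|circle. g s))
      + ennreal (2 * B / (c ^ 4 * \<delta>\<^sup>2))"
    by (intro add_right_mono mult_left_mono riesz_potential_integral_le g C g0) auto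
  also have "\<dots> = ennreal ?R"
    using I0 B0 c \<delta> by (subst ennreal_plus) (auto simp flip: ennreal_mult)
  finally have "(LINT w|?P. norm (?f w)) \<le> ?R"
    using I0 B0 c \<delta> by (subst (asm) ennreal_le_iff) auto
  moreover have "\<bar>moebius_energy y - moebius_energy x\<bar> \<le> (LINT w|?P. norm (?f w))"
    unfolding moebius_energy_pair[OF x c] moebius_energy_pair[OF y c]
      Bochner_Integration.integral_diff[OF iy ix, symmetric] real_norm_def[symmetric]
    by (rule integral_norm_bound)
  ultimately show ?thesis by (simp add: Ig)
qed

section \<open>Bilipschitz bounds from the energies\<close>

lemma d2_sq_integrable_norm: "integrable circle (\<lambda>s. (norm (d2 x s))\<^sup>2)"
  by (intro sq_integrable_norm_sq H2_derivs)

text \<open>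
  At short distance the chord deficit is at most 3/4 of the squared distance.
\<close>

lemma unit_speed_local_bilipschitz:
  assumes x: "unit_speed x" and K: "L2_sq (d2 x) \<le> K" and uv: "u \<in> {0..<1}" "v \<in> {0..<1}"
    and near: "circle_dist u v * K \<le> 3 / 4"
  shows "circle_dist u v / 2 \<le> norm (fun_of x u - fun_of x v)"
proof -
  let ?d = "circle_dist u v"
  have d0: "0 \<le> ?d" using circle_dist_bounds(1)[OF uv] .
  have "(LINT s:short_arc u v|circle. (norm (d2 x s))\<^sup>2) \<le> L2_sq (d2 x)"
    unfolding L2_sq_def by (rule set_integral_le_full[OF d2_sq_integrable_norm _ arc_sets[OF uv]]) simp
  then have "?d ^ 3 * (LINT s:short_arc u v|circle. (norm (d2 x s))\<^sup>2) \<le> ?d ^ 3 * K"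
    using K d0 by (intro mult_left_mono) auto
  also have "\<dots> = ?d\<^sup>2 * (?d * K)" by (simp add: power2_eq_square power3_eq_cube)
  also have "\<dots> \<le> ?d\<^sup>2 * (3 / 4)" using near by (intro mult_left_mono) auto
  finally have "?d\<^sup>2 - (norm (fun_of x v - fun_of x u))\<^sup>2 \<le> ?d\<^sup>2 * (3 / 4)"
    using unit_speed_chord_deficit(2)[OF x uv] by linarith
  then have "(?d / 2)\<^sup>2 \<le> (norm (fun_of x u - fun_of x v))\<^sup>2"
    by (simp add: norm_minus_commute power_divide)
  then show ?thesis by (rule power2_le_imp_le) simp
qed

lemma bilipschitz_from_separation:
  assumes x: "unit_speed x" and K: "L2_sq (d2 x) \<le> K" and r: "r * K \<le> 3 / 4" and K0: "K \<ge> 0"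
    and far: "\<And>u v. u \<in> {0..<1} \<Longrightarrow> v \<in> {0..<1} \<Longrightarrow> r < circle_dist u v \<Longrightarrow> m \<le> norm (fun_of x u - fun_of x v)"
    and m: "m > 0"
  shows "bilipschitz (min (1 / 2) (2 * m)) x"
  unfolding bilipschitz_def
proof (intro ballI)
  fix u v :: real assume uv: "u \<in> {0..<1}" "v \<in> {0..<1}"
  note d = circle_dist_bounds(1,2)[OF uv]
  show "min (1 / 2) (2 * m) * circle_dist u v \<le> norm (fun_of x u - fun_of x v)"
  proof (cases "circle_dist u v \<le> r")
    case True
    then have "circle_dist u v * K \<le> 3 / 4" using r mult_right_mono[OF True K0] by linarith
    then have "circle_dist u v / 2 \<le> norm (fun_of x u - fun_of x v)"
      by (rule unit_speed_local_bilipschitz[OF x K uv])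
    moreover have "min (1 / 2) (2 * m) * circle_dist u v \<le> 1 / 2 * circle_dist u v"
      using d by (intro mult_right_mono) auto
    ultimately show ?thesis by simp
  next
    case False
    then have "m \<le> norm (fun_of x u - fun_of x v)" using far[OF uv] by simp
    moreover have "min (1 / 2) (2 * m) * circle_dist u v \<le> (2 * m) * (1 / 2)"
      using d m by (intro mult_mono) auto
    ultimately show ?thesis by simp
  qed
qed

text \<open>
  Away from the diagonal the chord length has a positive minimum by compactness. The constant
  depends on the curve. It makes the Moebius integrand integrable, which the uniform bound below
  presupposes.
\<close>

lemma injective_bilipschitz:
  assumes x: "unit_speed x" and inj: "inj_on (fun_of x) {0..<1}"
  obtains c where "c > 0" "bilipschitz c x"
proof -
  define K where "K = L2_sq (d2 x)"
  have K: "K \<ge> 0" unfolding K_def by (rule L2_sq_nonneg)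
  \<comment> \<open>below this distance the local estimate applies, since \<open>r * K \<le> 3 / 4\<close>\<close>
  define r where "r = 3 / (4 * (K + 1))"
  have r: "r > 0" "r * K \<le> 3 / 4" using K by (simp_all add: r_def field_simps)
  define S where "S = {w :: real \<times> real. w \<in> {0..1} \<times> {0..1} \<and> r \<le> \<bar>fst w - snd w\<bar> \<and> \<bar>fst w - snd w\<bar> \<le> 1 - r}"
  have "S = ({0..1} \<times> {0..1}) \<inter> ({w. r \<le> \<bar>fst w - snd w\<bar>} \<inter> {w. \<bar>fst w - snd w\<bar> \<le> 1 - r})"
    unfolding S_def by auto
  moreover have "closed {w :: real \<times> real. r \<le> \<bar>fst w - snd w\<bar>}" "closed {w :: real \<times> real. \<bar>fst w - snd w\<bar> \<le> 1 - r}"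
    by (intro closed_Collect_le continuous_intros)+
  ultimately have S: "compact S" by (auto intro!: compact_Int_closed compact_Times)
  have cf: "continuous_on UNIV (fun_of x)" using fun_of[of x] by auto
  have cont: "continuous_on S (\<lambda>w. norm (fun_of x (fst w) - fun_of x (snd w)))"
    by (intro continuous_intros continuous_on_compose2[OF cf]) auto
  have pos: "norm (fun_of x (fst w) - fun_of x (snd w)) > 0" if "w \<in> S" for w
  proof -
    define u v where uv: "u = (if fst w = 1 then 0 else fst w)" "v = (if snd w = 1 then 0 else snd w)"
    have "fun_of x u = fun_of x (fst w)" "fun_of x v = fun_of x (snd w)"
      using fun_of_ends[of x] by (simp_all add: uv)
    moreover have "u \<in> {0..<1}" "v \<in> {0..<1}" "u \<noteq> v"
      using that r by (auto simp: uv S_def)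
    ultimately show ?thesis using inj by (auto simp: inj_on_def)
  qed
  obtain m where m: "m > 0" "\<And>w. w \<in> S \<Longrightarrow> m \<le> norm (fun_of x (fst w) - fun_of x (snd w))"
  proof (cases "S = {}")
    case True
    then show thesis using that[of 1] by simp
  next
    case False
    then obtain w0 where "w0 \<in> S"
      "\<And>w. w \<in> S \<Longrightarrow> norm (fun_of x (fst w0) - fun_of x (snd w0)) \<le> norm (fun_of x (fst w) - fun_of x (snd w))"
      using continuous_attains_inf[OF S False cont] by blast
    then show thesis using that pos by blast
  qed
  have "bilipschitz (min (1 / 2) (2 * m)) x"
  proof (rule bilipschitz_from_separation[OF x _ r(2) K _ m(1)])
    fix u v :: real assume "u \<in> {0..<1}" "v \<in> {0..<1}" "r < circle_dist u v"
    then have "(u, v) \<in> S" by (auto simp: S_def circle_dist_def)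
    then show "m \<le> norm (fun_of x u - fun_of x v)" using m(2) by fastforce
  qed (simp add: K_def)
  then show thesis using that m(1) by (metis min_less_iff_conj zero_less_divide_1_iff zero_less_mult_iff zero_less_numeral)
qed

text \<open>
  An interval adjacent to \<open>s\<close> on the side that has room for it inside the fundamental domain.
\<close>

definition side_interval :: "real \<Rightarrow> real \<Rightarrow> real set" where
  "side_interval s t = (if s < 1 / 2 then {s..<s + t} else {s - t..<s})"

lemma side_interval:
  assumes "s \<in> {0..1}" "0 \<le> t" "t \<le> 1 / 2"
  shows side_interval_subset: "side_interval s t \<subseteq> {0..<1}"
    and side_interval_sets: "side_interval s t \<in> sets circle"
    and measure_side_interval: "measure circle (side_interval s t) = t"
    and side_interval_near: "\<And>w. w \<in> side_interval s t \<Longrightarrow> \<bar>w - s\<bar> \<le> t"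
  using assms interval_in_sets_circle[of s "s + t"] interval_in_sets_circle[of "s - t" s]
    measure_circle_interval[of s "s + t"] measure_circle_interval[of "s - t" s]
  by (auto simp: side_interval_def split: if_splits)

text \<open>
  The logarithmic divergence as \<open>e \<rightarrow> 0\<close> is what the Moebius energy penalizes near a
  self-contact.
\<close>

lemma nn_integral_side_interval_log:
  assumes s: "s \<in> {0..1}" "0 \<le> t" "t \<le> 1 / 2" and e: "e > 0"
  shows "(\<integral>\<^sup>+w. ennreal (1 / (e + \<bar>w - s\<bar>)) * indicator (side_interval s t) w \<partial>circle)
    = ennreal (ln ((e + t) / e))"
proof -
  let ?f = "\<lambda>w. 1 / (e + \<bar>w - s\<bar>)"
  have "(\<integral>\<^sup>+w. ennreal (?f w) * indicator (side_interval s t) w \<partial>circle)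
      = (\<integral>\<^sup>+w. ennreal (?f w) * indicator (side_interval s t) w * indicator {0..<1} w \<partial>lborel)"
    unfolding circle_def by (rule nn_integral_restrict_space) simp
  also have "\<dots> = (\<integral>\<^sup>+w. ennreal (?f w) * indicator (side_interval s t) w \<partial>lborel)"
    using side_interval_subset[OF s] by (intro nn_integral_cong) (auto simp: indicator_def)
  also have "\<dots> = ennreal (ln (e + t) - ln e)"
  proof (cases "s < 1 / 2")
    case True
    have "(\<integral>\<^sup>+w. ennreal (?f w) * indicator (side_interval s t) w \<partial>lborel)
        = (\<integral>\<^sup>+w. ennreal (1 / (e + (w - s))) * indicator {s..s + t} w \<partial>lborel)"
    proof (rule nn_integral_cong_AE)
      show "AE w in lborel. ennreal (?f w) * indicator (side_interval s t) w
          = ennreal (1 / (e + (w - s))) * indicator {s..s + t} w"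
        using AE_lborel_singleton[of "s + t"]
        by eventually_elim (use True in \<open>auto simp: side_interval_def indicator_def\<close>)
    qed
    also have "\<dots> = ennreal (ln (e + (s + t - s)) - ln (e + (s - s)))"
    proof (rule nn_integral_FTC_Icc)
      show "((\<lambda>w. ln (e + (w - s))) has_real_derivative 1 / (e + (w - s))) (at w)"
        if "w \<in> {s..s + t}" for w
        using that e by (auto intro!: derivative_eq_intros)
      show "0 \<le> 1 / (e + (w - s))" if "w \<in> {s..s + t}" for w
        using that e by simp
    qed (use s in auto)
    finally show ?thesis by simp
  next
    case False
    have "(\<integral>\<^sup>+w. ennreal (?f w) * indicator (side_interval s t) w \<partial>lborel)
        = (\<integral>\<^sup>+w. ennreal (1 / (e + (s - w))) * indicator {s - t..s} w \<partial>lborel)"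
    proof (rule nn_integral_cong_AE)
      show "AE w in lborel. ennreal (?f w) * indicator (side_interval s t) w
          = ennreal (1 / (e + (s - w))) * indicator {s - t..s} w"
        using AE_lborel_singleton[of s]
        by eventually_elim (use False in \<open>auto simp: side_interval_def indicator_def\<close>)
    qed
    also have "\<dots> = ennreal (- ln (e + (s - s)) - - ln (e + (s - (s - t))))"
    proof (rule nn_integral_FTC_Icc)
      show "((\<lambda>w. - ln (e + (s - w))) has_real_derivative 1 / (e + (s - w))) (at w)"
        if "w \<in> {s - t..s}" for w
        using that e by (auto intro!: derivative_eq_intros)
      show "0 \<le> 1 / (e + (s - w))" if "w \<in> {s - t..s}" for w
        using that e by simp
    qed (use s in auto)
    finally show ?thesis by simp
  qed
  finally show ?thesis using e s by (simp add: ln_div)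
qed

lemma circle_dist_lipschitz:
  "\<bar>circle_dist u v - circle_dist u' v'\<bar> \<le> \<bar>u - u'\<bar> + \<bar>v - v'\<bar>"
  by (auto simp: circle_dist_def min_def abs_if split: if_splits)

lemma unit_speed_lipschitz:
  assumes "unit_speed x" "u \<in> {0..<1}" "v \<in> {0..<1}"
  shows "norm (fun_of x u - fun_of x v) \<le> \<bar>u - v\<bar>"
proof -
  have "norm (fun_of x v - fun_of x u) \<le> circle_dist u v"
    using unit_speed_chord_deficit(1)[OF assms] circle_dist_bounds(1)[OF assms(2,3)]
    by (rule power2_le_imp_le)
  then show ?thesis by (simp add: circle_dist_def norm_minus_commute)
qed

text \<open>
  If two points that are far apart along the curve come within distance \<open>e\<close>, then the chords
  between their neighbourhoods have length at most \<open>e\<close> plus the distances of the parameters, and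
  the inverse square of this integrates to a multiple of \<open>ln (1 / e)\<close> over a square of fixed
  size. The intrinsic term is bounded there, so a bound on the energy gives a lower bound for
  \<open>e\<close>.
\<close>

lemma uniform_bilipschitz:
  assumes K: "K \<ge> 0" and E: "E \<ge> 0"
  obtains c where "c > 0"
    "\<And>x :: 'a::euclidean_space H2. unit_speed x \<Longrightarrow> inj_on (fun_of x) {0..<1} \<Longrightarrow> L2_sq (d2 x) \<le> K \<Longrightarrow>
        moebius_energy x \<le> E \<Longrightarrow> bilipschitz c x"
proof -
  \<comment> \<open>pairs closer than \<open>r\<close> satisfy the local estimate; only the others can come into contact\<close>
  define r where "r = 3 / (4 * (K + 1))"
  have r: "r > 0" "r * K \<le> 3 / 4" using K by (simp_all add: r_def field_simps)
  have "3 / (4 * (K + 1)) \<le> 3 / (4 * (0 + 1))" using K by (intro divide_left_mono) auto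
  then have r1: "r \<le> 3 / 4" by (simp add: r_def)
  \<comment> \<open>neighbourhoods of this size keep a distance of at least \<open>r / 2\<close> along the curve\<close>
  define h where "h = r / 4"
  have h: "h > 0" "h \<le> 1 / 2" using r r1 by (auto simp: h_def)
  \<comment> \<open>the value at which \<open>ln (h / (2 * m)) / 4\<close> reaches the bound for the energy and the intrinsic term\<close>
  define m where "m = h / 2 * exp (- 4 * (E + 4 / r\<^sup>2))"
  have m: "m > 0" using h by (simp add: m_def)
  have "0 \<le> 4 * (E + 4 / r\<^sup>2)" using E by simp
  then have mh: "m \<le> h / 2" unfolding m_def using h by (intro mult_left_le) auto
  show thesis
  proof (rule that)
    show "min (1 / 2) (2 * m) > 0" using m by simp
    fix x :: "'a H2"
    assume x: "unit_speed x" and inj: "inj_on (fun_of x) {0..<1}" and xK: "L2_sq (d2 x) \<le> K"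
      and xE: "moebius_energy x \<le> E"
    let ?F = "moebius_integrand x"
    obtain c where c: "c > 0" "bilipschitz c x" using injective_bilipschitz[OF x inj] by blast
    have F0: "?F u v \<ge> 0" if "u \<in> {0..<1}" "v \<in> {0..<1}" for u v
      using moebius_integrand_nonneg[OF x that] inj that by (auto simp: inj_on_def)
    show "bilipschitz (min (1 / 2) (2 * m)) x"
    proof (rule bilipschitz_from_separation[OF x xK r(2) K _ m], rule ccontr)
      fix u0 v0 :: real
      assume uv0: "u0 \<in> {0..<1}" "v0 \<in> {0..<1}" and far: "r < circle_dist u0 v0"
        and close: "\<not> m \<le> norm (fun_of x u0 - fun_of x v0)"
      define e where "e = norm (fun_of x u0 - fun_of x v0)"
      have em: "e < m" using close by (simp add: e_def)
      have "u0 \<noteq> v0" using far r by (auto simp: circle_dist_def)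
      then have e: "e > 0" using inj uv0 by (auto simp: e_def inj_on_def)
      have e2: "e < h / 2" using em mh by simp
      let ?I = "side_interval u0 (h / 2)"
      have u0': "u0 \<in> {0..1}" "v0 \<in> {0..1}" using uv0 by auto
      have inner: "ennreal (1 / (4 * (e + \<bar>u - u0\<bar>))) \<le> (\<integral>\<^sup>+v. ennreal (?F u v + 4 / r\<^sup>2) \<partial>circle)"
        if u: "u \<in> ?I" for u
      proof -
        define a where "a = \<bar>u - u0\<bar>"
        have u01: "u \<in> {0..<1}" using side_interval_subset[OF u0'(1), of "h/2"] u h by auto
        have a: "0 \<le> a" "a \<le> h / 2"
          using side_interval_near[OF u0'(1), of "h/2" u] u h by (auto simp: a_def)
        \<comment> \<open>on this interval all chords are at most twice its length, so the inverse squares of the chords integrate to at least \<open>1 / (4 * (e + a))\<close>\<close>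
        let ?J = "side_interval v0 (e + a)"
        have t: "0 \<le> e + a" "e + a \<le> h" "e + a \<le> 1 / 2" using e e2 a h by auto
        have J: "?J \<in> sets circle" "measure circle ?J = e + a"
          using side_interval_sets[OF u0'(2)] measure_side_interval[OF u0'(2)] t by auto
        have pt: "1 / (2 * (e + a))\<^sup>2 \<le> ?F u v + 4 / r\<^sup>2" if v: "v \<in> ?J" for v
        proof -
          have v01: "v \<in> {0..<1}" using side_interval_subset[OF u0'(2) t(1,3)] v by auto
          have b: "\<bar>v - v0\<bar> \<le> e + a" by (rule side_interval_near[OF u0'(2) t(1,3) v])
          have "circle_dist u0 v0 - circle_dist u v \<le> \<bar>u0 - u\<bar> + \<bar>v0 - v\<bar>"
            using circle_dist_lipschitz[of u0 v0 u v] by linarith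
          then have "r / 2 \<le> circle_dist u v"
            using far a(2) b t(2) h_def unfolding a_def abs_minus_commute[of u0] abs_minus_commute[of v0]
            by linarith
          then have "1 / (circle_dist u v)\<^sup>2 \<le> 1 / (r / 2)\<^sup>2"
            using r by (intro divide_left_mono power_mono) (auto intro!: mult_pos_pos)
          then have d: "1 / (circle_dist u v)\<^sup>2 \<le> 4 / r\<^sup>2" by (simp add: power_divide)
          have "u \<noteq> v" using \<open>r / 2 \<le> circle_dist u v\<close> r by (auto simp: circle_dist_def)
          then have N0: "norm (fun_of x u - fun_of x v) > 0" using inj u01 v01 by (auto simp: inj_on_def)
          have eq: "fun_of x u - fun_of x v
              = (fun_of x u - fun_of x u0) + (fun_of x u0 - fun_of x v0) + (fun_of x v0 - fun_of x v)"
            by simp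
          have "norm (fun_of x u - fun_of x v)
              \<le> norm (fun_of x u - fun_of x u0) + e + norm (fun_of x v0 - fun_of x v)"
            unfolding e_def
            using arg_cong[OF eq, of norm] norm_triangle_ineq[of "fun_of x u - fun_of x u0 + (fun_of x u0 - fun_of x v0)" "fun_of x v0 - fun_of x v"]
              norm_triangle_ineq[of "fun_of x u - fun_of x u0" "fun_of x u0 - fun_of x v0"]
            by linarith
          also have "\<dots> \<le> a + e + (e + a)"
            using unit_speed_lipschitz[OF x u01 uv0(1)] unit_speed_lipschitz[OF x uv0(2) v01] b
            by (simp add: a_def abs_minus_commute)
          finally have "norm (fun_of x u - fun_of x v) \<le> 2 * (e + a)" by simp
          then have "1 / (2 * (e + a))\<^sup>2 \<le> 1 / (norm (fun_of x u - fun_of x v))\<^sup>2"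
            using N0 by (intro divide_left_mono power_mono) (auto intro!: mult_pos_pos)
          then show ?thesis using d by (simp add: moebius_integrand_def)
        qed
        have q: "1 / (4 * q) = 1 / (2 * q)\<^sup>2 * q" if "q > 0" for q :: real
          using that by (simp add: power2_eq_square field_simps)
        have "1 / (4 * (e + a)) = 1 / (2 * (e + a))\<^sup>2 * (e + a)"
          by (rule q) (use e a in linarith)
        then have "ennreal (1 / (4 * (e + a))) = ennreal (1 / (2 * (e + a))\<^sup>2) * ennreal (e + a)"
          using t by (simp add: ennreal_mult[symmetric])
        also have "ennreal (e + a) = emeasure circle ?J"
          using J by (simp add: circle.emeasure_eq_measure)
        also have "ennreal (1 / (2 * (e + a))\<^sup>2) * emeasure circle ?J
            = (\<integral>\<^sup>+v. ennreal (1 / (2 * (e + a))\<^sup>2) * indicator ?J v \<partial>circle)"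
          by (rule nn_integral_cmult_indicator[symmetric, OF J(1)])
        also have "\<dots> \<le> (\<integral>\<^sup>+v. ennreal (?F u v + 4 / r\<^sup>2) \<partial>circle)"
          using pt by (intro nn_integral_mono) (auto simp: indicator_def intro!: ennreal_leI)
        finally show ?thesis by (simp add: a_def)
      qed
      have "ennreal (1 / 4) * ennreal (ln ((e + h / 2) / e))
          = ennreal (1 / 4) * (\<integral>\<^sup>+u. ennreal (1 / (e + \<bar>u - u0\<bar>)) * indicator ?I u \<partial>circle)"
        using nn_integral_side_interval_log[OF u0'(1), of "h/2" e] h e by simp
      also have "\<dots> = (\<integral>\<^sup>+u. ennreal (1 / 4) * (ennreal (1 / (e + \<bar>u - u0\<bar>)) * indicator ?I u) \<partial>circle)"
        using side_interval_sets[OF u0'(1), of "h/2"] h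
        by (intro nn_integral_cmult[symmetric] borel_measurable_times_ennreal borel_measurable_indicator) auto
      also have "\<dots> \<le> (\<integral>\<^sup>+u. \<integral>\<^sup>+v. ennreal (?F u v + 4 / r\<^sup>2) \<partial>circle \<partial>circle)"
      proof (rule nn_integral_mono)
        fix u
        have "ennreal (1 / 4) * ennreal (1 / (e + \<bar>u - u0\<bar>)) = ennreal (1 / (4 * (e + \<bar>u - u0\<bar>)))"
          using e by (simp add: ennreal_mult[symmetric])
        then show "ennreal (1 / 4) * (ennreal (1 / (e + \<bar>u - u0\<bar>)) * indicator ?I u)
            \<le> (\<integral>\<^sup>+v. ennreal (?F u v + 4 / r\<^sup>2) \<partial>circle)"
          using inner[of u] by (cases "u \<in> ?I") auto
      qed
      also have "\<dots> = (\<integral>\<^sup>+w. ennreal ((\<lambda>(u, v). ?F u v) w + 4 / r\<^sup>2) \<partial>(circle \<Otimes>\<^sub>M circle))"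
      proof -
        have "(\<lambda>w. ennreal ((\<lambda>(u, v). ?F u v) w + 4 / r\<^sup>2)) \<in> borel_measurable (circle \<Otimes>\<^sub>M circle)"
          by measurable
        from circle.nn_integral_fst[OF this] show ?thesis by simp
      qed
      also have "\<dots> = ennreal (moebius_energy x + 4 / r\<^sup>2)"
      proof -
        note i = moebius_integrand_integrable[OF x c(2,1)]
        have i2: "integrable (circle \<Otimes>\<^sub>M circle) (\<lambda>w. 4 / r\<^sup>2 :: real)"
          by (intro finite_measure.integrable_const finite_measure_pair_measure) unfold_locales
        have "measure (circle \<Otimes>\<^sub>M circle) (space (circle \<Otimes>\<^sub>M circle)) = 1"
          using circle.emeasure_pair_measure_Times[of "space circle" circle "space circle"] sets.top[of circle]
          by (simp add: space_pair_measure emeasure_circle measure_def del: sets.top)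
        then have "(\<integral>w. (\<lambda>(u, v). ?F u v) w + 4 / r\<^sup>2 \<partial>(circle \<Otimes>\<^sub>M circle)) = moebius_energy x + 4 / r\<^sup>2"
          using i i2 by (simp add: Bochner_Integration.integral_add moebius_energy_pair[OF x c(2,1)])
        moreover have "(\<integral>\<^sup>+w. ennreal ((\<lambda>(u, v). ?F u v) w + 4 / r\<^sup>2) \<partial>(circle \<Otimes>\<^sub>M circle))
            = ennreal (\<integral>w. (\<lambda>(u, v). ?F u v) w + 4 / r\<^sup>2 \<partial>(circle \<Otimes>\<^sub>M circle))"
        proof (rule nn_integral_eq_integral[OF Bochner_Integration.integrable_add[OF i i2]], rule AE_I2)
          fix w assume "w \<in> space (circle \<Otimes>\<^sub>M circle)"
          then show "0 \<le> (\<lambda>(u, v). ?F u v) w + 4 / r\<^sup>2"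
            using F0 by (auto simp: space_pair_measure intro!: add_nonneg_nonneg)
        qed
        ultimately show ?thesis by simp
      qed
      also have "\<dots> \<le> ennreal (E + 4 / r\<^sup>2)" using xE by (intro ennreal_leI) simp
      finally have "ennreal (1 / 4 * ln ((e + h / 2) / e)) \<le> ennreal (E + 4 / r\<^sup>2)"
        using e h by (simp add: ennreal_mult[symmetric])
      then have "1 / 4 * ln ((e + h / 2) / e) \<le> E + 4 / r\<^sup>2"
        using E by (subst (asm) ennreal_le_iff) auto
      moreover have "ln ((h / 2) / e) \<le> ln ((e + h / 2) / e)"
        using e h by (intro ln_mono divide_right_mono) auto
      ultimately have "ln ((h / 2) / e) \<le> 4 * (E + 4 / r\<^sup>2)" by simp
      then have "(h / 2) / e \<le> exp (4 * (E + 4 / r\<^sup>2))"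
        using e h by (metis divide_pos_pos exp_le_cancel_iff exp_ln half_gt_zero)
      then have "h / 2 \<le> e * exp (4 * (E + 4 / r\<^sup>2))" using e by (simp add: field_simps)
      then have "m \<le> e * exp (4 * (E + 4 / r\<^sup>2)) * exp (- 4 * (E + 4 / r\<^sup>2))"
        unfolding m_def by (rule mult_right_mono) simp
      also have "\<dots> = e * exp (4 * (E + 4 / r\<^sup>2) + - 4 * (E + 4 / r\<^sup>2))"
        by (simp only: exp_add mult.assoc)
      finally have "m \<le> e" by simp
      then show False using em by simp
    qed
  qed
qed

section \<open>Closing up tangent fields\<close>

text \<open>
  Since the curve is closed, its velocity has mean 0, so its product with \<open>d\<close> vanishes
  somewhere, hence is at most half the length of \<open>d\<close> on an interval whose length depends only on
  the bending energy. On that interval the projection orthogonal to the velocity retains a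
  definite part of \<open>d\<close>.
\<close>

lemma coercivity:
  assumes K: "K \<ge> 0"
  obtains a where "a > 0"
    "\<And>(x :: 'a::euclidean_space H2) d. unit_speed x \<Longrightarrow> L2_sq (d2 x) \<le> K \<Longrightarrow>
        a * (norm d)\<^sup>2 \<le> (norm d)\<^sup>2 - (LINT s|circle. (velocity x s \<bullet> d)\<^sup>2)"
proof -
  \<comment> \<open>within this distance of a zero the product is at most \<open>norm d / 2\<close>, since \<open>sqrt (t * K) \<le> 1 / 2\<close>\<close>
  define t where "t = 1 / (4 * (K + 1))"
  have t: "t > 0" "t * K \<le> 1 / 4" using K by (simp_all add: t_def field_simps)
  have "1 / (4 * (K + 1)) \<le> 1 / (4 * (0 + 1))" using K by (intro divide_left_mono) auto
  then have t1: "t \<le> 1 / 4" by (simp add: t_def)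
  show thesis
  proof (rule that)
    show "3 / 4 * t > 0" using t by simp
    fix x :: "'a H2" and d :: 'a
    assume x: "unit_speed x" and xK: "L2_sq (d2 x) \<le> K"
    let ?T = "velocity x"
    let ?f = "\<lambda>s. ?T s \<bullet> d"
    have fp: "is_primitive ?f (\<lambda>s. d2 x s \<bullet> d)"
      by (rule is_primitive_linear[OF bounded_linear_inner_left velocity_primitive])
    note cf = is_primitive_continuous[OF fp]
    have iT: "integrable circle ?T" by (rule sq_integrable_imp_integrable[OF velocity_sq_integrable])
    have If: "(LINT s|circle. ?f s) = 0"
      using iT by (simp add: velocity_integral_zero)
    have if1: "integrable circle ?f" using iT by simp
    \<comment> \<open>a product of constant sign would contradict mean 0; \<open>\<sigma>\<close> is the sign\<close>
    have nosign: False if nz: "\<And>s. s \<in> {0..1} \<Longrightarrow> \<sigma> * ?f s > 0" for \<sigma> :: real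
    proof -
      have i: "integrable circle (\<lambda>s. \<sigma> * ?f s)" using if1 by simp
      have "(LINT s|circle. \<sigma> * ?f s) = 0" using If by simp
      moreover have "AE s in circle. 0 \<le> \<sigma> * ?f s"
        using nz by (intro AE_I2) (simp add: less_imp_le)
      ultimately have ae: "AE s in circle. \<sigma> * ?f s = 0"
        using integral_nonneg_eq_0_iff_AE[OF i] by blast
      have "\<sigma> * ?f 0 = 0"
        by (rule continuous_AE_eq[OF _ _ ae]) (intro continuous_intros velocity_continuous | simp)+
      then show False using nz[of 0] by auto
    qed
    obtain s0 where s0: "s0 \<in> {0..1}" "?f s0 = 0"
    proof (rule ccontr)
      assume "\<not> thesis"
      then have nz: "?f s \<noteq> 0" if "s \<in> {0..1}" for s using that \<open>\<And>s0. s0 \<in> {0..1} \<Longrightarrow> ?f s0 = 0 \<Longrightarrow> thesis\<close> by blast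
      have conn: "connected (?f ` {0..1})" using cf by (intro connected_continuous_image) auto
      have same: "?f s * ?f 0 > 0" if s: "s \<in> {0..1}" for s
      proof (rule ccontr)
        assume "\<not> ?f s * ?f 0 > 0"
        then have "?f s * ?f 0 < 0" using nz[OF s] nz[of 0] by (auto simp: not_less le_less)
        then have "0 \<in> {min (?f s) (?f 0)..max (?f s) (?f 0)}"
          by (auto simp: mult_less_0_iff min_def max_def)
        also have "\<dots> \<subseteq> ?f ` {0..1}"
          using connected_contains_Icc[OF conn] s by (auto simp: min_def max_def)
        finally show False using nz by fastforce
      qed
      then show False using nosign[of "?f 0"] by (simp add: mult.commute)
    qed
    let ?J = "side_interval s0 t"
    have J: "?J \<in> sets circle" "measure circle ?J = t" "?J \<subseteq> {0..<1}"
      using side_interval[OF s0(1)] t t1 by auto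
    have fd: "(?f s)\<^sup>2 \<le> (norm d)\<^sup>2" if "s \<in> {0..1}" for s
    proof -
      have "\<bar>?f s\<bar> \<le> norm d" using Cauchy_Schwarz_ineq2[of "?T s" d] x that by (simp add: unit_speed_def)
      then show ?thesis by (metis abs_ge_zero power2_abs power_mono)
    qed
    have near: "(?f s)\<^sup>2 \<le> (norm d)\<^sup>2 / 4" if s: "s \<in> ?J" for s
    proof -
      have "\<bar>s - s0\<bar> \<le> t" using side_interval_near[OF s0(1)] s t t1 by auto
      then have "\<bar>s - s0\<bar> * L2_sq (d2 x) \<le> t * K"
        using xK L2_sq_nonneg[of "d2 x"] t by (intro mult_mono) auto
      then have "sqrt \<bar>s - s0\<bar> * sqrt (L2_sq (d2 x)) \<le> sqrt (1 / 4)"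
        unfolding real_sqrt_mult[symmetric] using t by (intro real_sqrt_le_mono) linarith
      also have "sqrt (1 / 4) = (1 / 2 :: real)" by (simp add: real_sqrt_divide)
      finally have "norm (?T s - ?T s0) \<le> 1 / 2"
        using is_primitive_holder[OF velocity_primitive s0(1), of s x] J(3) s by force
      then have "norm (?T s - ?T s0) * norm d \<le> 1 / 2 * norm d" by (intro mult_right_mono) auto
      moreover have "?f s = (?T s - ?T s0) \<bullet> d" using s0(2) by (simp add: inner_diff_left)
      ultimately have "\<bar>?f s\<bar> \<le> norm d / 2"
        using Cauchy_Schwarz_ineq2[of "?T s - ?T s0" d] by simp
      then have "\<bar>?f s\<bar>\<^sup>2 \<le> (norm d / 2)\<^sup>2" by (intro power_mono) auto
      then show ?thesis by (simp add: power_divide)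
    qed
    have i2: "integrable circle (\<lambda>s. (norm d)\<^sup>2 - (?f s)\<^sup>2)"
    proof (rule Bochner_Integration.integrable_diff)
      have "(\<lambda>s. (?f s)\<^sup>2) \<in> borel_measurable circle"
        using borel_measurable_circle_continuous_on[OF cf] by measurable
      then show "integrable circle (\<lambda>s. (?f s)\<^sup>2)"
        using fd by (intro circle.integrable_const_bound[of _ "(norm d)\<^sup>2"]) auto
    qed simp
    have "3 / 4 * t * (norm d)\<^sup>2 = (LINT s:?J|circle. 3 / 4 * (norm d)\<^sup>2)"
      unfolding set_integral_const_circle[OF J(1)] J(2) by simp
    also have "\<dots> \<le> (LINT s|circle. (norm d)\<^sup>2 - (?f s)\<^sup>2)"
      unfolding set_lebesgue_integral_def
    proof (rule Bochner_Integration.integral_mono[OF _ i2])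
      show "integrable circle (\<lambda>s. indicat_real ?J s *\<^sub>R (3 / 4 * (norm d)\<^sup>2))"
        using set_integrable_circle[of "\<lambda>_. 3 / 4 * (norm d)\<^sup>2" ?J] J(1) by (simp add: set_integrable_def)
      fix s assume "s \<in> space circle"
      then show "indicat_real ?J s *\<^sub>R (3 / 4 * (norm d)\<^sup>2) \<le> (norm d)\<^sup>2 - (?f s)\<^sup>2"
        using near[of s] fd[of s] by (cases "s \<in> ?J") auto
    qed
    also have "\<dots> = (norm d)\<^sup>2 - (LINT s|circle. (?f s)\<^sup>2)"
    proof -
      have "integrable circle (\<lambda>s. (norm d)\<^sup>2 - ((norm d)\<^sup>2 - (?f s)\<^sup>2))"
        by (rule Bochner_Integration.integrable_diff[OF _ i2]) simp
      then have "integrable circle (\<lambda>s. (?f s)\<^sup>2)" by simp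
      then show ?thesis by (simp add: measure_circle_space)
    qed
    finally show "3 / 4 * t * (norm d)\<^sup>2 \<le> (norm d)\<^sup>2 - (LINT s|circle. (velocity x s \<bullet> d)\<^sup>2)" .
  qed
qed

text \<open>
  The first-order expansion of the normalization about a unit vector is the orthogonal
  projection.
\<close>

lemma normalization_expansion:
  fixes T w :: "'a::euclidean_space"
  assumes T: "norm T = 1" and nz: "T + w \<noteq> 0"
  shows "norm ((T + w) /\<^sub>R norm (T + w) - (T + w - (T \<bullet> w) *\<^sub>R T)) \<le> 4 * (norm w)\<^sup>2"
proof -
  define n where "n = norm (T + w)"
  define \<tau> where "\<tau> = T \<bullet> w"
  have n: "n > 0" using nz by (simp add: n_def)
  have \<tau>: "\<bar>\<tau>\<bar> \<le> norm w" unfolding \<tau>_def using Cauchy_Schwarz_ineq2[of T w] T by simp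
  have n1: "\<bar>n - 1\<bar> \<le> norm w" unfolding n_def using norm_triangle_ineq3[of "T + w" T] T by simp
  have nn: "n\<^sup>2 - 1 = 2 * \<tau> + (norm w)\<^sup>2"
    unfolding n_def \<tau>_def using T by (simp add: power2_norm_eq_inner inner_add inner_commute norm_eq_1)
  have "(1 - n + \<tau> * n) * (n + 1) = \<tau> * ((n - 1) * (n + 1)) + \<tau> * (n - 1) - (norm w)\<^sup>2"
    using nn by (simp add: power2_eq_square algebra_simps)
  then have "\<bar>1 - n + \<tau> * n\<bar> * (n + 1) = \<bar>\<tau> * ((n - 1) * (n + 1)) + \<tau> * (n - 1) - (norm w)\<^sup>2\<bar>"
    using n by (metis abs_mult abs_of_pos add_pos_pos zero_less_one)
  also have "\<dots> \<le> \<bar>\<tau>\<bar> * (\<bar>n - 1\<bar> * (n + 1)) + \<bar>\<tau>\<bar> * \<bar>n - 1\<bar> + (norm w)\<^sup>2"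
    using n by (intro order_trans[OF abs_triangle_ineq4] add_mono order_trans[OF abs_triangle_ineq]) (auto simp: abs_mult)
  also have "\<dots> \<le> norm w * (norm w * (n + 1)) + norm w * norm w + (norm w)\<^sup>2"
    using \<tau> n1 n by (intro add_mono mult_mono order.refl) auto
  also have "\<dots> \<le> 3 * (norm w)\<^sup>2 * (n + 1)"
    using n by (simp add: power2_eq_square algebra_simps)
  finally have key: "\<bar>1 - n + \<tau> * n\<bar> \<le> 3 * (norm w)\<^sup>2" using n by simp
  have "(T + w) /\<^sub>R n - (T + w - \<tau> *\<^sub>R T) = (1 / n - 1 + \<tau>) *\<^sub>R (T + w) - \<tau> *\<^sub>R w"
    by (simp add: algebra_simps inverse_eq_divide)
  also have "norm \<dots> \<le> norm ((1 / n - 1 + \<tau>) *\<^sub>R (T + w)) + norm (\<tau> *\<^sub>R w)"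
    by (rule norm_triangle_ineq4)
  also have "norm ((1 / n - 1 + \<tau>) *\<^sub>R (T + w)) = \<bar>1 - n + \<tau> * n\<bar>"
  proof -
    have "norm ((1 / n - 1 + \<tau>) *\<^sub>R (T + w)) = \<bar>(1 / n - 1 + \<tau>) * n\<bar>"
      using n by (simp add: n_def[symmetric] abs_mult)
    also have "(1 / n - 1 + \<tau>) * n = 1 - n + \<tau> * n" using n by (simp add: field_simps)
    finally show ?thesis .
  qed
  also have "norm (\<tau> *\<^sub>R w) \<le> (norm w)\<^sup>2"
    using \<tau> by (simp add: power2_eq_square mult_right_mono)
  finally show ?thesis using key by (simp add: n_def \<tau>_def)
qed

lemma normalize_lipschitz:
  fixes a b :: "'a::euclidean_space"
  assumes a: "1 / 2 \<le> norm a" and b: "b \<noteq> 0"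
  shows "norm (a /\<^sub>R norm a - b /\<^sub>R norm b) \<le> 4 * norm (a - b)"
proof -
  define m n where "m = norm a" and "n = norm b"
  have m0: "1 / 2 \<le> m" using a by (simp add: m_def)
  then have m: "m > 0" "1 / m \<le> 2" using divide_left_mono[OF m0, of 1] by auto
  have n: "n > 0" using b by (simp add: n_def)
  have "a /\<^sub>R m - b /\<^sub>R n = (1 / m) *\<^sub>R (a - b) + ((n - m) / (m * n)) *\<^sub>R b"
    using m n by (simp add: scaleR_diff_right inverse_eq_divide diff_divide_distrib scaleR_diff_left)
  also have "norm \<dots> \<le> 1 / m * norm (a - b) + \<bar>n - m\<bar> / (m * n) * n"
    using m n norm_triangle_ineq[of "(1 / m) *\<^sub>R (a - b)" "((n - m) / (m * n)) *\<^sub>R b"]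
    by (simp add: n_def[symmetric] abs_divide abs_mult)
  also have "\<bar>n - m\<bar> / (m * n) * n = 1 / m * \<bar>m - n\<bar>" using n by (simp add: abs_minus_commute)
  also have "1 / m * norm (a - b) + 1 / m * \<bar>m - n\<bar> \<le> 2 * norm (a - b) + 2 * norm (a - b)"
    using m norm_triangle_ineq3[of a b] by (intro add_mono mult_mono) (auto simp: m_def n_def)
  finally show ?thesis by (simp add: m_def n_def)
qed

text \<open>
  A coercive linear map is injective, hence invertible in finite dimension, and coercivity
  bounds the inverse.
\<close>

lemma coercive_right_inverse:
  fixes A :: "'a::euclidean_space \<Rightarrow> 'a"
  assumes A: "linear A" and a: "a > 0" and coer: "\<And>d. a * (norm d)\<^sup>2 \<le> d \<bullet> A d"
  obtains G where "linear G" "\<And>v. A (G v) = v" "\<And>v. norm (G v) \<le> norm v / a"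
proof -
  have low: "a * norm d \<le> norm (A d)" for d
  proof (cases "d = 0")
    case False
    have "a * norm d * norm d \<le> norm d * norm (A d)"
      using coer[of d] norm_cauchy_schwarz[of d "A d"] by (simp add: power2_eq_square mult.assoc)
    then show ?thesis using False by (simp add: mult.commute)
  qed simp
  have "inj A"
    using low a unfolding linear_injective_0[OF A]
    by (metis mult_le_0_iff norm_le_zero_iff norm_zero not_le)
  then obtain G where G: "linear G" "\<And>v. A (G v) = v"
    using linear_injective_isomorphism[OF A] by blast
  show thesis
    by (rule that[OF G]) (use low[of "G _"] a G(2) in \<open>simp add: pos_le_divide_eq mult.commute\<close>)
qed

lemma integrable_continuous_circle:
  fixes f :: "real \<Rightarrow> 'a::euclidean_space"
  assumes "continuous_on {0..1} f"
  shows "integrable circle f"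
proof -
  obtain B where "\<And>u. u \<in> {0..1} \<Longrightarrow> norm (f u) \<le> B"
    using continuous_on_unit_interval_bounded[OF assms] by blast
  then show ?thesis
    using borel_measurable_circle_continuous_on[OF assms]
    by (intro circle.integrable_const_bound[of _ B]) auto
qed

lemma integral_circle_norm_le:
  fixes f :: "real \<Rightarrow> 'a::euclidean_space"
  assumes "integrable circle f" "\<And>s. s \<in> {0..<1} \<Longrightarrow> norm (f s) \<le> B"
  shows "norm (LINT s|circle. f s) \<le> B"
proof -
  have "norm (LINT s|circle. f s) \<le> (LINT s|circle. B)"
    by (rule Bochner_Integration.integral_norm_bound_integral) (use assms in auto)
  then show ?thesis by (simp add: measure_circle_space)
qed

text \<open>
  Subtracting a constant \<open>d\<close> from a field and then projecting changes the mean by this amount.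
  On closed curves of unit speed this map is coercive, so the mean can be corrected to 0 by a
  unique constant.
\<close>

definition projected_mean :: "'a::euclidean_space H2 \<Rightarrow> 'a \<Rightarrow> 'a" where
  "projected_mean x d = (LINT s|circle. d - (velocity x s \<bullet> d) *\<^sub>R velocity x s)"

lemma projection_integrable:
  "integrable circle (\<lambda>s. d - (velocity x s \<bullet> d) *\<^sub>R velocity x s)"
  by (intro integrable_continuous_circle continuous_intros velocity_continuous)

lemma projected_mean_linear: "linear (projected_mean x)"
proof (rule linearI)
  fix d e :: 'a and r :: real
  have "projected_mean x (d + e) = (LINT s|circle. (d - (velocity x s \<bullet> d) *\<^sub>R velocity x s)
      + (e - (velocity x s \<bullet> e) *\<^sub>R velocity x s))"
    unfolding projected_mean_def
    by (intro Bochner_Integration.integral_cong) (auto simp: inner_add_right scaleR_add_left)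
  also have "\<dots> = projected_mean x d + projected_mean x e"
    unfolding projected_mean_def
    by (rule Bochner_Integration.integral_add[OF projection_integrable projection_integrable])
  finally show "projected_mean x (d + e) = projected_mean x d + projected_mean x e" .
  have "projected_mean x (r *\<^sub>R d) = (LINT s|circle. r *\<^sub>R (d - (velocity x s \<bullet> d) *\<^sub>R velocity x s))"
    unfolding projected_mean_def
    by (intro Bochner_Integration.integral_cong) (auto simp: scaleR_diff_right)
  also have "\<dots> = r *\<^sub>R projected_mean x d"
    unfolding projected_mean_def by (rule integral_scaleR_right)
  finally show "projected_mean x (r *\<^sub>R d) = r *\<^sub>R projected_mean x d" .
qed

lemma projected_mean_inner:
  "d \<bullet> projected_mean x d = (norm d)\<^sup>2 - (LINT s|circle. (velocity x s \<bullet> d)\<^sup>2)"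
proof -
  have i: "integrable circle (\<lambda>s. (velocity x s \<bullet> d)\<^sup>2)"
    by (intro integrable_continuous_circle continuous_intros velocity_continuous)
  have "d \<bullet> projected_mean x d = (LINT s|circle. d \<bullet> (d - (velocity x s \<bullet> d) *\<^sub>R velocity x s))"
    unfolding projected_mean_def
    by (rule integral_inner_right[OF projection_integrable, symmetric])
  also have "\<dots> = (LINT s|circle. (norm d)\<^sup>2 - (velocity x s \<bullet> d)\<^sup>2)"
    by (intro Bochner_Integration.integral_cong)
       (auto simp: inner_diff_right dot_square_norm inner_commute[of d] simp flip: power2_eq_square)
  finally show ?thesis using i by (simp add: measure_circle_space)
qed

lemma unit_speed_velocity_ortho:
  assumes "unit_speed x"
  shows "AE s in circle. velocity x s \<bullet> d2 x s = 0"
proof -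
  have P: "is_primitive (\<lambda>s. velocity x s \<bullet> velocity x s) (\<lambda>s. d2 x s \<bullet> velocity x s + velocity x s \<bullet> d2 x s)"
    by (rule is_primitive_inner[OF velocity_primitive velocity_primitive])
  have "AE s in circle. d2 x s \<bullet> velocity x s + velocity x s \<bullet> d2 x s = 0"
    by (rule is_primitive_unique[OF P is_primitive_const[of 1]])
       (use assms in \<open>simp add: unit_speed_def dot_square_norm\<close>)
  then show ?thesis by eventually_elim (simp add: inner_commute)
qed

lemma tangent_velocity:
  assumes "h \<in> arclength_tangent x"
  shows "\<And>s. s \<in> {0..1} \<Longrightarrow> velocity x s \<bullet> velocity h s = 0"
    and "AE s in circle. velocity x s \<bullet> d2 h s + velocity h s \<bullet> d2 x s = 0"
    and "fun_of h 0 = 0"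
proof -
  show "fun_of h 0 = 0" using assms by (simp add: arclength_tangent_def)
  have "AE s in circle. d1 x s \<bullet> d1 h s = 0" using assms by (simp add: arclength_tangent_def)
  then have ae: "AE s in circle. velocity x s \<bullet> velocity h s = 0"
    using velocity_AE[of x] velocity_AE[of h] by eventually_elim simp
  show eq: "velocity x s \<bullet> velocity h s = 0" if "s \<in> {0..1}" for s
    by (rule continuous_AE_eq[OF _ _ ae that]) (intro continuous_intros velocity_continuous)+
  have P: "is_primitive (\<lambda>s. velocity x s \<bullet> velocity h s) (\<lambda>s. d2 x s \<bullet> velocity h s + velocity x s \<bullet> d2 h s)"
    by (rule is_primitive_inner[OF velocity_primitive velocity_primitive])
  have "AE s in circle. d2 x s \<bullet> velocity h s + velocity x s \<bullet> d2 h s = 0"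
    by (rule is_primitive_unique[OF P is_primitive_const[of 0]]) (use eq in simp)
  then show "AE s in circle. velocity x s \<bullet> d2 h s + velocity h s \<bullet> d2 x s = 0"
    by eventually_elim (simp add: inner_commute add.commute)
qed

text \<open>
  The velocity perturbed by \<open>t h'\<close> and normalized need not have mean 0. To first order,
  subtracting a constant \<open>d\<close> before normalizing changes the mean by the projected mean of \<open>d\<close>,
  which is invertible. All other terms are quadratic, so solving for \<open>d\<close> is a fixed point
  problem on a ball of radius of order \<open>t\<^sup>2\<close>, and Brouwer's theorem applies.
\<close>

lemma closing_translation:
  fixes x h :: "'a::euclidean_space H2"
  assumes x: "unit_speed x" and h: "h \<in> arclength_tangent x"
    and a: "a > 0" "\<And>d. a * (norm d)\<^sup>2 \<le> (norm d)\<^sup>2 - (LINT s|circle. (velocity x s \<bullet> d)\<^sup>2)"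
    and B: "B \<ge> 0" "\<And>s. s \<in> {0..1} \<Longrightarrow> norm (velocity h s) \<le> B"
    and K: "K = 4 * (B + 1)\<^sup>2 / a" and t: "0 < t" "t * (B + 1) \<le> 1 / 4" "K * t \<le> 1"
  obtains d where "norm d \<le> K * t\<^sup>2"
    "(LINT s|circle. (velocity x s + (t *\<^sub>R velocity h s - d)) /\<^sub>R norm (velocity x s + (t *\<^sub>R velocity h s - d))) = 0"
proof -
  let ?T = "velocity x" and ?H = "velocity h"
  define w where "w d s = t *\<^sub>R ?H s - d" for d s
  define N where "N d s = (?T s + w d s) /\<^sub>R norm (?T s + w d s)" for d s
  define A where "A = projected_mean x"
  have K0: "K > 0" using K a(1) B(1) by simp
  have Kt: "K * t\<^sup>2 \<le> t" using mult_right_mono[OF t(3), of t] t(1) by (simp add: power2_eq_square mult.assoc)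
  obtain G where G: "linear G" "\<And>v. A (G v) = v" "\<And>v. norm (G v) \<le> norm v / a"
    using coercive_right_inverse[OF projected_mean_linear a(1)] a(2) unfolding A_def projected_mean_inner by blast
  have T1: "norm (?T s) = 1" if "s \<in> {0..1}" for s using x that by (simp add: unit_speed_def)
  have wle: "norm (w d s) \<le> t * (B + 1)" if "norm d \<le> K * t\<^sup>2" "s \<in> {0..1}" for d s
  proof -
    have "norm (w d s) \<le> norm (t *\<^sub>R ?H s) + norm d" unfolding w_def by (rule norm_triangle_ineq4)
    also have "\<dots> \<le> t * B + t"
      using t(1) B(2)[OF that(2)] that(1) Kt by (intro add_mono) (auto intro: mult_left_mono)
    finally show ?thesis by (simp add: distrib_left)
  qed
  have Vge: "1 / 2 \<le> norm (?T s + w d s)" if "norm d \<le> K * t\<^sup>2" "s \<in> {0..1}" for d s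
    using wle[OF that] t(2) T1[OF that(2)] norm_diff_ineq[of "?T s" "w d s"] by linarith
  have contN: "continuous_on {0..1} (N d)" if "norm d \<le> K * t\<^sup>2" for d
  proof -
    have "\<forall>s\<in>{0..1}. norm (?T s + w d s) \<noteq> 0" using Vge[OF that] by force
    then show ?thesis unfolding N_def w_def
      by (intro continuous_intros velocity_continuous) auto
  qed
  note iN = integrable_continuous_circle[OF contN]
  have iT: "integrable circle ?T" and iH: "integrable circle ?H"
    by (intro integrable_continuous_circle velocity_continuous)+
  \<comment> \<open>applying \<open>A\<close> to \<open>d = F d\<close> shows that the mean of \<open>N d\<close> vanishes\<close>
  define F where "F d = G ((LINT s|circle. N d s) + A d)" for d
  have bound: "norm ((LINT s|circle. N d s) + A d) \<le> 4 * (t * (B + 1))\<^sup>2" if d: "norm d \<le> K * t\<^sup>2" for d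
  proof -
    let ?P = "\<lambda>s. d - (?T s \<bullet> d) *\<^sub>R ?T s"
    have iP: "integrable circle ?P" by (rule projection_integrable)
    have "(LINT s|circle. N d s + ?P s - ?T s - t *\<^sub>R ?H s)
        = (LINT s|circle. N d s) + A d - (LINT s|circle. ?T s) - t *\<^sub>R (LINT s|circle. ?H s)"
      unfolding A_def projected_mean_def using iN[OF d] iP iT iH by simp
    then have "(LINT s|circle. N d s) + A d = (LINT s|circle. N d s + ?P s - ?T s - t *\<^sub>R ?H s)"
      by (simp add: velocity_integral_zero)
    also have "norm \<dots> \<le> 4 * (t * (B + 1))\<^sup>2"
    proof (rule integral_circle_norm_le)
      show "integrable circle (\<lambda>s. N d s + ?P s - ?T s - t *\<^sub>R ?H s)"
        using iN[OF d] iP iT iH by simp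
      fix s :: real assume "s \<in> {0..<1}"
      then have s: "s \<in> {0..1}" by simp
      have Tw: "?T s \<bullet> w d s = - (?T s \<bullet> d)"
        using tangent_velocity(1)[OF h s] by (simp add: w_def inner_diff_right)
      have "?T s + w d s \<noteq> 0" using Vge[OF d s] by force
      from normalization_expansion[OF T1[OF s] this]
      have "norm (N d s - (?T s + w d s - (?T s \<bullet> w d s) *\<^sub>R ?T s)) \<le> 4 * (norm (w d s))\<^sup>2"
        by (simp add: N_def)
      also have "\<dots> \<le> 4 * (t * (B + 1))\<^sup>2" using wle[OF d s] by (intro mult_left_mono power_mono) auto
      finally show "norm (N d s + ?P s - ?T s - t *\<^sub>R ?H s) \<le> 4 * (t * (B + 1))\<^sup>2"
        unfolding Tw by (simp add: w_def algebra_simps)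
    qed
    finally show ?thesis .
  qed
  have "continuous_on (cball 0 (K * t\<^sup>2)) (\<lambda>d. LINT s|circle. N d s)"
  proof (rule lipschitz_on_continuous_on[of 4], rule lipschitz_onI)
    fix d e :: 'a assume "d \<in> cball 0 (K * t\<^sup>2)" "e \<in> cball 0 (K * t\<^sup>2)"
    then have de: "norm d \<le> K * t\<^sup>2" "norm e \<le> K * t\<^sup>2" by auto
    have "dist (LINT s|circle. N d s) (LINT s|circle. N e s) = norm (LINT s|circle. N d s - N e s)"
      using iN[OF de(1)] iN[OF de(2)] by (simp add: dist_norm)
    also have "\<dots> \<le> 4 * norm (d - e)"
    proof (rule integral_circle_norm_le)
      show "integrable circle (\<lambda>s. N d s - N e s)" using iN[OF de(1)] iN[OF de(2)] by simp
      fix s :: real assume "s \<in> {0..<1}"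
      then have s: "s \<in> {0..1}" by simp
      have "?T s + w e s \<noteq> 0" using Vge[OF de(2) s] by force
      from normalize_lipschitz[OF Vge[OF de(1) s] this]
      show "norm (N d s - N e s) \<le> 4 * norm (d - e)" by (simp add: N_def w_def norm_minus_commute)
    qed
    finally show "dist (LINT s|circle. N d s) (LINT s|circle. N e s) \<le> 4 * dist d e"
      by (simp add: dist_norm)
  qed simp
  moreover have "bounded_linear A" "bounded_linear G"
    using projected_mean_linear G(1) unfolding A_def linear_conv_bounded_linear by blast+
  ultimately have contF: "continuous_on (cball 0 (K * t\<^sup>2)) F"
    unfolding F_def
    by (intro bounded_linear.continuous_on[of G] continuous_on_add bounded_linear.continuous_on[of A]
        continuous_on_id)
  have "F \<in> cball 0 (K * t\<^sup>2) \<rightarrow> cball 0 (K * t\<^sup>2)"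
  proof
    fix d :: 'a assume "d \<in> cball 0 (K * t\<^sup>2)"
    then have d: "norm d \<le> K * t\<^sup>2" by simp
    have "norm (F d) \<le> 4 * (t * (B + 1))\<^sup>2 / a"
      unfolding F_def using G(3) bound[OF d] a(1) by (meson divide_right_mono less_imp_le order_trans)
    also have "\<dots> = K * t\<^sup>2" by (simp add: K power_mult_distrib)
    finally show "F d \<in> cball 0 (K * t\<^sup>2)" by simp
  qed
  moreover have "K * t\<^sup>2 > 0" using K0 t by simp
  ultimately obtain d where d: "d \<in> cball 0 (K * t\<^sup>2)" "F d = d"
    using brouwer_ball[OF _ contF] by blast
  have "A d = (LINT s|circle. N d s) + A d"
    using G(2)[of "(LINT s|circle. N d s) + A d"] d(2) unfolding F_def by simp
  then have "(LINT s|circle. N d s) = 0" by simp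
  then show thesis using that[of d] d(1) by (simp add: N_def w_def)
qed

section \<open>The bending energy and curves with prescribed tangent\<close>

text \<open>
  On curves of unit speed the bending energy is half of the associated quadratic form.
\<close>

definition d2_form :: "'a::euclidean_space H2 \<Rightarrow> 'a H2 \<Rightarrow> real" where
  "d2_form f g = (LINT s|circle. d2 f s \<bullet> d2 g s)"

lemma d2_form_self: "d2_form f f = L2_sq (d2 f)"
  by (simp add: d2_form_def L2_sq_def dot_square_norm)

lemma L2_sq_d2_le_norm: "L2_sq (d2 f) \<le> (norm f)\<^sup>2"
  using L2_sq_nonneg[of "fun_of f"] L2_sq_nonneg[of "velocity f"] by (simp add: norm_H2_sq)

lemma d2_inner_integrable: "integrable circle (\<lambda>s. d2 f s \<bullet> d2 g s)"
  by (intro sq_integrable_inner H2_derivs)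

lemma d2_form_commute: "d2_form f g = d2_form g f"
  by (simp add: d2_form_def inner_commute)

lemma d2_form_add_left: "d2_form (f + f') g = d2_form f g + d2_form f' g"
proof -
  have "d2_form (f + f') g = (LINT s|circle. d2 f s \<bullet> d2 g s + d2 f' s \<bullet> d2 g s)"
    unfolding d2_form_def
  proof (rule integral_cong_AE)
    show "AE s in circle. d2 (f + f') s \<bullet> d2 g s = d2 f s \<bullet> d2 g s + d2 f' s \<bullet> d2 g s"
      using d_add(2)[of f f'] by eventually_elim (simp add: inner_add_left)
  qed measurable
  then show ?thesis unfolding d2_form_def
    using Bochner_Integration.integral_add[OF d2_inner_integrable[of f g] d2_inner_integrable[of f' g]] by simp
qed

lemma d2_form_scaleR_left: "d2_form (r *\<^sub>R f) g = r * d2_form f g"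
proof -
  have "d2_form (r *\<^sub>R f) g = (LINT s|circle. r * (d2 f s \<bullet> d2 g s))"
    unfolding d2_form_def
  proof (rule integral_cong_AE)
    show "AE s in circle. d2 (r *\<^sub>R f) s \<bullet> d2 g s = r * (d2 f s \<bullet> d2 g s)"
      using d_scaleR(2)[of r f] by eventually_elim simp
  qed measurable
  then show ?thesis by (simp add: d2_form_def)
qed

lemma
  shows d2_form_add_right: "d2_form f (g + g') = d2_form f g + d2_form f g'"
    and d2_form_scaleR_right: "d2_form f (r *\<^sub>R g) = r * d2_form f g"
  unfolding d2_form_commute[of f] by (rule d2_form_add_left, rule d2_form_scaleR_left)

lemma d2_form_bound: "\<bar>d2_form f g\<bar> \<le> norm f * norm g"
proof -
  have expand: "d2_form (f + (- m) *\<^sub>R g) (f + (- m) *\<^sub>R g)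
      = d2_form f f - 2 * m * d2_form f g + m\<^sup>2 * d2_form g g" for m
    unfolding d2_form_add_left d2_form_add_right d2_form_scaleR_left d2_form_scaleR_right
      d2_form_commute[of g f]
    by (simp add: power2_eq_square algebra_simps)
  have "0 \<le> d2_form f f - 2 * m * d2_form f g + m\<^sup>2 * d2_form g g" for m
    using expand[of m] by (metis d2_form_self L2_sq_nonneg)
  then have "(d2_form f g)\<^sup>2 \<le> d2_form g g * d2_form f f"
    by (rule nonneg_quadratic_imp_discriminant[rotated]) (simp add: d2_form_self L2_sq_nonneg)
  also have "\<dots> \<le> (norm g)\<^sup>2 * (norm f)\<^sup>2"
    unfolding d2_form_self by (intro mult_mono L2_sq_d2_le_norm L2_sq_nonneg) auto
  finally have "\<bar>d2_form f g\<bar>\<^sup>2 \<le> (norm f * norm g)\<^sup>2" by (simp add: power_mult_distrib mult.commute)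
  then show ?thesis by (rule power2_le_imp_le) simp
qed

lemma d2_form_bounded_bilinear: "bounded_bilinear d2_form"
proof
  fix f f' g g' :: "'a H2" and r :: real
  show "d2_form (f + f') g = d2_form f g + d2_form f' g" by (rule d2_form_add_left)
  show "d2_form f (g + g') = d2_form f g + d2_form f g'"
    by (rule d2_form_add_right)
  show "d2_form (r *\<^sub>R f) g = r *\<^sub>R d2_form f g" by (simp add: d2_form_scaleR_left)
  show "d2_form f (r *\<^sub>R g) = r *\<^sub>R d2_form f g"
    by (simp add: d2_form_scaleR_right)
  show "\<exists>K. \<forall>f g :: 'a H2. norm (d2_form f g) \<le> norm f * norm g * K"
    using d2_form_bound by (intro exI[of _ 1]) auto
qed

interpretation d2_form: bounded_bilinear d2_form
  by (rule d2_form_bounded_bilinear)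

lemma bending_energy_unit_speed:
  assumes x: "unit_speed x"
  shows "bending_energy x = 1 / 2 * L2_sq (d2 x)"
proof -
  let ?g = "arclength_deriv x (fun_of x)"
  have g: "?g u = d1 x u /\<^sub>R norm (d1 x u)" for u
    by (simp add: arclength_deriv_def d1_def)
  have "?g \<in> borel_measurable circle" unfolding g by measurable
  moreover have "AE u in circle. d1 x u = ?g u"
    using unit_speed_AE[OF x] by eventually_elim (simp add: g)
  ultimately have w: "has_weak_deriv ?g (d2 x)"
    by (intro has_weak_deriv_cong_AE[OF H2_derivs(2)])
  have m: "weak_deriv ?g \<in> borel_measurable circle"
    using has_weak_deriv_weak_deriv[OF w] by (auto simp: has_weak_deriv_def)
  have "(LINT u|circle. (curvature x u)\<^sup>2 * norm (d1 x u)) = L2_sq (d2 x)"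
    unfolding L2_sq_def
  proof (rule integral_cong_AE)
    show "(\<lambda>u. (curvature x u)\<^sup>2 * norm (d1 x u)) \<in> borel_measurable circle"
      unfolding curvature_def arclength_deriv_def[of x ?g] using m by measurable
    show "AE u in circle. (curvature x u)\<^sup>2 * norm (d1 x u) = (norm (d2 x u))\<^sup>2"
      using unit_speed_AE[OF x] weak_deriv_AE_eq[OF w]
      by eventually_elim (simp add: curvature_def arclength_deriv_def[of x ?g])
  qed measurable
  then show ?thesis by (simp add: bending_energy_def)
qed

text \<open>
  Here \<open>V\<close> is the perturbed velocity, \<open>V'\<close> its derivative, and the left-hand side compares the
  derivative of \<open>V / \<bar>V\<bar>\<close> with \<open>V'\<close>. The orthogonality assumptions are the constraints \<open>\<bar>T\<bar> = 1\<close>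
  and \<open>T \<bullet> H = 0\<close> and their derivatives. They remove every first-order term from \<open>\<bar>V\<bar>\<close> and from
  \<open>V \<bullet> V'\<close>.
\<close>

lemma normalization_derivative_bound:
  fixes T H p q d :: "'a::euclidean_space"
  assumes T: "norm T = 1" and TH: "T \<bullet> H = 0" and Tp: "T \<bullet> p = 0" and Tq: "T \<bullet> q + H \<bullet> p = 0"
    and H: "norm H \<le> B" and d: "norm d \<le> K * t\<^sup>2" and t: "0 < t" "t \<le> 1"
    and w: "norm (t *\<^sub>R H - d) \<le> t * (B + 1)"
  defines "V \<equiv> T + (t *\<^sub>R H - d)" and "V' \<equiv> p + t *\<^sub>R q"
  assumes V: "1 / 2 \<le> norm V"
  shows "norm ((- (1 / (2 * (V \<bullet> V) * sqrt (V \<bullet> V))) * (V' \<bullet> V + V \<bullet> V')) *\<^sub>R V + (1 / sqrt (V \<bullet> V)) *\<^sub>R V' - V')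
    \<le> (4 * (B + K) + 4 * K + 2 * (B + 1)\<^sup>2) * t\<^sup>2 * (norm p + norm q)"
proof -
  define n where "n = norm V"
  have n: "n \<ge> 1 / 2" using V by (simp add: n_def)
  have n0: "n > 0" using n by linarith
  have VV: "V \<bullet> V = n\<^sup>2" "sqrt (V \<bullet> V) = n"
    by (simp_all add: n_def dot_square_norm)
  have B0: "B \<ge> 0" using order_trans[OF norm_ge_zero H] .
  have "K * t\<^sup>2 \<ge> 0" using order_trans[OF norm_ge_zero d] .
  then have K0: "K \<ge> 0" using t by (simp add: zero_le_mult_iff)
  define P where "P = norm p + norm q"
  have V'P: "norm V' \<le> P"
  proof -
    have "norm V' \<le> norm p + t * norm q"
      unfolding V'_def using norm_triangle_ineq[of p "t *\<^sub>R q"] t by simp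
    also have "t * norm q \<le> 1 * norm q" using t by (intro mult_right_mono) auto
    finally show ?thesis by (simp add: P_def)
  qed
  have "V \<bullet> V' = T \<bullet> p + t * (T \<bullet> q + H \<bullet> p) + t\<^sup>2 * (H \<bullet> q) - d \<bullet> V'"
    unfolding V_def V'_def by (simp add: inner_add inner_diff power2_eq_square algebra_simps)
  then have VV': "V \<bullet> V' = t\<^sup>2 * (H \<bullet> q) - d \<bullet> V'" using Tp Tq by simp
  have "\<bar>t\<^sup>2 * (H \<bullet> q)\<bar> \<le> t\<^sup>2 * (B * P)"
  proof -
    have "\<bar>H \<bullet> q\<bar> \<le> norm H * norm q" by (rule Cauchy_Schwarz_ineq2)
    also have "\<dots> \<le> B * P" using H B0 by (intro mult_mono) (auto simp: P_def)
    finally show ?thesis unfolding abs_mult by (intro mult_mono) auto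
  qed
  moreover have "\<bar>d \<bullet> V'\<bar> \<le> K * t\<^sup>2 * P"
  proof -
    have "\<bar>d \<bullet> V'\<bar> \<le> norm d * norm V'" by (rule Cauchy_Schwarz_ineq2)
    also have "\<dots> \<le> K * t\<^sup>2 * P" using d V'P K0 t by (intro mult_mono) auto
    finally show ?thesis .
  qed
  ultimately have k: "\<bar>V \<bullet> V'\<bar> \<le> (B + K) * t\<^sup>2 * P"
    unfolding VV' using abs_triangle_ineq4[of "t\<^sup>2 * (H \<bullet> q)" "d \<bullet> V'"] by (simp add: algebra_simps)
  have first: "norm ((- (1 / (2 * n\<^sup>2 * n)) * (V' \<bullet> V + V \<bullet> V')) *\<^sub>R V) \<le> 4 * ((B + K) * t\<^sup>2 * P)"
  proof -
    have "norm ((- (1 / (2 * n\<^sup>2 * n)) * (V' \<bullet> V + V \<bullet> V')) *\<^sub>R V) = \<bar>V \<bullet> V'\<bar> / n\<^sup>2"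
      using n0 by (simp add: inner_commute[of V'] n_def[symmetric] abs_mult power2_eq_square field_simps)
    also have "\<dots> \<le> \<bar>V \<bullet> V'\<bar> / (1 / 2)\<^sup>2"
      using n by (intro divide_left_mono power_mono mult_pos_pos) auto
    also have "\<dots> = 4 * \<bar>V \<bullet> V'\<bar>" by (simp add: power2_eq_square)
    also have "\<dots> \<le> 4 * ((B + K) * t\<^sup>2 * P)" using k by simp
    finally show ?thesis .
  qed
  have rho: "\<bar>1 / n - 1\<bar> \<le> (4 * K + 2 * (B + 1)\<^sup>2) * t\<^sup>2"
  proof -
    have "n\<^sup>2 - 1 = (norm (t *\<^sub>R H - d))\<^sup>2 - 2 * (T \<bullet> d)"
      unfolding n_def V_def using T TH
      by (simp add: power2_norm_eq_inner inner_add inner_diff inner_commute norm_eq_1 algebra_simps)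
    then have "\<bar>n\<^sup>2 - 1\<bar> \<le> (norm (t *\<^sub>R H - d))\<^sup>2 + 2 * \<bar>T \<bullet> d\<bar>"
      using abs_triangle_ineq4[of "(norm (t *\<^sub>R H - d))\<^sup>2" "2 * (T \<bullet> d)"] by (simp add: abs_mult)
    also have "\<dots> \<le> (t * (B + 1))\<^sup>2 + 2 * (K * t\<^sup>2)"
      using w Cauchy_Schwarz_ineq2[of T d] T d by (intro add_mono power_mono) auto
    finally have n2: "\<bar>n\<^sup>2 - 1\<bar> \<le> (t * (B + 1))\<^sup>2 + 2 * (K * t\<^sup>2)" .
    have "\<bar>1 / n - 1\<bar> = \<bar>n - 1\<bar> * (1 / n)"
      using n0 by (simp add: field_simps abs_divide[symmetric] abs_minus_commute)
    also have "\<dots> \<le> \<bar>n - 1\<bar> * 2"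
      using n0 divide_left_mono[OF n, of 1] by (intro mult_left_mono) auto
    also have "\<bar>n - 1\<bar> * 2 \<le> 2 * \<bar>n\<^sup>2 - 1\<bar>"
    proof -
      have "n\<^sup>2 - 1 = (n - 1) * (n + 1)" by (simp add: power2_eq_square algebra_simps)
      then have "\<bar>n\<^sup>2 - 1\<bar> = \<bar>n - 1\<bar> * (n + 1)" using n0 by (simp add: abs_mult)
      moreover have "\<bar>n - 1\<bar> * 1 \<le> \<bar>n - 1\<bar> * (n + 1)" using n0 by (intro mult_left_mono) auto
      ultimately have "\<bar>n - 1\<bar> \<le> \<bar>n\<^sup>2 - 1\<bar>" by (simp only: mult_1_right)
      then show ?thesis by simp
    qed
    also have "\<dots> \<le> 2 * ((t * (B + 1))\<^sup>2 + 2 * (K * t\<^sup>2))" using n2 by simp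
    also have "\<dots> = (4 * K + 2 * (B + 1)\<^sup>2) * t\<^sup>2"
      unfolding power_mult_distrib by (simp add: algebra_simps)
    finally show ?thesis .
  qed
  have "norm ((1 / n - 1) *\<^sub>R V') \<le> (4 * K + 2 * (B + 1)\<^sup>2) * t\<^sup>2 * P"
    unfolding norm_scaleR using rho V'P K0 by (intro mult_mono) auto
  then have "norm ((- (1 / (2 * n\<^sup>2 * n)) * (V' \<bullet> V + V \<bullet> V')) *\<^sub>R V + (1 / n - 1) *\<^sub>R V')
      \<le> 4 * ((B + K) * t\<^sup>2 * P) + (4 * K + 2 * (B + 1)\<^sup>2) * t\<^sup>2 * P"
    using first by (intro order_trans[OF norm_triangle_ineq add_mono])
  also have "\<dots> = (4 * (B + K) + 4 * K + 2 * (B + 1)\<^sup>2) * t\<^sup>2 * P" by (simp add: algebra_simps)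
  finally show ?thesis unfolding VV(2) unfolding VV(1) by (simp add: P_def scaleR_diff_left add_diff_eq)
qed

lemma L2_sq_le_bound:
  assumes "f \<in> borel_measurable circle" "\<And>s. s \<in> {0..<1} \<Longrightarrow> norm (f s) \<le> B"
  shows "L2_sq f \<le> B\<^sup>2"
proof -
  have le: "(norm (f s))\<^sup>2 \<le> B\<^sup>2" if "s \<in> {0..<1}" for s
    using assms(2)[OF that] by (intro power_mono) auto
  have "L2_sq f \<le> (LINT s|circle. B\<^sup>2)"
    unfolding L2_sq_def
  proof (rule Bochner_Integration.integral_mono)
    show "integrable circle (\<lambda>s. (norm (f s))\<^sup>2)"
      using assms(1) le by (intro circle.integrable_const_bound[of _ "B\<^sup>2"]) auto
  qed (use le in auto)
  then show ?thesis by (simp add: measure_circle_space)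
qed

lemma primitive_norm_le:
  assumes F: "is_primitive F f" and F0: "F 0 = 0" and B: "\<And>s. s \<in> {0..<1} \<Longrightarrow> norm (f s) \<le> B"
    and u: "u \<in> {0..1}"
  shows "norm (F u) \<le> B"
proof -
  have B0: "B \<ge> 0" using order_trans[OF norm_ge_zero B[of 0]] by simp
  have A: "{0..<u} \<in> sets circle" using u by (intro interval_in_sets_circle) auto
  have "norm (F u - F 0) \<le> (LINT s:{0..<u}|circle. norm (f s))"
    using u by (intro is_primitive_increment_le[OF F]) auto
  also have "\<dots> \<le> (LINT s:{0..<u}|circle. B)"
    by (rule set_integral_mono_circle[OF _ _ A]) (use is_primitiveD(2)[OF F] B u in auto)
  also have "\<dots> = u * B"
    using set_integral_const_circle[OF A, of B] measure_circle_interval[of 0 u] u by simp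
  also have "\<dots> \<le> B" using u B0 by (simp add: mult_left_le_one_le)
  finally show ?thesis using F0 by simp
qed

lemma bilipschitz_perturb:
  assumes c: "bilipschitz c x" and near: "\<And>s. s \<in> {0..1} \<Longrightarrow> norm (velocity y s - velocity x s) \<le> c / 2"
  shows "bilipschitz (c / 2) y"
  unfolding bilipschitz_def
proof (intro ballI)
  fix u v :: real assume uv: "u \<in> {0..<1}" "v \<in> {0..<1}"
  note A = arc_sets[OF uv]
  let ?e = "\<lambda>s. fun_of y s - fun_of x s"
  have e: "is_primitive ?e (\<lambda>s. velocity y s - velocity x s)" "?e 0 = ?e 1"
    by (intro is_primitive_diff fun_of_primitive) (simp add: fun_of_ends)
  have "norm (?e v - ?e u) = norm (LINT s:short_arc u v|circle. velocity y s - velocity x s)"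
    unfolding arc_increment[OF e uv] by simp
  also have "\<dots> \<le> (LINT s:short_arc u v|circle. norm (velocity y s - velocity x s))"
    by (rule set_integral_norm_bound_circle[OF is_primitiveD(2)[OF e(1)] A])
  also have "\<dots> \<le> (LINT s:short_arc u v|circle. c / 2)"
    by (rule set_integral_mono_circle[OF _ _ A])
       (use is_primitiveD(2)[OF e(1)] near arc_subset[OF uv] in force)+
  also have "\<dots> = circle_dist u v * (c / 2)"
    using set_integral_const_circle[OF A, of "c / 2"] measure_arc[OF uv] by simp
  finally have "norm (?e v - ?e u) \<le> circle_dist u v * (c / 2)" .
  moreover have "c * circle_dist u v \<le> norm (fun_of x u - fun_of x v)" using c uv by (simp add: bilipschitz_def)
  moreover have "fun_of x u - fun_of x v = (?e v - ?e u) + (fun_of y u - fun_of y v)" by simp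
  then have "norm (fun_of x u - fun_of x v) \<le> norm (?e v - ?e u) + norm (fun_of y u - fun_of y v)"
    by (metis norm_triangle_ineq)
  ultimately show "c / 2 * circle_dist u v \<le> norm (fun_of y u - fun_of y v)" by (simp add: algebra_simps)
qed

lemma arclength_curvesI:
  assumes "bilipschitz c y" "c > 0" "unit_speed y" "fun_of y 0 = z"
  shows "y \<in> arclength_curves z"
  using bilipschitz_inj[OF assms(1,2)] unit_speed_AE[OF assms(3)] assms(4)
  by (simp add: arclength_curves_def)

lemma normalized_curve:
  fixes x h :: "'a::euclidean_space H2" and d :: 'a and t :: real
  defines "V \<equiv> \<lambda>s. velocity x s + (t *\<^sub>R velocity h s - d)"
    and "V' \<equiv> \<lambda>s. d2 x s + t *\<^sub>R d2 h s"
  assumes V: "\<And>s. s \<in> {0..1} \<Longrightarrow> V s \<noteq> 0" and closed: "(LINT s|circle. V s /\<^sub>R norm (V s)) = 0"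
  obtains y where "fun_of y 0 = z" "unit_speed y" "\<And>s. s \<in> {0..1} \<Longrightarrow> velocity y s = V s /\<^sub>R norm (V s)"
    "AE s in circle. d2 y s = (- (1 / (2 * (V s \<bullet> V s) * sqrt (V s \<bullet> V s))) * (V' s \<bullet> V s + V s \<bullet> V' s)) *\<^sub>R V s
        + (1 / sqrt (V s \<bullet> V s)) *\<^sub>R V' s"
proof -
  have pV: "is_primitive V V'"
  proof -
    have "is_primitive V (\<lambda>s. d2 x s + (t *\<^sub>R d2 h s - 0))"
      unfolding V_def
      by (intro is_primitive_add is_primitive_diff is_primitive_scaleR is_primitive_const velocity_primitive)
    then show ?thesis by (simp add: V'_def)
  qed
  have pq: "is_primitive (\<lambda>s. V s \<bullet> V s) (\<lambda>s. V' s \<bullet> V s + V s \<bullet> V' s)"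
    by (rule is_primitive_inner[OF pV pV])
  have pos: "z > 0" if "z \<in> (\<lambda>s. V s \<bullet> V s) ` {0..1}" for z using that V by auto
  have pr: "is_primitive (\<lambda>s. 1 / sqrt (V s \<bullet> V s))
      (\<lambda>s. - (1 / (2 * (V s \<bullet> V s) * sqrt (V s \<bullet> V s))) * (V' s \<bullet> V s + V s \<bullet> V' s))"
  proof (rule is_primitive_chain[OF pq, where \<phi> = "\<lambda>z. 1 / sqrt z" and \<phi>' = "\<lambda>z. - (1 / (2 * z * sqrt z))"])
    fix z assume "z \<in> (\<lambda>s. V s \<bullet> V s) ` {0..1}"
    from pos[OF this] show "((\<lambda>z. 1 / sqrt z) has_real_derivative - (1 / (2 * z * sqrt z))) (at z)"
      by (auto intro!: derivative_eq_intros simp: field_simps)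
  next
    show "continuous_on ((\<lambda>s. V s \<bullet> V s) ` {0..1}) (\<lambda>z. - (1 / (2 * z * sqrt z)))"
      using pos by (intro continuous_intros) fastforce
  qed
  define Y where "Y s = (1 / sqrt (V s \<bullet> V s)) *\<^sub>R V s" for s
  have Y: "Y s = V s /\<^sub>R norm (V s)" for s
    by (simp add: Y_def norm_eq_sqrt_inner inverse_eq_divide)
  have pY: "is_primitive Y (\<lambda>s. (- (1 / (2 * (V s \<bullet> V s) * sqrt (V s \<bullet> V s))) * (V' s \<bullet> V s + V s \<bullet> V' s)) *\<^sub>R V s
        + (1 / sqrt (V s \<bullet> V s)) *\<^sub>R V' s)"
    unfolding Y_def by (rule is_primitive_scaleR_fun[OF pr pV])
  have "V 0 = V 1" by (simp add: V_def velocity_ends)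
  then have ends: "Y 0 = Y 1" by (simp add: Y_def)
  obtain y where y: "fun_of y 0 = z" "\<And>u. u \<in> {0..1} \<Longrightarrow> velocity y u = Y u"
    "AE s in circle. d2 y s = (- (1 / (2 * (V s \<bullet> V s) * sqrt (V s \<bullet> V s))) * (V' s \<bullet> V s + V s \<bullet> V' s)) *\<^sub>R V s
        + (1 / sqrt (V s \<bullet> V s)) *\<^sub>R V' s"
    using H2_from_velocity[OF pY ends, of z] closed by (auto simp: Y)
  show thesis
  proof (rule that[OF y(1) _ _ y(3)])
    show "unit_speed y" using V by (simp add: unit_speed_def y(2) Y)
    show "velocity y s = V s /\<^sub>R norm (V s)" if "s \<in> {0..1}" for s using y(2)[OF that] by (simp add: Y)
  qed
qed

text \<open>
  The derivative along the manifold is only accessible through points of the manifold, so each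
  tangent vector is realized by explicit nearby curves: perturb the velocity, close it up by a
  constant, normalize. Such curves stay injective because the bilipschitz property persists
  under small perturbations of the velocity.
\<close>

lemma tangent_curve:
  fixes x h :: "'a::euclidean_space H2"
  assumes xM: "x \<in> arclength_curves z" and h: "h \<in> arclength_tangent x"
    and c: "bilipschitz c x" "c > 0"
  obtains C t0 where "C \<ge> 0" "t0 > 0"
    "\<And>t. 0 < t \<Longrightarrow> t \<le> t0 \<Longrightarrow> \<exists>y\<in>arclength_curves z. bilipschitz (c / 2) y \<and> norm (y - x - t *\<^sub>R h) \<le> C * t\<^sup>2 \<and>
        (\<forall>s\<in>{0..1}. norm (velocity y s - velocity x s - t *\<^sub>R velocity h s) \<le> C * t\<^sup>2)"
proof -
  have x: "unit_speed x" by (rule arclength_curves_unit_speed[OF xM])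
  obtain a where a: "a > 0"
    "\<And>d. a * (norm d)\<^sup>2 \<le> (norm d)\<^sup>2 - (LINT s|circle. (velocity x s \<bullet> d)\<^sup>2)"
    using coercivity[OF L2_sq_nonneg[of "d2 x"], where 'a = 'a] x by (metis order.refl)
  obtain B where B: "B > 0" "\<And>s. s \<in> {0..1} \<Longrightarrow> norm (velocity h s) \<le> B"
    using continuous_on_unit_interval_bounded[OF velocity_continuous] by blast
  define K where "K = 4 * (B + 1)\<^sup>2 / a"
  have K: "K > 0" using a(1) B(1) by (simp add: K_def)
  define C1 where "C1 = 2 * K + 4 * (B + 1)\<^sup>2"
  define C2 where "C2 = 4 * (B + K) + 4 * K + 2 * (B + 1)\<^sup>2"
  define Q where "Q = L2_sq (\<lambda>s. norm (d2 x s) + norm (d2 h s))"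
  \<comment> \<open>two contributions of order zero and one, bounded by \<open>C1\<close>, and one of order two, bounded by \<open>C2\<close>\<close>
  define C where "C = sqrt (2 * C1\<^sup>2 + C2\<^sup>2 * Q)"
  have C1: "C1 > 0" using K by (simp add: C1_def add_pos_nonneg)
  have C2: "C2 > 0" using K B(1) unfolding C2_def by (intro add_pos_nonneg) auto
  have Q: "Q \<ge> 0" unfolding Q_def by (rule L2_sq_nonneg)
  have C1C: "C1 \<le> C" unfolding C_def using Q C1 by (intro real_le_rsqrt) auto
  \<comment> \<open>the bounds ensure, in this order: perturbations of size at most 1/4, room for the fixed point, \<open>t \<le> 1\<close>, and preservation of the bilipschitz property\<close>
  define t0 where "t0 = min (1 / (4 * (B + 1))) (min (1 / K) (min 1 (c / (2 * (B + C1)))))"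
  show thesis
  proof (rule that)
    show "C \<ge> 0" using C1 C1C by simp
    show "t0 > 0" using B(1) K C1 c(2) by (simp add: t0_def)
    fix t :: real assume t: "0 < t" "t \<le> t0"
    have t1: "t * (B + 1) \<le> 1 / 4" "K * t \<le> 1" "t \<le> 1" "t * (B + C1) \<le> c / 2"
      using t B(1) K C1 by (auto simp: t0_def field_simps)
    obtain d where d: "norm d \<le> K * t\<^sup>2"
      "(LINT s|circle. (velocity x s + (t *\<^sub>R velocity h s - d)) /\<^sub>R norm (velocity x s + (t *\<^sub>R velocity h s - d))) = 0"
      using closing_translation[OF x h a less_imp_le[OF B(1)] B(2) K_def t(1) t1(1,2)] by blast
    define V where "V s = velocity x s + (t *\<^sub>R velocity h s - d)" for s
    define V' where "V' s = d2 x s + t *\<^sub>R d2 h s" for s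
    have Kt: "K * t\<^sup>2 \<le> t" using mult_right_mono[OF t1(2), of t] t(1) by (simp add: power2_eq_square mult.assoc)
    have T1: "norm (velocity x s) = 1" if "s \<in> {0..1}" for s using x that by (simp add: unit_speed_def)
    have w: "norm (t *\<^sub>R velocity h s - d) \<le> t * (B + 1)" if "s \<in> {0..1}" for s
    proof -
      have "norm (t *\<^sub>R velocity h s - d) \<le> norm (t *\<^sub>R velocity h s) + norm d" by (rule norm_triangle_ineq4)
      also have "\<dots> \<le> t * B + t"
        using t(1) B(2)[OF that] d(1) Kt by (intro add_mono) (auto intro: mult_left_mono)
      finally show ?thesis by (simp add: distrib_left)
    qed
    have Vge: "1 / 2 \<le> norm (V s)" if "s \<in> {0..1}" for s
      unfolding V_def using w[OF that] t1(1) T1[OF that] norm_diff_ineq[of "velocity x s" "t *\<^sub>R velocity h s - d"]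
      by linarith
    have V0: "V s \<noteq> 0" if "s \<in> {0..1}" for s using Vge[OF that] by force
    obtain y where y: "fun_of y 0 = z" "unit_speed y" "\<And>s. s \<in> {0..1} \<Longrightarrow> velocity y s = V s /\<^sub>R norm (V s)"
      "AE s in circle. d2 y s = (- (1 / (2 * (V s \<bullet> V s) * sqrt (V s \<bullet> V s))) * (V' s \<bullet> V s + V s \<bullet> V' s)) *\<^sub>R V s
        + (1 / sqrt (V s \<bullet> V s)) *\<^sub>R V' s"
      using normalized_curve[of x t h d z] V0 d(2) unfolding V_def V'_def by blast
    have vel: "norm (velocity y s - velocity x s - t *\<^sub>R velocity h s) \<le> C1 * t\<^sup>2" if s: "s \<in> {0..1}" for s
    proof -
      let ?T = "velocity x s" and ?w = "t *\<^sub>R velocity h s - d"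
      have "?T \<bullet> ?w = - (?T \<bullet> d)" using tangent_velocity(1)[OF h s] by (simp add: inner_diff_right)
      then have "velocity y s - velocity x s - t *\<^sub>R velocity h s
          = (V s /\<^sub>R norm (V s) - (?T + ?w - (?T \<bullet> ?w) *\<^sub>R ?T)) + ((?T \<bullet> d) *\<^sub>R ?T - d)"
        by (simp add: y(3)[OF s])
      also have "norm \<dots> \<le> norm (V s /\<^sub>R norm (V s) - (?T + ?w - (?T \<bullet> ?w) *\<^sub>R ?T)) + norm ((?T \<bullet> d) *\<^sub>R ?T - d)"
        by (rule norm_triangle_ineq)
      also have "norm (V s /\<^sub>R norm (V s) - (?T + ?w - (?T \<bullet> ?w) *\<^sub>R ?T)) \<le> 4 * (norm ?w)\<^sup>2"
        using normalization_expansion[OF T1[OF s], of ?w] V0[OF s] unfolding V_def by blast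
      also have "\<dots> \<le> 4 * (t * (B + 1))\<^sup>2" using w[OF s] by (intro mult_left_mono power_mono) auto
      also have "norm ((?T \<bullet> d) *\<^sub>R ?T - d) \<le> norm d + norm d"
        using norm_triangle_ineq4[of "(?T \<bullet> d) *\<^sub>R ?T" d] Cauchy_Schwarz_ineq2[of ?T d] T1[OF s] by simp
      also have "\<dots> \<le> K * t\<^sup>2 + K * t\<^sup>2" using d(1) by simp
      finally show ?thesis unfolding C1_def power_mult_distrib by (simp add: algebra_simps)
    qed
    have near: "norm (velocity y s - velocity x s) \<le> c / 2" if s: "s \<in> {0..1}" for s
    proof -
      have "norm (velocity y s - velocity x s) \<le> norm (velocity y s - velocity x s - t *\<^sub>R velocity h s) + norm (t *\<^sub>R velocity h s)"
        using norm_triangle_ineq[of "velocity y s - velocity x s - t *\<^sub>R velocity h s" "t *\<^sub>R velocity h s"] by simp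
      also have "\<dots> \<le> C1 * t\<^sup>2 + t * B"
        using vel[OF s] B(2)[OF s] t(1) by (intro add_mono) (auto intro: mult_left_mono)
      also have "C1 * t\<^sup>2 \<le> C1 * t" using C1 t(1) t1(3) by (intro mult_left_mono) (auto simp: power2_eq_square mult_left_le)
      finally show ?thesis using t1(4) by (simp add: algebra_simps)
    qed
    have bil: "bilipschitz (c / 2) y" by (rule bilipschitz_perturb[OF c(1) near])
    have yM: "y \<in> arclength_curves z" by (rule arclength_curvesI[OF bil _ y(2,1)]) (use c in simp)
    define e where "e = y - x - t *\<^sub>R h"
    have ve: "norm (velocity e s) \<le> C1 * t\<^sup>2" if "s \<in> {0..<1}" for s
      using vel[of s] that by (simp add: e_def velocity_diff velocity_scaleR)
    have e0: "fun_of e 0 = 0"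
      using xM y(1) tangent_velocity(3)[OF h]
      by (simp add: e_def fun_of_diff scaleR_H2.rep_eq arclength_curves_def)
    have fe: "norm (fun_of e s) \<le> C1 * t\<^sup>2" if "s \<in> {0..<1}" for s
      by (rule primitive_norm_le[OF fun_of_primitive e0 ve]) (use that in auto)
    have d2e: "AE s in circle. norm (d2 e s) \<le> C2 * t\<^sup>2 * (norm (d2 x s) + norm (d2 h s))"
      using d2_diff[of "y - x" "t *\<^sub>R h"] d2_diff[of y x] d_scaleR(2)[of t h] y(4)
        unit_speed_velocity_ortho[OF x] tangent_velocity(2)[OF h] AE_space
    proof eventually_elim
      case (elim s)
      have s: "s \<in> {0..1}" using elim(7) by simp
      have "d2 e s = d2 y s - V' s" using elim(1-3) by (simp add: e_def V'_def)
      then show ?case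
        using normalization_derivative_bound[OF T1[OF s] tangent_velocity(1)[OF h s] elim(5,6) B(2)[OF s] d(1)
            t(1) t1(3) w[OF s] Vge[OF s, unfolded V_def]]
        unfolding elim(4) V_def V'_def C2_def by simp
    qed
    have "L2_sq (d2 e) \<le> (C2 * t\<^sup>2)\<^sup>2 * Q"
    proof -
      have i: "integrable circle (\<lambda>s. (norm (d2 x s) + norm (d2 h s))\<^sup>2)"
      proof -
        have "sq_integrable (\<lambda>s. norm (d2 x s))" "sq_integrable (\<lambda>s. norm (d2 h s))"
          using H2_derivs(5) by (auto simp: sq_integrable_def)
        from sq_integrable_norm_sq[OF sq_integrable_add[OF this]] show ?thesis by simp
      qed
      have "L2_sq (d2 e) \<le> (LINT s|circle. (C2 * t\<^sup>2)\<^sup>2 * (norm (d2 x s) + norm (d2 h s))\<^sup>2)"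
        unfolding L2_sq_def
      proof (rule integral_mono_AE)
        show "integrable circle (\<lambda>s. (norm (d2 e s))\<^sup>2)" by (rule d2_sq_integrable_norm)
        show "integrable circle (\<lambda>s. (C2 * t\<^sup>2)\<^sup>2 * (norm (d2 x s) + norm (d2 h s))\<^sup>2)" using i by simp
        show "AE s in circle. (norm (d2 e s))\<^sup>2 \<le> (C2 * t\<^sup>2)\<^sup>2 * (norm (d2 x s) + norm (d2 h s))\<^sup>2"
          using d2e by eventually_elim (metis norm_ge_zero power_mono power_mult_distrib)
      qed
      then show ?thesis by (simp add: Q_def L2_sq_def)
    qed
    moreover have "L2_sq (fun_of e) \<le> (C1 * t\<^sup>2)\<^sup>2" "L2_sq (velocity e) \<le> (C1 * t\<^sup>2)\<^sup>2"
      by (intro L2_sq_le_bound fe ve is_primitive_measurable[OF fun_of_primitive]; assumption)+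
    ultimately have "(norm e)\<^sup>2 \<le> (2 * C1\<^sup>2 + C2\<^sup>2 * Q) * (t\<^sup>2)\<^sup>2"
      by (simp add: norm_H2_sq power_mult_distrib algebra_simps)
    also have "\<dots> = (C * t\<^sup>2)\<^sup>2" using Q by (simp add: C_def power_mult_distrib)
    finally have ne: "norm e \<le> C * t\<^sup>2"
      by (rule power2_le_imp_le) (use C1 C1C in simp)
    have "C1 * t\<^sup>2 \<le> C * t\<^sup>2" using C1C by (intro mult_right_mono) auto
    then have "\<forall>s\<in>{0..1}. norm (velocity y s - velocity x s - t *\<^sub>R velocity h s) \<le> C * t\<^sup>2"
      using vel by force
    then show "\<exists>y\<in>arclength_curves z. bilipschitz (c / 2) y \<and> norm (y - x - t *\<^sub>R h) \<le> C * t\<^sup>2 \<and>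
        (\<forall>s\<in>{0..1}. norm (velocity y s - velocity x s - t *\<^sub>R velocity h s) \<le> C * t\<^sup>2)"
      using yM bil ne unfolding e_def by blast
  qed
qed

section \<open>The first variation\<close>

lemma difference_quotient_along_curve:
  fixes f :: "'a::real_normed_vector \<Rightarrow> real"
  assumes D: "(f has_derivative D) (at x within M)" and y: "\<And>n. y n \<in> M"
    and \<tau>: "\<And>n. \<tau> n > 0" and lim: "(\<lambda>n. (1 / \<tau> n) *\<^sub>R (y n - x)) \<longlonglongrightarrow> h" and y0: "y \<longlonglongrightarrow> x"
  shows "(\<lambda>n. (f (y n) - f x) / \<tau> n) \<longlonglongrightarrow> D h"
proof -
  have bD: "bounded_linear D" using D by (simp add: has_derivative_within_alt)
  define R where "R n = (1 / \<tau> n) *\<^sub>R (y n - x)" for n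
  obtain B where B: "B > 0" "\<And>n. norm (R n) \<le> B"
    using convergent_imp_Bseq[OF convergentI[OF lim]] unfolding R_def Bseq_def by blast
  have "(\<lambda>n. (f (y n) - f x) / \<tau> n - D (R n)) \<longlonglongrightarrow> 0"
  proof (rule LIMSEQ_I)
    fix e :: real assume "e > 0"
    then have "e / (2 * B) > 0" using B by simp
    then obtain d where d: "d > 0"
      "\<And>z. z \<in> M \<Longrightarrow> norm (z - x) < d \<Longrightarrow> norm (f z - f x - D (z - x)) \<le> e / (2 * B) * norm (z - x)"
      using D unfolding has_derivative_within_alt by blast
    obtain N where N: "\<And>n. n \<ge> N \<Longrightarrow> norm (y n - x) < d" using LIMSEQ_D[OF y0 d(1)] by blast
    have "norm ((f (y n) - f x) / \<tau> n - D (R n) - 0) < e" if "n \<ge> N" for n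
    proof -
      have "D (R n) = D (y n - x) / \<tau> n"
        unfolding R_def using linear_scale[OF bounded_linear.linear[OF bD]] by simp
      then have "norm ((f (y n) - f x) / \<tau> n - D (R n)) = norm (f (y n) - f x - D (y n - x)) / \<tau> n"
        using \<tau>[of n] by (simp add: abs_divide flip: diff_divide_distrib)
      also have "\<dots> \<le> e / (2 * B) * norm (y n - x) / \<tau> n"
        using d(2)[OF y N[OF that]] \<tau>[of n] by (intro divide_right_mono) auto
      also have "\<dots> = e / (2 * B) * norm (R n)" using \<tau>[of n] by (simp add: R_def)
      also have "\<dots> \<le> e / (2 * B) * B" using B \<open>e > 0\<close> by (intro mult_left_mono) auto
      also have "\<dots> < e" using B \<open>e > 0\<close> by simp
      finally show ?thesis by simp
    qed
    then show "\<exists>N. \<forall>n\<ge>N. norm ((f (y n) - f x) / \<tau> n - D (R n) - 0) < e" by blast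
  qed
  moreover have "(\<lambda>n. D (R n)) \<longlonglongrightarrow> D h"
    using bounded_linear.tendsto[OF bD lim] by (simp add: R_def)
  ultimately show ?thesis using tendsto_add by fastforce
qed

lemma L2_sq_sum_le:
  assumes "sq_integrable f" "sq_integrable g"
  shows "L2_sq (\<lambda>s. f s + g s) \<le> 2 * L2_sq f + 2 * L2_sq g"
proof -
  have "L2_sq (\<lambda>s. f s + g s) \<le> (LINT s|circle. 2 * (norm (f s))\<^sup>2 + 2 * (norm (g s))\<^sup>2)"
    unfolding L2_sq_def
  proof (rule Bochner_Integration.integral_mono)
    show "integrable circle (\<lambda>s. (norm (f s + g s))\<^sup>2)"
      by (rule sq_integrable_norm_sq[OF sq_integrable_add[OF assms]])
    show "integrable circle (\<lambda>s. 2 * (norm (f s))\<^sup>2 + 2 * (norm (g s))\<^sup>2)"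
      using sq_integrable_norm_sq[OF assms(1)] sq_integrable_norm_sq[OF assms(2)] by simp
    fix s
    have "(norm (f s + g s))\<^sup>2 \<le> (norm (f s) + norm (g s))\<^sup>2"
      by (intro power_mono norm_triangle_ineq) auto
    also have "\<dots> \<le> 2 * (norm (f s))\<^sup>2 + 2 * (norm (g s))\<^sup>2"
      using sum_squares_bound[of "norm (f s)" "norm (g s)"] by (simp add: power2_sum)
    finally show "(norm (f s + g s))\<^sup>2 \<le> 2 * (norm (f s))\<^sup>2 + 2 * (norm (g s))\<^sup>2" .
  qed
  then show ?thesis
    using sq_integrable_norm_sq[OF assms(1)] sq_integrable_norm_sq[OF assms(2)] by (simp add: L2_sq_def)
qed

lemma bilipschitz_mono: "bilipschitz c x \<Longrightarrow> c' \<le> c \<Longrightarrow> bilipschitz c' x"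
  unfolding bilipschitz_def by (meson circle_dist_bounds(1) mult_right_mono order_trans)

text \<open>
  Along curves tangent to \<open>h\<close> the difference quotients of the total energy tend to \<open>D h\<close> and
  those of the bending energy to its first variation. What remains is the difference quotient of
  the Moebius energy, which \<open>moebius_energy_difference_le\<close> bounds in the limit.
\<close>

lemma first_variation_bound:
  fixes x h :: "'a::euclidean_space H2"
  assumes Ck: "Ck \<ge> 0" "\<And>s. s \<in> {0..<1} \<Longrightarrow> (\<integral>\<^sup>+u. ennreal (riesz_kernel u s) \<partial>circle) \<le> ennreal Ck"
    and xM: "x \<in> arclength_curves z" and h: "h \<in> arclength_tangent x"
    and c: "bilipschitz c x" "c > 0"
    and D: "(total_energy \<theta> has_derivative D) (at x within arclength_curves z)"
    and \<theta>: "\<theta> > 0" and \<delta>: "\<delta> > 0" and \<beta>: "\<And>s. s \<in> {0..1} \<Longrightarrow> norm (velocity h s) \<le> \<beta>"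
  shows "\<bar>d2_form x h\<bar> \<le> \<bar>D h\<bar> + \<theta> * (sqrt \<delta> / (2 * (c / 2) ^ 4) * (Ck\<^sup>2 * ((norm h)\<^sup>2 + 8 * L2_sq (d2 x)))
      + 2 * \<beta> / ((c / 2) ^ 4 * \<delta>\<^sup>2))"
proof -
  define S where "S = arclength_curves z"
  have x: "unit_speed x" by (rule arclength_curves_unit_speed[OF xM])
  obtain C t0 where C: "C \<ge> 0" "t0 > 0"
    "\<And>t. 0 < t \<Longrightarrow> t \<le> t0 \<Longrightarrow> \<exists>y\<in>S. bilipschitz (c / 2) y \<and> norm (y - x - t *\<^sub>R h) \<le> C * t\<^sup>2 \<and>
        (\<forall>s\<in>{0..1}. norm (velocity y s - velocity x s - t *\<^sub>R velocity h s) \<le> C * t\<^sup>2)"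
    using tangent_curve[OF xM h c] unfolding S_def by blast
  define \<tau> where "\<tau> n = t0 * inverse (real (Suc n))" for n
  have \<tau>: "0 < \<tau> n" "\<tau> n \<le> t0" for n
    using C(2) by (auto simp: \<tau>_def inverse_le_1_iff intro!: mult_left_le)
  have \<tau>0: "\<tau> \<longlonglongrightarrow> 0"
    unfolding \<tau>_def using tendsto_mult_right_zero[OF LIMSEQ_inverse_real_of_nat] by simp
  have "\<exists>y. \<forall>n. y n \<in> S \<and> bilipschitz (c / 2) (y n) \<and> norm (y n - x - \<tau> n *\<^sub>R h) \<le> C * (\<tau> n)\<^sup>2 \<and>
        (\<forall>s\<in>{0..1}. norm (velocity (y n) s - velocity x s - \<tau> n *\<^sub>R velocity h s) \<le> C * (\<tau> n)\<^sup>2)"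
    using C(3)[OF \<tau>] by (intro choice) blast
  then obtain y where y: "\<And>n. y n \<in> S" "\<And>n. bilipschitz (c / 2) (y n)"
    "\<And>n. norm (y n - x - \<tau> n *\<^sub>R h) \<le> C * (\<tau> n)\<^sup>2"
    "\<And>n s. s \<in> {0..1} \<Longrightarrow> norm (velocity (y n) s - velocity x s - \<tau> n *\<^sub>R velocity h s) \<le> C * (\<tau> n)\<^sup>2"
    by blast
  have yu: "unit_speed (y n)" for n
    using y(1)[of n] arclength_curves_unit_speed unfolding S_def by blast
  have dist: "norm (y n - x) \<le> \<tau> n * (norm h + C * \<tau> n)" for n
  proof -
    have "norm (y n - x) \<le> norm (y n - x - \<tau> n *\<^sub>R h) + norm (\<tau> n *\<^sub>R h)"
      using norm_triangle_ineq[of "y n - x - \<tau> n *\<^sub>R h" "\<tau> n *\<^sub>R h"] by simp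
    also have "\<dots> \<le> C * (\<tau> n)\<^sup>2 + \<tau> n * norm h" using y(3)[of n] \<tau>(1)[of n] by simp
    finally show ?thesis by (simp add: power2_eq_square algebra_simps)
  qed
  have yx: "y \<longlonglongrightarrow> x"
  proof (rule LIM_zero_cancel, rule Lim_null_comparison)
    show "eventually (\<lambda>n. norm (y n - x) \<le> \<tau> n * (norm h + C * \<tau> n)) sequentially" using dist by simp
    show "(\<lambda>n. \<tau> n * (norm h + C * \<tau> n)) \<longlonglongrightarrow> 0"
      by (rule tendsto_eq_intros \<tau>0 refl | simp)+
  qed
  have quot: "(\<lambda>n. (1 / \<tau> n) *\<^sub>R (y n - x)) \<longlonglongrightarrow> h"
  proof (rule LIM_zero_cancel, rule Lim_null_comparison)
    show "eventually (\<lambda>n. norm ((1 / \<tau> n) *\<^sub>R (y n - x) - h) \<le> C * \<tau> n) sequentially"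
    proof (rule always_eventually, rule allI)
      fix n
      have "(1 / \<tau> n) *\<^sub>R (y n - x) - h = (1 / \<tau> n) *\<^sub>R (y n - x - \<tau> n *\<^sub>R h)"
        using \<tau>(1)[of n] by (simp add: scaleR_diff_right)
      then have "norm ((1 / \<tau> n) *\<^sub>R (y n - x) - h) = norm (y n - x - \<tau> n *\<^sub>R h) / \<tau> n"
        using \<tau>(1)[of n] by simp
      also have "\<dots> \<le> C * (\<tau> n)\<^sup>2 / \<tau> n" using y(3)[of n] \<tau>(1)[of n] by (intro divide_right_mono) auto
      also have "\<dots> = C * \<tau> n" using \<tau>(1)[of n] by (simp add: power2_eq_square)
      finally show "norm ((1 / \<tau> n) *\<^sub>R (y n - x) - h) \<le> C * \<tau> n" .
    qed
    show "(\<lambda>n. C * \<tau> n) \<longlonglongrightarrow> 0" using tendsto_mult_right_zero[OF \<tau>0] by simp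
  qed
  have Elim: "(\<lambda>n. (total_energy \<theta> (y n) - total_energy \<theta> x) / \<tau> n) \<longlonglongrightarrow> D h"
    using difference_quotient_along_curve[OF D _ \<tau>(1) quot yx] y(1) unfolding S_def by blast
  have blim: "(\<lambda>n. (bending_energy (y n) - bending_energy x) / \<tau> n) \<longlonglongrightarrow> d2_form x h"
  proof -
    have eq: "(bending_energy (y n) - bending_energy x) / \<tau> n
        = 1 / 2 * d2_form ((1 / \<tau> n) *\<^sub>R (y n - x)) (y n + x)" for n
    proof -
      have "d2_form (y n - x) (y n + x) = d2_form (y n) (y n) - d2_form x x"
        unfolding d2_form.diff_left d2_form.add_right d2_form_commute[of x "y n"] by simp
      then show ?thesis
        unfolding bending_energy_unit_speed[OF yu] bending_energy_unit_speed[OF x] d2_form_self[symmetric]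
          d2_form.scaleR_left by (simp add: diff_divide_distrib)
    qed
    have "1 / 2 * d2_form h (x + x) = d2_form x h"
      by (simp add: d2_form.add_right d2_form_commute[of h])
    moreover have "(\<lambda>n. 1 / 2 * d2_form ((1 / \<tau> n) *\<^sub>R (y n - x)) (y n + x)) \<longlonglongrightarrow> 1 / 2 * d2_form h (x + x)"
      by (intro tendsto_mult tendsto_const d2_form.tendsto quot tendsto_add yx)
    ultimately show ?thesis unfolding eq by simp
  qed
  define L where "L = L2_sq (d2 x)"
  define R where "R n = sqrt \<delta> / (2 * (c / 2) ^ 4) * (Ck\<^sup>2 * ((norm h + C * \<tau> n)\<^sup>2 + (2 * (\<tau> n)\<^sup>2 * (norm h + C * \<tau> n)\<^sup>2 + 8 * L)))
      + 2 * (\<beta> + C * \<tau> n) / ((c / 2) ^ 4 * \<delta>\<^sup>2)" for n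
  have Mle: "\<bar>moebius_energy (y n) - moebius_energy x\<bar> / \<tau> n \<le> R n" for n
  proof -
    define t where "t = \<tau> n"
    have t: "t > 0" using \<tau> by (simp add: t_def)
    let ?P = "L2_sq (\<lambda>s. d2 (y n) s - d2 x s)" and ?Q = "L2_sq (\<lambda>s. d2 (y n) s + d2 x s)"
    have "?P = L2_sq (d2 (y n - x))"
      by (rule L2_sq_cong_AE) (use d2_diff[of "y n" x] in \<open>auto simp: eq_commute\<close>)
    also have "\<dots> \<le> (norm (y n - x))\<^sup>2" by (rule L2_sq_d2_le_norm)
    also have "\<dots> \<le> (t * (norm h + C * t))\<^sup>2" using dist[of n] by (intro power_mono) (auto simp: t_def)
    finally have P: "?P \<le> t\<^sup>2 * (norm h + C * t)\<^sup>2" by (simp only: power_mult_distrib)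
    have "?Q = L2_sq (\<lambda>s. (d2 (y n) s - d2 x s) + 2 *\<^sub>R d2 x s)"
      by (simp add: scaleR_2 algebra_simps)
    also have "\<dots> \<le> 2 * ?P + 2 * L2_sq (\<lambda>s. 2 *\<^sub>R d2 x s)"
      using sq_integrable_add[OF H2_derivs(5)[of "y n"] sq_integrable_scaleR[OF H2_derivs(5)[of x], of "-1"]]
      by (intro L2_sq_sum_le sq_integrable_scaleR H2_derivs) simp
    also have "L2_sq (\<lambda>s. 2 *\<^sub>R d2 x s) = 4 * L" by (simp add: L_def L2_sq_def power_mult_distrib)
    finally have Q: "?Q \<le> 2 * (t\<^sup>2 * (norm h + C * t)\<^sup>2) + 8 * L" using P by linarith
    have B: "norm (velocity (y n) s - velocity x s) \<le> t * \<beta> + C * t\<^sup>2" if s: "s \<in> {0..1}" for s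
    proof -
      have "norm (velocity (y n) s - velocity x s)
          \<le> norm (velocity (y n) s - velocity x s - t *\<^sub>R velocity h s) + norm (t *\<^sub>R velocity h s)"
        using norm_triangle_ineq[of "velocity (y n) s - velocity x s - t *\<^sub>R velocity h s" "t *\<^sub>R velocity h s"] by simp
      also have "\<dots> \<le> C * t\<^sup>2 + t * \<beta>"
        using y(4)[OF s, of n] \<beta>[OF s] t unfolding t_def by (intro add_mono) (auto intro: mult_left_mono)
      finally show ?thesis by simp
    qed
    have c2: "c / 2 > 0" using c by simp
    \<comment> \<open>the weight \<open>l = 1 / t\<close> makes both terms proportional to \<open>t\<close>\<close>
    have "\<bar>moebius_energy (y n) - moebius_energy x\<bar>
        \<le> sqrt \<delta> / (2 * (c / 2) ^ 4) * (Ck\<^sup>2 * (1 / t * ?P + ?Q / (1 / t))) + 2 * (t * \<beta> + C * t\<^sup>2) / ((c / 2) ^ 4 * \<delta>\<^sup>2)"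
      by (rule moebius_energy_difference_le[OF Ck x bilipschitz_mono[OF c(1)] yu y(2) c2 _ \<delta> B])
         (use c t in auto)
    also have "\<dots> \<le> sqrt \<delta> / (2 * (c / 2) ^ 4) * (Ck\<^sup>2 * (1 / t * (t\<^sup>2 * (norm h + C * t)\<^sup>2)
          + (2 * (t\<^sup>2 * (norm h + C * t)\<^sup>2) + 8 * L) / (1 / t))) + 2 * (t * \<beta> + C * t\<^sup>2) / ((c / 2) ^ 4 * \<delta>\<^sup>2)"
      using P Q t c \<delta> by (intro add_right_mono mult_left_mono add_mono divide_right_mono) auto
    also have "\<dots> = t * R n"
      using t c \<delta> unfolding R_def t_def[symmetric] by (simp add: power2_eq_square field_simps)
    finally show ?thesis using t by (simp add: t_def pos_divide_le_eq mult.commute)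
  qed
  have "(\<lambda>n. \<bar>(total_energy \<theta> (y n) - total_energy \<theta> x) / \<tau> n
      - (bending_energy (y n) - bending_energy x) / \<tau> n\<bar>) \<longlonglongrightarrow> \<bar>D h - d2_form x h\<bar>"
    by (intro tendsto_rabs tendsto_diff Elim blim)
  moreover have "(\<lambda>n. \<theta> * R n) \<longlonglongrightarrow> \<theta> * (sqrt \<delta> / (2 * (c / 2) ^ 4) * (Ck\<^sup>2 * ((norm h + C * 0)\<^sup>2 + (2 * 0\<^sup>2 * (norm h + C * 0)\<^sup>2 + 8 * L)))
      + 2 * (\<beta> + C * 0) / ((c / 2) ^ 4 * \<delta>\<^sup>2))"
    unfolding R_def using c \<delta> by (intro tendsto_intros \<tau>0) auto
  moreover have "\<bar>(total_energy \<theta> (y n) - total_energy \<theta> x) / \<tau> n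
      - (bending_energy (y n) - bending_energy x) / \<tau> n\<bar> \<le> \<theta> * R n" for n
  proof -
    have "(total_energy \<theta> (y n) - total_energy \<theta> x) / \<tau> n - (bending_energy (y n) - bending_energy x) / \<tau> n
        = \<theta> * ((moebius_energy (y n) - moebius_energy x) / \<tau> n)"
      using \<tau>(1)[of n] by (simp add: total_energy_def field_simps)
    also have "\<bar>\<dots>\<bar> = \<theta> * (\<bar>moebius_energy (y n) - moebius_energy x\<bar> / \<tau> n)"
      using \<theta> \<tau>(1)[of n] by (simp add: abs_mult)
    also have "\<dots> \<le> \<theta> * R n" using Mle[of n] \<theta> by (intro mult_left_mono) auto
    finally show ?thesis .
  qed
  ultimately have "\<bar>D h - d2_form x h\<bar> \<le> \<theta> * (sqrt \<delta> / (2 * (c / 2) ^ 4) * (Ck\<^sup>2 * ((norm h + C * 0)\<^sup>2 + (2 * 0\<^sup>2 * (norm h + C * 0)\<^sup>2 + 8 * L)))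
      + 2 * (\<beta> + C * 0) / ((c / 2) ^ 4 * \<delta>\<^sup>2))"
    by (intro LIMSEQ_le) blast+
  then show ?thesis by (simp add: L_def)
qed

section \<open>Testing with the difference of two curves\<close>

text \<open>
  The difference \<open>x - y\<close> is made tangent at \<open>x\<close> by projecting its derivative and correcting the
  mean. When the velocities are uniformly close the correction is small, and since \<open>x''\<close> is
  orthogonal to the velocity, the projection hardly affects the pairing with \<open>x''\<close>, although the
  second derivatives of \<open>x\<close> and \<open>y\<close> need not be close.
\<close>

lemma tangent_test_field:
  fixes x y :: "'a::euclidean_space H2"
  assumes x: "unit_speed x" and y: "unit_speed y"
    and K: "L2_sq (d2 x) \<le> K" "L2_sq (d2 y) \<le> K"
    and a: "a > 0" "\<And>d. a * (norm d)\<^sup>2 \<le> (norm d)\<^sup>2 - (LINT s|circle. (velocity x s \<bullet> d)\<^sup>2)"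
    and e: "\<And>s. s \<in> {0..1} \<Longrightarrow> norm (velocity x s - velocity y s) \<le> e" and e2: "e \<le> 2"
  defines "b \<equiv> 1 + 2 / a"
  obtains h where "h \<in> arclength_tangent x" "\<And>s. s \<in> {0..1} \<Longrightarrow> norm (velocity h s) \<le> 2 * b * e"
    "(norm h)\<^sup>2 \<le> 32 * b\<^sup>2 + (2 * (2 + 4 * b)\<^sup>2 + 8) * K"
    "\<bar>d2_form x h - d2_form x (x - y)\<bar> \<le> b * e * L2_sq (d2 x)"
proof -
  let ?T = "velocity x" and ?U = "\<lambda>s. velocity x s - velocity y s"
  have e0: "e \<ge> 0" using order_trans[OF norm_ge_zero e[of 0]] by simp
  have b: "b \<ge> 1" using a(1) by (simp add: b_def)
  have T1: "norm (?T s) = 1" if "s \<in> {0..1}" for s using x that by (simp add: unit_speed_def)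
  have proj: "norm (v - (?T s \<bullet> v) *\<^sub>R ?T s) \<le> 2 * norm v" if "s \<in> {0..1}" for v s
    using norm_triangle_ineq4[of v "(?T s \<bullet> v) *\<^sub>R ?T s"] Cauchy_Schwarz_ineq2[of "?T s" v] T1[OF that] by simp
  obtain G where G: "linear G" "\<And>v. projected_mean x (G v) = v" "\<And>v. norm (G v) \<le> norm v / a"
    using coercive_right_inverse[OF projected_mean_linear a(1)] a(2) unfolding projected_mean_inner by blast
  \<comment> \<open>the mean of the projected difference, to be cancelled by the projection of a constant\<close>
  define m where "m = (LINT s|circle. ?U s - (?T s \<bullet> ?U s) *\<^sub>R ?T s)"
  have iU: "integrable circle (\<lambda>s. ?U s - (?T s \<bullet> ?U s) *\<^sub>R ?T s)"
    by (intro integrable_continuous_circle continuous_intros velocity_continuous)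
  have m: "norm m \<le> 2 * e"
    unfolding m_def
  proof (rule integral_circle_norm_le[OF iU])
    fix s :: real assume "s \<in> {0..<1}"
    then have s: "s \<in> {0..1}" by simp
    show "norm (?U s - (?T s \<bullet> ?U s) *\<^sub>R ?T s) \<le> 2 * e" using proj[OF s, of "?U s"] e[OF s] by linarith
  qed
  define d where "d = G m"
  have d: "norm d \<le> 2 / a * e"
    using G(3)[of m] m a(1) unfolding d_def by (simp add: pos_le_divide_eq pos_divide_le_eq)
  define v where "v s = ?U s - d" for s
  define v' where "v' s = d2 x s - d2 y s" for s
  have v: "norm (v s) \<le> b * e" if "s \<in> {0..1}" for s
    using norm_triangle_ineq4[of "?U s" d] e[OF that] d by (simp add: v_def b_def distrib_right)
  have pv: "is_primitive v v'"
    using is_primitive_diff[OF is_primitive_diff[OF velocity_primitive velocity_primitive] is_primitive_const, of x y d]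
    by (simp add: v_def[abs_def] v'_def[abs_def])
  define H where "H s = v s - (?T s \<bullet> v s) *\<^sub>R ?T s" for s
  define H' where "H' s = v' s - ((d2 x s \<bullet> v s + ?T s \<bullet> v' s) *\<^sub>R ?T s + (?T s \<bullet> v s) *\<^sub>R d2 x s)" for s
  have pH: "is_primitive H H'"
    unfolding H_def H'_def
    by (intro is_primitive_diff pv is_primitive_scaleR_fun is_primitive_inner velocity_primitive)
  have ends: "H 0 = H 1" by (simp add: H_def v_def velocity_ends)
  have closed: "(LINT s|circle. H s) = 0"
  proof -
    have "(LINT s|circle. H s) = (LINT s|circle. (?U s - (?T s \<bullet> ?U s) *\<^sub>R ?T s) - (d - (?T s \<bullet> d) *\<^sub>R ?T s))"
      by (intro Bochner_Integration.integral_cong) (auto simp: H_def v_def inner_diff_right scaleR_diff_left)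
    also have "\<dots> = m - projected_mean x d"
      unfolding m_def projected_mean_def
      by (rule Bochner_Integration.integral_diff[OF iU projection_integrable])
    also have "\<dots> = 0" by (simp add: d_def G(2))
    finally show ?thesis .
  qed
  obtain h where h: "fun_of h 0 = 0" "\<And>s. s \<in> {0..1} \<Longrightarrow> velocity h s = H s"
    "AE s in circle. d1 h s = H s" "AE s in circle. d2 h s = H' s"
    using H2_from_velocity[OF pH ends closed] by blast
  have Hb: "norm (H s) \<le> 2 * b * e" if s: "s \<in> {0..1}" for s
    using proj[OF s, of "v s"] v[OF s] by (simp add: H_def)
  have be: "b * e \<le> 2 * b" using e2 b by simp
  have hT: "h \<in> arclength_tangent x"
  proof -
    have "AE s in circle. d1 x s \<bullet> d1 h s = 0"
      using velocity_AE[of x] h(3) AE_space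
    proof eventually_elim
      case (elim s)
      then have "?T s \<bullet> ?T s = 1" using T1[of s] by (simp add: dot_square_norm)
      then show ?case using elim by (simp add: H_def inner_diff_right)
    qed
    then show ?thesis using h(1) by (simp add: arclength_tangent_def)
  qed
  have vh: "norm (velocity h s) \<le> 4 * b" if "s \<in> {0..<1}" for s
    using Hb[of s] h(2)[of s] be that by simp
  have fh: "norm (fun_of h s) \<le> 4 * b" if "s \<in> {0..<1}" for s
    by (rule primitive_norm_le[OF fun_of_primitive h(1) vh]) (use that in auto)
  have d2h: "AE s in circle. norm (d2 h s) \<le> norm ((2 + 4 * b) * norm (d2 x s) + 2 * norm (d2 y s))"
    using h(4) AE_space
  proof eventually_elim
    case (elim s)
    then have s: "s \<in> {0..1}" by simp
    let ?p = "d2 x s"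
    have Tv: "\<bar>?T s \<bullet> w\<bar> \<le> norm w" for w using Cauchy_Schwarz_ineq2[of "?T s" w] T1[OF s] by simp
    have pv': "\<bar>?p \<bullet> v s\<bar> \<le> norm ?p * (b * e)"
      using order_trans[OF Cauchy_Schwarz_ineq2[of ?p "v s"] mult_left_mono[OF v[OF s] norm_ge_zero]] .
    have "norm (H' s) \<le> norm (v' s) + (norm ((?p \<bullet> v s + ?T s \<bullet> v' s) *\<^sub>R ?T s) + norm ((?T s \<bullet> v s) *\<^sub>R ?p))"
      unfolding H'_def by (intro order_trans[OF norm_triangle_ineq4] add_left_mono norm_triangle_ineq)
    also have "\<dots> \<le> norm (v' s) + ((norm ?p * (b * e) + norm (v' s)) + (b * e) * norm ?p)"
    proof (intro add_left_mono add_mono)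
      show "norm ((?p \<bullet> v s + ?T s \<bullet> v' s) *\<^sub>R ?T s) \<le> norm ?p * (b * e) + norm (v' s)"
        using pv' Tv[of "v' s"] T1[OF s] abs_triangle_ineq[of "?p \<bullet> v s" "?T s \<bullet> v' s"] by simp
      show "norm ((?T s \<bullet> v s) *\<^sub>R ?p) \<le> (b * e) * norm ?p"
        using order_trans[OF Tv v[OF s]] by (simp add: mult_right_mono)
    qed
    also have "\<dots> = 2 * norm (v' s) + 2 * (b * e) * norm ?p" by simp
    also have "\<dots> \<le> 2 * (norm ?p + norm (d2 y s)) + 2 * (2 * b) * norm ?p"
      using be by (intro add_mono mult_left_mono mult_right_mono) (auto simp: v'_def norm_triangle_ineq4)
    also have "\<dots> = (2 + 4 * b) * norm ?p + 2 * norm (d2 y s)" by (simp add: algebra_simps)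
    also have "\<dots> = norm \<dots>" using b by simp
    finally show ?case using elim by simp
  qed
  have nx: "sq_integrable (\<lambda>s. (2 + 4 * b) * norm (d2 x s))" and ny: "sq_integrable (\<lambda>s. 2 * norm (d2 y s))"
  proof -
    have "sq_integrable (\<lambda>s. norm (d2 w s))" for w :: "'a H2"
      using H2_derivs(5)[of w] by (auto simp: sq_integrable_def)
    from sq_integrable_scaleR[OF this, of "2 + 4 * b" x] sq_integrable_scaleR[OF this, of 2 y]
    show "sq_integrable (\<lambda>s. (2 + 4 * b) * norm (d2 x s))" "sq_integrable (\<lambda>s. 2 * norm (d2 y s))" by simp_all
  qed
  have "L2_sq (d2 h) \<le> L2_sq (\<lambda>s. (2 + 4 * b) * norm (d2 x s) + 2 * norm (d2 y s))"
    unfolding L2_sq_def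
  proof (rule integral_mono_AE[OF d2_sq_integrable_norm sq_integrable_norm_sq[OF sq_integrable_add[OF nx ny]]])
    show "AE s in circle. (norm (d2 h s))\<^sup>2 \<le> (norm ((2 + 4 * b) * norm (d2 x s) + 2 * norm (d2 y s)))\<^sup>2"
      using d2h by eventually_elim (intro power_mono, auto)
  qed
  also have "\<dots> \<le> 2 * L2_sq (\<lambda>s. (2 + 4 * b) * norm (d2 x s)) + 2 * L2_sq (\<lambda>s. 2 * norm (d2 y s))"
    by (rule L2_sq_sum_le[OF nx ny])
  also have "\<dots> = 2 * ((2 + 4 * b)\<^sup>2 * L2_sq (d2 x)) + 2 * (4 * L2_sq (d2 y))"
    by (simp add: L2_sq_def abs_mult power_mult_distrib)
  also have "\<dots> \<le> 2 * ((2 + 4 * b)\<^sup>2 * K) + 2 * (4 * K)"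
    using K by (intro add_mono mult_left_mono) auto
  finally have "L2_sq (d2 h) \<le> 2 * ((2 + 4 * b)\<^sup>2 * K) + 2 * (4 * K)" .
  moreover have "L2_sq (fun_of h) \<le> (4 * b)\<^sup>2" "L2_sq (velocity h) \<le> (4 * b)\<^sup>2"
    by (intro L2_sq_le_bound fh vh is_primitive_measurable[OF fun_of_primitive]; assumption)+
  ultimately have nh: "(norm h)\<^sup>2 \<le> 32 * b\<^sup>2 + (2 * (2 + 4 * b)\<^sup>2 + 8) * K"
    unfolding norm_H2_sq power_mult_distrib[of 4 b] by (simp add: distrib_right)
  have form: "\<bar>d2_form x h - d2_form x (x - y)\<bar> \<le> b * e * L2_sq (d2 x)"
  proof -
    have "\<bar>d2_form x h - d2_form x (x - y)\<bar> = norm (LINT s|circle. d2 x s \<bullet> d2 h s - d2 x s \<bullet> d2 (x - y) s)"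
      unfolding d2_form_def using d2_inner_integrable[of x h] d2_inner_integrable[of x "x - y"] by simp
    also have "\<dots> \<le> (LINT s|circle. norm (d2 x s \<bullet> d2 h s - d2 x s \<bullet> d2 (x - y) s))"
      by (rule integral_norm_bound)
    also have "\<dots> \<le> (LINT s|circle. b * e * (norm (d2 x s))\<^sup>2)"
    proof (rule integral_mono_AE)
      show "integrable circle (\<lambda>s. norm (d2 x s \<bullet> d2 h s - d2 x s \<bullet> d2 (x - y) s))"
        using d2_inner_integrable[of x h] d2_inner_integrable[of x "x - y"] by simp
      show "integrable circle (\<lambda>s. b * e * (norm (d2 x s))\<^sup>2)"
        using d2_sq_integrable_norm[of x] by simp
      show "AE s in circle. norm (d2 x s \<bullet> d2 h s - d2 x s \<bullet> d2 (x - y) s) \<le> b * e * (norm (d2 x s))\<^sup>2"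
        using h(4) d2_diff[of x y] unit_speed_velocity_ortho[OF x] AE_space
      proof eventually_elim
        case (elim s)
        then have s: "s \<in> {0..1}" by simp
        have "d2 x s \<bullet> d2 h s - d2 x s \<bullet> d2 (x - y) s = - ((?T s \<bullet> v s) * (norm (d2 x s))\<^sup>2)"
          using elim(3) by (simp add: elim(1,2) H'_def v'_def inner_diff_right inner_add_right dot_square_norm
              inner_commute[of "d2 x s" "?T s"])
        moreover have "\<bar>?T s \<bullet> v s\<bar> \<le> b * e"
          using order_trans[OF Cauchy_Schwarz_ineq2[of "?T s" "v s"]] v[OF s] T1[OF s] by simp
        ultimately show ?case by (simp add: abs_mult mult_right_mono)
      qed
    qed
    finally show ?thesis by (simp add: L2_sq_def)
  qed
  show thesis by (rule that[OF hT _ nh form]) (use Hb h(2) in simp)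
qed

section \<open>Limits of arclength curves\<close>

lemma L1_le_L2:
  assumes "sq_integrable f"
  shows "(LINT s|circle. norm (f s)) \<le> sqrt (L2_sq f)"
proof (rule real_le_rsqrt)
  have A: "{0..<1} \<in> sets circle" using interval_in_sets_circle[of 0 1] by simp
  show "(LINT s|circle. norm (f s))\<^sup>2 \<le> L2_sq f"
    using Cauchy_Schwarz_set[OF assms A]
    by (simp add: set_integral_circle_full measure_circle_space L2_sq_def)
qed

lemma sq_integrable_diff:
  assumes "sq_integrable f" "sq_integrable g"
  shows "sq_integrable (\<lambda>s. f s - g s)"
  using sq_integrable_add[OF assms(1) sq_integrable_scaleR[OF assms(2), of "-1"]] by simp

text \<open>
  A subsequence converges almost everywhere because the sequence is Cauchy in \<open>L\<^sup>1\<close>, and Fatou's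
  lemma transfers the \<open>L\<^sup>2\<close> bounds to its limit.
\<close>

lemma L2_complete:
  fixes f :: "nat \<Rightarrow> real \<Rightarrow> 'a::euclidean_space"
  assumes f: "\<And>n. sq_integrable (f n)"
    and cau: "\<And>e. e > 0 \<Longrightarrow> \<exists>N. \<forall>i\<ge>N. \<forall>j\<ge>N. L2_sq (\<lambda>s. f i s - f j s) \<le> e"
  obtains p where "sq_integrable p" "\<And>e. e > 0 \<Longrightarrow> \<exists>N. \<forall>i\<ge>N. L2_sq (\<lambda>s. f i s - p s) \<le> e"
proof -
  have m [measurable]: "f n \<in> borel_measurable circle" for n using f by (simp add: sq_integrable_def)
  note sd = sq_integrable_diff[OF f f]
  obtain r where r: "strict_mono r" "AE s in circle. Cauchy (\<lambda>i. f (r i) s)"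
  proof (rule cauchy_L1_AE_cauchy_subseq)
    show "integrable circle (f n)" for n by (rule sq_integrable_imp_integrable[OF f])
    fix e :: real assume "e > 0"
    then have "(e / 2)\<^sup>2 > 0" by simp
    then obtain N where N: "\<And>i j. i \<ge> N \<Longrightarrow> j \<ge> N \<Longrightarrow> L2_sq (\<lambda>s. f i s - f j s) \<le> (e / 2)\<^sup>2"
      using cau by blast
    have "(LINT s|circle. norm (f i s - f j s)) < e" if "i \<ge> N" "j \<ge> N" for i j
    proof -
      have "(LINT s|circle. norm (f i s - f j s)) \<le> sqrt (L2_sq (\<lambda>s. f i s - f j s))"
        by (rule L1_le_L2[OF sd])
      also have "\<dots> \<le> sqrt ((e / 2)\<^sup>2)" using N[OF that] by (rule real_sqrt_le_mono)
      also have "\<dots> < e" using \<open>e > 0\<close> by simp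
      finally show ?thesis .
    qed
    then show "\<exists>N. \<forall>i\<ge>N. \<forall>j\<ge>N. (LINT s|circle. norm (f i s - f j s)) < e" by blast
  qed
  define p where "p s = lim (\<lambda>i. f (r i) s)" for s
  have pm [measurable]: "p \<in> borel_measurable circle"
    unfolding p_def by (rule borel_measurable_lim_metric) (rule m)
  have pl: "AE s in circle. (\<lambda>i. f (r i) s) \<longlonglongrightarrow> p s"
    using r(2) by eventually_elim (simp add: p_def Cauchy_convergent_iff convergent_LIMSEQ_iff)
  have est: "\<exists>N. \<forall>i\<ge>N. sq_integrable (\<lambda>s. f i s - p s) \<and> L2_sq (\<lambda>s. f i s - p s) \<le> e" if e: "e > 0" for e
  proof -
    obtain N where N: "\<And>i j. i \<ge> N \<Longrightarrow> j \<ge> N \<Longrightarrow> L2_sq (\<lambda>s. f i s - f j s) \<le> e" using cau[OF e] by blast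
    have "sq_integrable (\<lambda>s. f i s - p s) \<and> L2_sq (\<lambda>s. f i s - p s) \<le> e" if i: "i \<ge> N" for i
    proof -
      let ?u = "\<lambda>k s. ennreal ((norm (f i s - f (r k) s))\<^sup>2)"
      have "(\<integral>\<^sup>+s. ennreal ((norm (f i s - p s))\<^sup>2) \<partial>circle) = (\<integral>\<^sup>+s. liminf (\<lambda>k. ?u k s) \<partial>circle)"
      proof (rule nn_integral_cong_AE)
        show "AE s in circle. ennreal ((norm (f i s - p s))\<^sup>2) = liminf (\<lambda>k. ?u k s)"
          using pl
        proof eventually_elim
          case (elim s)
          have "(\<lambda>k. ?u k s) \<longlonglongrightarrow> ennreal ((norm (f i s - p s))\<^sup>2)"
            by (intro tendsto_ennrealI tendsto_power tendsto_norm tendsto_diff tendsto_const elim)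
          then show ?case by (rule lim_imp_Liminf[OF trivial_limit_sequentially, symmetric])
        qed
      qed
      also have "\<dots> \<le> liminf (\<lambda>k. \<integral>\<^sup>+s. ?u k s \<partial>circle)" by (rule nn_integral_liminf) measurable
      also have "\<dots> \<le> limsup (\<lambda>k. \<integral>\<^sup>+s. ?u k s \<partial>circle)" by (rule Liminf_le_Limsup) simp
      also have "\<dots> \<le> ennreal e"
      proof (rule Limsup_bounded)
        show "eventually (\<lambda>k. (\<integral>\<^sup>+s. ?u k s \<partial>circle) \<le> ennreal e) sequentially"
          using eventually_ge_at_top[of N]
        proof eventually_elim
          case (elim k)
          then have "r k \<ge> N" using seq_suble[OF r(1), of k] by linarith
          then have "L2_sq (\<lambda>s. f i s - f (r k) s) \<le> e" using N[OF i] by blast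
          then show ?case
            using nn_integral_eq_integral[OF sq_integrable_norm_sq[OF sd[of i "r k"]]]
            by (simp add: L2_sq_def ennreal_leI)
        qed
      qed
      finally have le: "(\<integral>\<^sup>+s. ennreal ((norm (f i s - p s))\<^sup>2) \<partial>circle) \<le> ennreal e" .
      have int: "integrable circle (\<lambda>s. (norm (f i s - p s))\<^sup>2)"
      proof (rule integrableI_bounded)
        show "(\<integral>\<^sup>+s. ennreal (norm ((norm (f i s - p s))\<^sup>2)) \<partial>circle) < \<infinity>"
          using le by (simp add: le_less_trans)
      qed measurable
      then have sq: "sq_integrable (\<lambda>s. f i s - p s)" by (simp add: sq_integrable_def)
      have "ennreal (L2_sq (\<lambda>s. f i s - p s)) \<le> ennreal e"
        using le nn_integral_eq_integral[OF int] by (simp add: L2_sq_def)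
      then show ?thesis using sq e by (simp add: ennreal_le_iff)
    qed
    then show ?thesis by blast
  qed
  obtain N where "sq_integrable (\<lambda>s. f N s - p s)" using est[of 1] by auto
  from sq_integrable_diff[OF f[of N] this] have "sq_integrable p" by simp
  moreover have "\<exists>N. \<forall>i\<ge>N. L2_sq (\<lambda>s. f i s - p s) \<le> e" if "e > 0" for e
    using est[OF that] by auto
  ultimately show thesis by (rule that)
qed

lemma primitive_limit:
  assumes x: "\<And>k. is_primitive (F k) (f k)" and lim: "\<And>s. s \<in> {0..1} \<Longrightarrow> (\<lambda>k. F k s) \<longlonglongrightarrow> g s"
    and p: "sq_integrable p" and L2: "\<And>e. e > 0 \<Longrightarrow> \<exists>N. \<forall>k\<ge>N. L2_sq (\<lambda>s. f k s - p s) \<le> e"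
  shows "is_primitive g p"
  unfolding is_primitive_def
proof (intro conjI allI impI p; elim conjE)
  fix u v :: real assume uv: "0 \<le> u" "u \<le> v" "v \<le> 1"
  then have A: "{u..<v} \<in> sets circle" by (intro interval_in_sets_circle)
  note ip = sq_integrable_imp_integrable[OF p] and if' = is_primitiveD(2)[OF x]
  have "(\<lambda>k. F k v - F k u) \<longlonglongrightarrow> (LINT s:{u..<v}|circle. p s)"
  proof (rule LIMSEQ_I)
    fix e :: real assume e: "e > 0"
    then have "(e / 2)\<^sup>2 > 0" by simp
    then obtain N where N: "\<And>k. k \<ge> N \<Longrightarrow> L2_sq (\<lambda>s. f k s - p s) \<le> (e / 2)\<^sup>2" using L2 by blast
    have "norm (F k v - F k u - (LINT s:{u..<v}|circle. p s)) < e" if k: "k \<ge> N" for k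
    proof -
      have sq: "sq_integrable (\<lambda>s. f k s - p s)" by (rule sq_integrable_diff[OF is_primitiveD(1)[OF x] p])
      note i = sq_integrable_imp_integrable[OF sq]
      have "F k v - F k u - (LINT s:{u..<v}|circle. p s) = (LINT s:{u..<v}|circle. f k s - p s)"
        using is_primitiveD(3)[OF x uv] set_integral_diff[OF set_integrable_circle[OF if' A] set_integrable_circle[OF ip A]]
        by simp
      also have "norm \<dots> \<le> (LINT s:{u..<v}|circle. norm (f k s - p s))"
        by (rule set_integral_norm_bound_circle[OF i A])
      also have "\<dots> \<le> (LINT s|circle. norm (f k s - p s))"
        by (rule set_integral_le_full[OF _ _ A]) (use i in auto)
      also have "\<dots> \<le> sqrt (L2_sq (\<lambda>s. f k s - p s))" by (rule L1_le_L2[OF sq])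
      also have "\<dots> \<le> sqrt ((e / 2)\<^sup>2)" using N[OF k] by (rule real_sqrt_le_mono)
      also have "\<dots> < e" using e by simp
      finally show ?thesis .
    qed
    then show "\<exists>N. \<forall>k\<ge>N. norm (F k v - F k u - (LINT s:{u..<v}|circle. p s)) < e" by blast
  qed
  moreover have "(\<lambda>k. F k v - F k u) \<longlonglongrightarrow> g v - g u" using uv by (intro tendsto_diff lim) auto
  ultimately show "g v - g u = (LINT s:{u..<v}|circle. p s)" using LIMSEQ_unique by blast
qed

text \<open>
  The uniform bilipschitz constant passes to the limit and keeps the limit curve injective:
  without it, the limit could leave the manifold through a self-contact.
\<close>

lemma arclength_curves_limit:
  fixes x :: "nat \<Rightarrow> 'a::euclidean_space H2"
  assumes xM: "\<And>k. x k \<in> arclength_curves z" and c: "c > 0" "\<And>k. bilipschitz c (x k)"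
    and unif: "\<And>e. e > 0 \<Longrightarrow> \<exists>N. \<forall>k\<ge>N. \<forall>s\<in>{0..1}. norm (velocity (x k) s - g s) < e"
    and cau: "\<And>e. e > 0 \<Longrightarrow> \<exists>N. \<forall>i\<ge>N. \<forall>j\<ge>N. L2_sq (\<lambda>s. d2 (x i) s - d2 (x j) s) \<le> e"
  obtains l where "l \<in> arclength_curves z" "x \<longlonglongrightarrow> l"
proof -
  obtain p where p: "sq_integrable p" "\<And>e. e > 0 \<Longrightarrow> \<exists>N. \<forall>k\<ge>N. L2_sq (\<lambda>s. d2 (x k) s - p s) \<le> e"
    using L2_complete[OF H2_derivs(5) cau] by blast
  have lim: "(\<lambda>k. velocity (x k) s) \<longlonglongrightarrow> g s" if "s \<in> {0..1}" for s
    using unif that by (intro LIMSEQ_I) blast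
  have gp: "is_primitive g p" by (rule primitive_limit[OF velocity_primitive lim p])
  have ends: "g 0 = g 1"
    using lim[of 0] lim[of 1] LIMSEQ_unique[of "\<lambda>k. velocity (x k) 0" "g 0" "g 1"] by (simp add: velocity_ends)
  have ig: "integrable circle g" by (rule integrable_continuous_circle[OF is_primitive_continuous[OF gp]])
  have iv: "integrable circle (velocity y)" for y :: "'a H2"
    by (rule integrable_continuous_circle[OF velocity_continuous])
  have "norm (LINT s|circle. g s) \<le> 0 + e" if e: "e > 0" for e
  proof -
    obtain k where k: "\<And>s. s \<in> {0..1} \<Longrightarrow> norm (velocity (x k) s - g s) < e" using unif[OF e] by blast
    have "norm (LINT s|circle. velocity (x k) s - g s) \<le> e"
      by (rule integral_circle_norm_le) (use iv ig k in \<open>auto simp: less_imp_le\<close>)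
    then show ?thesis using iv ig by (simp add: velocity_integral_zero)
  qed
  then have "norm (LINT s|circle. g s) \<le> 0" by (rule field_le_epsilon)
  then have closed: "(LINT s|circle. g s) = 0" by simp
  obtain l where l: "fun_of l 0 = z" "\<And>u. u \<in> {0..1} \<Longrightarrow> velocity l u = g u" "AE u in circle. d2 l u = p u"
    using H2_from_velocity[OF gp ends closed] by blast
  have vel: "norm (velocity (x k - l) s) \<le> e" "norm (fun_of (x k - l) s) \<le> e"
    if "\<And>s. s \<in> {0..1} \<Longrightarrow> norm (velocity (x k) s - g s) < e" "s \<in> {0..<1}" for k e s
  proof -
    have v: "norm (velocity (x k - l) s) \<le> e" if "s \<in> {0..<1}" for s
      using that \<open>\<And>s. s \<in> {0..1} \<Longrightarrow> norm (velocity (x k) s - g s) < e\<close>[of s]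
      by (simp add: velocity_diff l(2))
    then show "norm (velocity (x k - l) s) \<le> e" using that by blast
    have "fun_of (x k - l) 0 = 0" using xM[of k] l(1) by (simp add: fun_of_diff arclength_curves_def)
    then show "norm (fun_of (x k - l) s) \<le> e"
      using primitive_norm_le[OF fun_of_primitive _ v] that by simp
  qed
  have conv: "x \<longlonglongrightarrow> l"
  proof (rule LIMSEQ_I)
    fix e :: real assume e: "e > 0"
    then have e2: "e / 2 > 0" "(e / 2)\<^sup>2 > 0" by simp_all
    obtain N1 where N1: "\<And>k s. k \<ge> N1 \<Longrightarrow> s \<in> {0..1} \<Longrightarrow> norm (velocity (x k) s - g s) < e / 2"
      using unif[OF e2(1)] by blast
    obtain N2 where N2: "\<And>k. k \<ge> N2 \<Longrightarrow> L2_sq (\<lambda>s. d2 (x k) s - p s) \<le> (e / 2)\<^sup>2"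
      using p(2)[OF e2(2)] by blast
    have "norm (x k - l) < e" if k: "k \<ge> max N1 N2" for k
    proof -
      have k1: "norm (velocity (x k) s - g s) < e / 2" if "s \<in> {0..1}" for s using N1 k that by auto
      have "L2_sq (fun_of (x k - l)) \<le> (e / 2)\<^sup>2" "L2_sq (velocity (x k - l)) \<le> (e / 2)\<^sup>2"
        by (intro L2_sq_le_bound vel[OF k1] is_primitive_measurable[OF fun_of_primitive]; assumption)+
      moreover have "L2_sq (d2 (x k - l)) = L2_sq (\<lambda>s. d2 (x k) s - p s)"
      proof (rule L2_sq_cong_AE)
        show "AE s in circle. d2 (x k - l) s = d2 (x k) s - p s"
          using d2_diff[of "x k" l] l(3) by eventually_elim simp
      qed (use p(1) in \<open>auto simp: sq_integrable_def\<close>)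
      moreover have "L2_sq (\<lambda>s. d2 (x k) s - p s) \<le> (e / 2)\<^sup>2" using N2 k by simp
      ultimately have "(norm (x k - l))\<^sup>2 \<le> 3 * (e / 2)\<^sup>2" by (simp add: norm_H2_sq)
      also have "\<dots> < e\<^sup>2" using e by (simp add: power2_eq_square)
      finally show ?thesis using e by (simp add: power2_less_imp_less)
    qed
    then show "\<exists>N. \<forall>k\<ge>N. norm (x k - l) < e" by blast
  qed
  have lu: "unit_speed l"
    unfolding unit_speed_def
  proof
    fix s :: real assume s: "s \<in> {0..1}"
    have "(\<lambda>k. norm (velocity (x k) s)) \<longlonglongrightarrow> norm (velocity l s)"
      using tendsto_norm[OF lim[OF s]] l(2)[OF s] by simp
    moreover have "norm (velocity (x k) s) = 1" for k
      using arclength_curves_unit_speed[OF xM] s by (simp add: unit_speed_def)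
    ultimately show "norm (velocity l s) = 1" by (simp add: LIMSEQ_const_iff)
  qed
  have "bilipschitz c l"
    unfolding bilipschitz_def
  proof (intro ballI)
    fix u v :: real assume uv: "u \<in> {0..<1}" "v \<in> {0..<1}"
    have fl: "(\<lambda>k. fun_of (x k) s) \<longlonglongrightarrow> fun_of l s" if s: "s \<in> {0..<1}" for s
    proof (rule LIMSEQ_I)
      fix e :: real assume "e > 0"
      then have "e / 2 > 0" by simp
      then obtain N where N: "\<And>k s. k \<ge> N \<Longrightarrow> s \<in> {0..1} \<Longrightarrow> norm (velocity (x k) s - g s) < e / 2"
        using unif by blast
      have "norm (fun_of (x k) s - fun_of l s) < e" if "k \<ge> N" for k
        using vel(2)[OF N[OF that] s] \<open>e > 0\<close> by (simp add: fun_of_diff)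
      then show "\<exists>N. \<forall>k\<ge>N. norm (fun_of (x k) s - fun_of l s) < e" by blast
    qed
    have "(\<lambda>k. norm (fun_of (x k) u - fun_of (x k) v)) \<longlonglongrightarrow> norm (fun_of l u - fun_of l v)"
      by (intro tendsto_norm tendsto_diff fl uv)
    then show "c * circle_dist u v \<le> norm (fun_of l u - fun_of l v)"
      by (rule LIMSEQ_le_const) (use c(2) uv in \<open>auto simp: bilipschitz_def\<close>)
  qed
  then have "l \<in> arclength_curves z" by (rule arclength_curvesI[OF _ c(1) lu l(1)])
  then show thesis using that conv by blast
qed

section \<open>The Palais--Smale condition\<close>

text \<open>
  As \<open>D\<close> is bounded, the supremum is over a bounded set, to which \<open>h\<close> contributes after scaling
  to norm 1.
\<close>

lemma cotangent_norm_bound: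
  assumes D: "bounded_linear D" and h: "h \<in> V" and sc: "\<And>r h. h \<in> V \<Longrightarrow> r *\<^sub>R h \<in> V"
  shows "\<bar>D h\<bar> \<le> cotangent_norm V D * norm h"
proof (cases "h = 0")
  case True
  then show ?thesis using linear_0[OF bounded_linear.linear[OF D]] by simp
next
  case False
  obtain K where K: "\<And>h. norm (D h) \<le> norm h * K" "K > 0" using bounded_linear.pos_bounded[OF D] by blast
  let ?k = "(1 / norm h) *\<^sub>R h"
  have "\<bar>D ?k\<bar> \<le> cotangent_norm V D"
    unfolding cotangent_norm_def
  proof (rule cSUP_upper)
    show "?k \<in> {h \<in> V. norm h \<le> 1}" using sc[OF h] False by simp
    show "bdd_above ((\<lambda>h. \<bar>D h\<bar>) ` {h \<in> V. norm h \<le> 1})"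
    proof (rule bdd_aboveI2)
      fix w assume "w \<in> {h \<in> V. norm h \<le> 1}"
      then have "norm w * K \<le> 1 * K" using K(2) by (intro mult_right_mono) auto
      then show "\<bar>D w\<bar> \<le> K" using K(1)[of w] by simp
    qed
  qed
  moreover have "D ?k = D h / norm h" using linear_scale[OF bounded_linear.linear[OF D]] by simp
  ultimately show ?thesis using False by (simp add: abs_divide pos_divide_le_eq)
qed

lemma arclength_tangent_scaleR:
  assumes "h \<in> arclength_tangent x"
  shows "r *\<^sub>R h \<in> arclength_tangent x"
proof -
  have "AE u in circle. d1 x u \<bullet> d1 h u = 0" "fun_of h 0 = 0" using assms by (auto simp: arclength_tangent_def)
  then have "AE u in circle. d1 x u \<bullet> d1 (r *\<^sub>R h) u = 0"
    using d_scaleR(1)[of r h] by (auto elim: eventually_elim2)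
  then show ?thesis using \<open>fun_of h 0 = 0\<close> by (simp add: arclength_tangent_def scaleR_H2.rep_eq)
qed

lemma moebius_energy_nonneg:
  assumes "x \<in> arclength_curves z"
  shows "moebius_energy x \<ge> 0"
  unfolding moebius_energy_unit_speed[OF arclength_curves_unit_speed[OF assms]]
proof (intro Bochner_Integration.integral_nonneg_AE AE_I2)
  fix u v assume "u \<in> space circle" "v \<in> space circle"
  then show "0 \<le> moebius_integrand x u v"
    using assms arclength_curves_unit_speed[OF assms]
    by (intro moebius_integrand_nonneg) (auto simp: arclength_curves_def inj_on_def)
qed

text \<open>
  For \<open>x\<close> and \<open>y\<close> late in the sequence, \<open>\<parallel>x'' - y''\<parallel>\<^sup>2\<close> is the sum of the pairings of \<open>x''\<close> with
  \<open>x'' - y''\<close> and of \<open>y''\<close> with \<open>y'' - x''\<close>. Each is nearly the first variation of the bending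
  energy in a bounded tangent direction, which is small by the Palais--Smale property and the
  smallness of the Moebius part.
\<close>

lemma palais_smale_arclength:
  fixes z :: "'a::euclidean_space"
  assumes \<theta>: "\<theta> > 0"
  shows "palais_smale_condition (total_energy \<theta>) (arclength_curves z) arclength_tangent"
  unfolding palais_smale_condition_def
proof (intro allI impI)
  fix \<gamma> :: "nat \<Rightarrow> 'a H2"
  let ?M = "arclength_curves z"
  assume "palais_smale_seq (total_energy \<theta>) ?M arclength_tangent \<gamma>"
  then obtain D where \<gamma>M: "\<And>k. \<gamma> k \<in> ?M" and bdd: "bdd_above (range (\<lambda>k. total_energy \<theta> (\<gamma> k)))"
    and D: "\<And>k. (total_energy \<theta> has_derivative D k) (at (\<gamma> k) within ?M)"
    and D0: "(\<lambda>k. cotangent_norm (arclength_tangent (\<gamma> k)) (D k)) \<longlonglongrightarrow> 0"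
    unfolding palais_smale_seq_def by blast
  obtain E where E: "\<And>k. total_energy \<theta> (\<gamma> k) \<le> E" using bdd unfolding bdd_above_def by blast
  have us: "unit_speed (\<gamma> k)" for k by (rule arclength_curves_unit_speed[OF \<gamma>M])
  have E0: "E \<ge> 0"
    using E[of 0] mult_nonneg_nonneg[OF less_imp_le[OF \<theta>] moebius_energy_nonneg[OF \<gamma>M[of 0]]]
      L2_sq_nonneg[of "d2 (\<gamma> 0)"]
    by (simp add: total_energy_def bending_energy_unit_speed[OF us])
  define K where "K = 2 * E"
  have K0: "K \<ge> 0" using E0 by (simp add: K_def)
  have K: "L2_sq (d2 (\<gamma> k)) \<le> K" for k
    using E[of k] mult_nonneg_nonneg[OF less_imp_le[OF \<theta>] moebius_energy_nonneg[OF \<gamma>M[of k]]]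
    by (simp add: K_def total_energy_def bending_energy_unit_speed[OF us])
  have Mb: "moebius_energy (\<gamma> k) \<le> E / \<theta>" for k
  proof -
    have "\<theta> * moebius_energy (\<gamma> k) \<le> E"
      using E[of k] L2_sq_nonneg[of "d2 (\<gamma> k)"] by (simp add: total_energy_def bending_energy_unit_speed[OF us])
    then show ?thesis using \<theta> by (simp add: pos_le_divide_eq mult.commute)
  qed
  have "E / \<theta> \<ge> 0" using E0 \<theta> by simp
  from uniform_bilipschitz[OF K0 this, where 'a = 'a] obtain c where c: "c > 0"
    "\<And>x :: 'a H2. unit_speed x \<Longrightarrow> inj_on (fun_of x) {0..<1} \<Longrightarrow> L2_sq (d2 x) \<le> K \<Longrightarrow>
        moebius_energy x \<le> E / \<theta> \<Longrightarrow> bilipschitz c x" by blast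
  have bil: "bilipschitz c (\<gamma> k)" for k
    using c(2)[OF us _ K Mb] \<gamma>M[of k] by (simp add: arclength_curves_def)
  obtain a where a: "a > 0"
    "\<And>(x :: 'a H2) d. unit_speed x \<Longrightarrow> L2_sq (d2 x) \<le> K \<Longrightarrow>
        a * (norm d)\<^sup>2 \<le> (norm d)\<^sup>2 - (LINT s|circle. (velocity x s \<bullet> d)\<^sup>2)"
    using coercivity[OF K0, where 'a = 'a] by blast
  obtain Ck where Ck: "Ck \<ge> 0"
    "\<And>s. s \<in> {0..<1} \<Longrightarrow> (\<integral>\<^sup>+u. ennreal (riesz_kernel u s) \<partial>circle) \<le> ennreal Ck"
    using riesz_kernel_mass_bounded by blast
  obtain g r where r: "strict_mono (r :: nat \<Rightarrow> nat)"
    and unif: "\<And>e. 0 < e \<Longrightarrow> \<exists>N. \<forall>n s. n \<ge> N \<and> s \<in> {0..1} \<longrightarrow> norm (velocity (\<gamma> (r n)) s - g s) < e"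
  proof (rule Arzela_Ascoli[of "{0..1::real}" "\<lambda>k. velocity (\<gamma> k)" 1])
    show "norm (velocity (\<gamma> k) s) \<le> 1" if "s \<in> {0..1}" for k s
      using us[of k] that by (simp add: unit_speed_def)
    fix s e :: real assume s: "s \<in> {0..1}" and e: "0 < e"
    obtain d where d: "d > 0" "\<And>t. 0 \<le> t \<Longrightarrow> t < d \<Longrightarrow> sqrt t * sqrt K < e"
      using sqrt_modulus_small[OF e, of "sqrt K"] K0 by auto
    have "norm (velocity (\<gamma> k) s - velocity (\<gamma> k) y) < e" if "y \<in> {0..1}" "norm (s - y) < d" for k y
    proof -
      have "norm (velocity (\<gamma> k) s - velocity (\<gamma> k) y) \<le> sqrt \<bar>s - y\<bar> * sqrt (L2_sq (d2 (\<gamma> k)))"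
        by (rule is_primitive_holder[OF velocity_primitive that(1) s])
      also have "\<dots> \<le> sqrt \<bar>s - y\<bar> * sqrt K" using K by (intro mult_left_mono) auto
      also have "\<dots> < e" using d(2)[of "\<bar>s - y\<bar>"] that(2) by simp
      finally show ?thesis .
    qed
    then show "\<exists>d>0. \<forall>n y. y \<in> {0..1} \<and> norm (s - y) < d \<longrightarrow> norm (velocity (\<gamma> n) s - velocity (\<gamma> n) y) < e"
      using d(1) by blast
  qed auto
  define x where "x k = \<gamma> (r k)" for k
  define b where "b = 1 + 2 / a"
  have b: "b \<ge> 1" using a(1) by (simp add: b_def)
  define R where "R = sqrt (32 * b\<^sup>2 + (2 * (2 + 4 * b)\<^sup>2 + 8) * K)"
  have Rsq: "R\<^sup>2 = 32 * b\<^sup>2 + (2 * (2 + 4 * b)\<^sup>2 + 8) * K" using K0 by (simp add: R_def)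
  have R0: "R \<ge> 0" using K0 by (simp add: R_def)
  define A where "A = Ck\<^sup>2 * (R\<^sup>2 + 8 * K) / (2 * (c / 2) ^ 4)"
  have A: "A \<ge> 0" using K0 c(1) by (simp add: A_def)
  define cn where "cn k = cotangent_norm (arclength_tangent (x k)) (D (r k))" for k
  have cn0: "cn \<longlonglongrightarrow> 0"
    using LIMSEQ_subseq_LIMSEQ[OF D0 r] by (simp add: cn_def[abs_def] x_def o_def)
  have key: "\<bar>d2_form (x k) (x k - y)\<bar> \<le> \<bar>cn k\<bar> * R + \<theta> * (sqrt \<delta> * A + 4 * b * e / ((c / 2) ^ 4 * \<delta>\<^sup>2)) + b * e * K"
    if y: "unit_speed y" "L2_sq (d2 y) \<le> K" and \<delta>: "\<delta> > 0" and e: "e \<le> 2"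
      and near: "\<And>s. s \<in> {0..1} \<Longrightarrow> norm (velocity (x k) s - velocity y s) \<le> e" for k y \<delta> e
  proof -
    have xk: "unit_speed (x k)" "L2_sq (d2 (x k)) \<le> K" "bilipschitz c (x k)" "x k \<in> ?M"
      using us K bil \<gamma>M by (simp_all add: x_def)
    have e0: "e \<ge> 0" using order_trans[OF norm_ge_zero near[of 0]] by simp
    obtain h where h: "h \<in> arclength_tangent (x k)" "\<And>s. s \<in> {0..1} \<Longrightarrow> norm (velocity h s) \<le> 2 * b * e"
      "(norm h)\<^sup>2 \<le> R\<^sup>2" "\<bar>d2_form (x k) h - d2_form (x k) (x k - y)\<bar> \<le> b * e * L2_sq (d2 (x k))"
      using tangent_test_field[OF xk(1) y(1) xk(2) y(2) a(1) a(2)[OF xk(1,2)] near e] unfolding Rsq b_def by blast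
    have hR: "norm h \<le> R" using h(3) R0 by (rule power2_le_imp_le)
    have Dk: "(total_energy \<theta> has_derivative D (r k)) (at (x k) within ?M)" using D by (simp add: x_def)
    have "\<bar>D (r k) h\<bar> \<le> cn k * norm h"
      unfolding cn_def
      by (rule cotangent_norm_bound[OF has_derivative_bounded_linear[OF Dk] h(1) arclength_tangent_scaleR])
    also have "\<dots> \<le> \<bar>cn k\<bar> * R" using hR by (intro mult_mono) auto
    finally have 1: "\<bar>D (r k) h\<bar> \<le> \<bar>cn k\<bar> * R" .
    have "Ck\<^sup>2 * ((norm h)\<^sup>2 + 8 * L2_sq (d2 (x k))) \<le> Ck\<^sup>2 * (R\<^sup>2 + 8 * K)"
      using h(3) xk(2) by (intro mult_left_mono add_mono) auto
    then have "sqrt \<delta> / (2 * (c / 2) ^ 4) * (Ck\<^sup>2 * ((norm h)\<^sup>2 + 8 * L2_sq (d2 (x k))))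
        \<le> sqrt \<delta> / (2 * (c / 2) ^ 4) * (Ck\<^sup>2 * (R\<^sup>2 + 8 * K))"
      by (rule mult_left_mono) (use c(1) \<delta> in simp)
    also have "\<dots> = sqrt \<delta> * A" by (simp add: A_def)
    finally have 2: "\<theta> * (sqrt \<delta> / (2 * (c / 2) ^ 4) * (Ck\<^sup>2 * ((norm h)\<^sup>2 + 8 * L2_sq (d2 (x k))))
        + 2 * (2 * b * e) / ((c / 2) ^ 4 * \<delta>\<^sup>2)) \<le> \<theta> * (sqrt \<delta> * A + 4 * b * e / ((c / 2) ^ 4 * \<delta>\<^sup>2))"
      using \<theta> by (intro mult_left_mono) auto
    have 3: "\<bar>d2_form (x k) h\<bar> \<le> \<bar>D (r k) h\<bar> + \<theta> * (sqrt \<delta> / (2 * (c / 2) ^ 4) * (Ck\<^sup>2 * ((norm h)\<^sup>2 + 8 * L2_sq (d2 (x k))))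
        + 2 * (2 * b * e) / ((c / 2) ^ 4 * \<delta>\<^sup>2))"
      by (rule first_variation_bound[OF Ck xk(4) h(1) xk(3) c(1) Dk \<theta> \<delta> h(2)])
    have "b * e * L2_sq (d2 (x k)) \<le> b * e * K" using xk(2) b e0 by (intro mult_left_mono) auto
    then show ?thesis using 1 2 3 h(4) by linarith
  qed
  have small: "\<exists>N. \<forall>k\<ge>N. \<forall>j\<ge>N. \<bar>d2_form (x k) (x k - x j)\<bar> \<le> \<epsilon>" if \<epsilon>: "\<epsilon> > 0" for \<epsilon>
  proof -
    \<comment> \<open>\<open>\<delta>\<close> makes the near-diagonal Moebius term at most \<open>\<epsilon> / 4\<close>; only then \<open>e\<close> is chosen, depending on \<open>\<delta>\<close>\<close>
    define \<delta> where "\<delta> = (\<epsilon> / (4 * (\<theta> * A + 1)))\<^sup>2"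
    have tA: "\<theta> * A \<ge> 0" using \<theta> A by simp
    have \<delta>: "\<delta> > 0" using \<epsilon> tA by (simp add: \<delta>_def)
    have "sqrt \<delta> = \<epsilon> / (4 * (\<theta> * A + 1))" using \<epsilon> tA by (simp add: \<delta>_def)
    then have "\<theta> * (sqrt \<delta> * A) = \<epsilon> / 4 * (\<theta> * A / (\<theta> * A + 1))" by simp
    also have "\<dots> \<le> \<epsilon> / 4 * 1" using \<epsilon> tA by (intro mult_left_mono) auto
    finally have s1: "\<theta> * (sqrt \<delta> * A) \<le> \<epsilon> / 4" by simp
    define W where "W = \<theta> * (4 * b / ((c / 2) ^ 4 * \<delta>\<^sup>2)) + b * K"
    have W: "W \<ge> 0" using \<theta> b c(1) \<delta> K0 by (simp add: W_def)
    define e where "e = min 2 (\<epsilon> / (4 * (W + 1)))"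
    have e: "e > 0" "e \<le> 2" using \<epsilon> W by (simp_all add: e_def)
    have "e * W \<le> \<epsilon> / (4 * (W + 1)) * W" using W by (intro mult_right_mono) (auto simp: e_def)
    also have "\<dots> = \<epsilon> / 4 * (W / (W + 1))" by simp
    also have "\<dots> \<le> \<epsilon> / 4 * 1" using \<epsilon> W by (intro mult_left_mono) auto
    finally have s2: "e * W \<le> \<epsilon> / 4" by simp
    have "(\<lambda>k. \<bar>cn k\<bar> * R) \<longlonglongrightarrow> 0" using tendsto_mult_left_zero[OF tendsto_rabs_zero[OF cn0]] .
    then obtain N1 where N1: "\<And>k. k \<ge> N1 \<Longrightarrow> norm (\<bar>cn k\<bar> * R - 0) < \<epsilon> / 4"
      using LIMSEQ_D[of _ 0 "\<epsilon> / 4"] \<epsilon> by (metis divide_pos_pos zero_less_numeral)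
    have "e / 2 > 0" using e by simp
    then obtain N2 where N2: "\<And>k s. k \<ge> N2 \<Longrightarrow> s \<in> {0..1} \<Longrightarrow> norm (velocity (x k) s - g s) < e / 2"
      using unif unfolding x_def by blast
    have "\<bar>d2_form (x k) (x k - x j)\<bar> \<le> \<epsilon>" if kj: "k \<ge> max N1 N2" "j \<ge> max N1 N2" for k j
    proof -
      have "norm (velocity (x k) s - velocity (x j) s) \<le> e" if s: "s \<in> {0..1}" for s
      proof -
        have "norm (velocity (x k) s - g s) < e / 2" "norm (velocity (x j) s - g s) < e / 2"
          using N2 kj s by auto
        then show ?thesis
          using norm_triangle_ineq4[of "velocity (x k) s - g s" "velocity (x j) s - g s"] by simp
      qed
      from key[OF _ _ \<delta> e(2) this] us K
      have "\<bar>d2_form (x k) (x k - x j)\<bar> \<le> \<bar>cn k\<bar> * R + \<theta> * (sqrt \<delta> * A + 4 * b * e / ((c / 2) ^ 4 * \<delta>\<^sup>2)) + b * e * K"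
        unfolding x_def by blast
      also have "\<dots> = \<bar>cn k\<bar> * R + \<theta> * (sqrt \<delta> * A) + e * W" by (simp add: W_def algebra_simps)
      also have "\<dots> \<le> \<epsilon> / 4 + \<epsilon> / 4 + \<epsilon> / 4" using N1[of k] kj s1 s2 by simp
      finally show ?thesis using \<epsilon> by simp
    qed
    then show ?thesis by blast
  qed
  have cau: "\<exists>N. \<forall>i\<ge>N. \<forall>j\<ge>N. L2_sq (\<lambda>s. d2 (x i) s - d2 (x j) s) \<le> e" if e: "e > 0" for e
  proof -
    obtain N where N: "\<And>k j. k \<ge> N \<Longrightarrow> j \<ge> N \<Longrightarrow> \<bar>d2_form (x k) (x k - x j)\<bar> \<le> e / 2"
      using small[of "e / 2"] e by auto
    have "L2_sq (\<lambda>s. d2 (x i) s - d2 (x j) s) \<le> e" if "i \<ge> N" "j \<ge> N" for i j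
    proof -
      have "L2_sq (\<lambda>s. d2 (x i) s - d2 (x j) s) = L2_sq (d2 (x i - x j))"
        by (rule L2_sq_cong_AE) (use d2_diff[of "x i" "x j"] in \<open>auto simp: eq_commute\<close>)
      also have "\<dots> = d2_form (x i) (x i - x j) + d2_form (x j) (x j - x i)"
        unfolding d2_form_self[symmetric] by (simp add: d2_form.diff_left d2_form.diff_right)
      also have "\<dots> \<le> e / 2 + e / 2"
        using N[OF that] N[OF that(2,1)] by linarith
      finally show ?thesis by simp
    qed
    then show ?thesis by blast
  qed
  have unif': "\<exists>N. \<forall>k\<ge>N. \<forall>s\<in>{0..1}. norm (velocity (x k) s - g s) < e" if "e > 0" for e
    using unif[OF that] unfolding x_def by blast
  obtain l where "l \<in> ?M" "x \<longlonglongrightarrow> l"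
    using arclength_curves_limit[of x z c g, OF _ c(1) _ unif' cau] \<gamma>M bil unfolding x_def by blast
  moreover have "x = \<gamma> \<circ> r" by (auto simp: x_def)
  ultimately show "\<exists>l\<in>?M. \<exists>r. strict_mono r \<and> (\<gamma> \<circ> r) \<longlonglongrightarrow> l" using r by auto
qed

theorem theorem1p2:
  fixes \<theta> :: real and z :: "real ^ 'n"
  assumes "CARD('n) \<ge> 2" and "\<theta> > 0"
  shows "palais_smale_condition (total_energy \<theta>) (arclength_curves z) arclength_tangent"
  by (rule palais_smale_arclength[OF assms(2)])

end
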